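(* Let $k$ be an even positive integer, $N$ a positive integer, and $D>0$ a fundamental discriminant with $D\equiv1\pmod{4N}$. Assume $S^{+}_{2k}(N/d)=\{0\}$ for every positive divisor $d$ of $N$. Then $$\zeta_{\mathbb{Q}(\sqrt D)}(k)=(2k-1)D^{1/2-k}\zeta(2k)N^k\binom{2k-2}{k-1}\sum_{d\mid N}d^{-2k}\prod_{p\mid (N/d)}(1-p^{-2k})\sum_{\substack{b\in\mathbb{Z},\ |b|<\sqrt D\\ b\equiv1\pmod{2N/d}}}\sigma_{k-1}\!\left(\frac{d(D-b^2)}{4N}\right).$$
   Context: $\zeta_{\mathbb{Q}(\sqrt D)}$ is the Dedekind zeta function of $\mathbb{Q}(\sqrt D)$, $\zeta$ the Riemann zeta function, $\sigma_{k-1}(m)=\sum_{0<e\mid m}e^{k-1}$, $p$ runs over primes. For a positive integer $M$, $S_{2k}(M)$ is the space of cusp forms of weight $2k$ on $\Gamma_0(M)$, $W_M:=\begin{pmatrix}0&-1/\sqrt M\\ \sqrt M&0\end{pmatrix}$ is the Fricke involution, with slash operator $(f|_{2k}g)(z)=(\det g)^k(\gamma z+\delta)^{-2k}f(\frac{\alpha z+\beta}{\gamma z+\delta})$ for $g=\begin{pmatrix}\alpha&\beta\\\gamma&\delta\end{pmatrix}\in\mathrm{GL}_2^+(\mathbb{R})$, and $S^{+}_{2k}(M):=\{f\in S_{2k}(M):f|_{2k}W_M=f\}$. *)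

theory Defs
  imports "HOL-Analysis.Analysis" "HOL-Computational_Algebra.Polynomial"
    "HOL-Computational_Algebra.Squarefree"
begin

definition fundamental_discriminant :: "int \<Rightarrow> bool" where
  "fundamental_discriminant D \<longleftrightarrow> D \<noteq> 1 \<and>
     ((D mod 4 = 1 \<and> squarefree D) \<or>
      (\<exists>m. D = 4 * m \<and> (m mod 4 = 2 \<or> m mod 4 = 3) \<and> squarefree m))"

definition quad_field :: "int \<Rightarrow> real set" where
  "quad_field D = {x. \<exists>a b :: rat. x = of_rat a + of_rat b * sqrt (of_int D)}"

definition alg_integer :: "real \<Rightarrow> bool" where
  "alg_integer x \<longleftrightarrow> (\<exists>p :: int poly. lead_coeff p = 1 \<and> poly (map_poly of_int p) x = 0)"

definition ring_of_integers :: "int \<Rightarrow> real set" where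
  "ring_of_integers D = {x \<in> quad_field D. alg_integer x}"

definition is_ideal :: "int \<Rightarrow> real set \<Rightarrow> bool" where
  "is_ideal D I \<longleftrightarrow> I \<subseteq> ring_of_integers D \<and> 0 \<in> I \<and>
     (\<forall>x\<in>I. \<forall>y\<in>I. x + y \<in> I) \<and>
     (\<forall>x\<in>I. \<forall>r\<in>ring_of_integers D. r * x \<in> I)"

definition ideal_norm :: "int \<Rightarrow> real set \<Rightarrow> nat" where
  "ideal_norm D I = card (ring_of_integers D //
      {(x, y). x \<in> ring_of_integers D \<and> y \<in> ring_of_integers D \<and> x - y \<in> I})"

definition dedekind_zeta :: "int \<Rightarrow> nat \<Rightarrow> real" where
  "dedekind_zeta D s = infsum (\<lambda>I. 1 / real (ideal_norm D I) ^ s)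
      {I. is_ideal D I \<and> I \<noteq> {0}}"

definition riemann_zeta_nat :: "nat \<Rightarrow> real" where
  "riemann_zeta_nat s = (\<Sum>n. 1 / real (Suc n) ^ s)"

definition sigma_div :: "nat \<Rightarrow> nat \<Rightarrow> real" where
  "sigma_div j m = (\<Sum>e\<in>{e. 0 < e \<and> e dvd m}. real e ^ j)"

definition upper_half :: "complex set" where
  "upper_half = {z. 0 < Im z}"

definition slash :: "nat \<Rightarrow> real \<times> real \<times> real \<times> real \<Rightarrow> (complex \<Rightarrow> complex) \<Rightarrow> complex \<Rightarrow> complex" where
  "slash k g f z = (case g of (\<alpha>, \<beta>, \<gamma>, \<delta>) \<Rightarrow>
      complex_of_real (\<alpha> * \<delta> - \<beta> * \<gamma>) ^ k / (of_real \<gamma> * z + of_real \<delta>) ^ (2 * k)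
      * f ((of_real \<alpha> * z + of_real \<beta>) / (of_real \<gamma> * z + of_real \<delta>)))"

definition int_mat :: "int \<times> int \<times> int \<times> int \<Rightarrow> real \<times> real \<times> real \<times> real" where
  "int_mat g = (case g of (a, b, c, d) \<Rightarrow> (of_int a, of_int b, of_int c, of_int d))"

definition SL2Z :: "(int \<times> int \<times> int \<times> int) set" where
  "SL2Z = {(a, b, c, d). a * d - b * c = 1}"

definition Gamma0 :: "nat \<Rightarrow> (int \<times> int \<times> int \<times> int) set" where
  "Gamma0 M = {(a, b, c, d). a * d - b * c = 1 \<and> int M dvd c}"

text \<open>Cusp forms of weight 2k on Gamma_0(M): holomorphic on the upper half plane,
  invariant under the weight-2k slash action of Gamma_0(M), and vanishing at every cusp
  (for every gamma in SL2(Z), (f|gamma)(z) tends to 0 as Im z tends to infinity,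
  uniformly in Re z).\<close>
definition cusp_form :: "nat \<Rightarrow> nat \<Rightarrow> (complex \<Rightarrow> complex) \<Rightarrow> bool" where
  "cusp_form k M f \<longleftrightarrow>
     f holomorphic_on upper_half \<and>
     (\<forall>g\<in>Gamma0 M. \<forall>z\<in>upper_half. slash k (int_mat g) f z = f z) \<and>
     (\<forall>g\<in>SL2Z. \<forall>\<epsilon>>0. \<exists>Y. \<forall>z. Y < Im z \<longrightarrow> norm (slash k (int_mat g) f z) < \<epsilon>)"

definition fricke :: "nat \<Rightarrow> real \<times> real \<times> real \<times> real" where
  "fricke M = (0, - 1 / sqrt (real M), sqrt (real M), 0)"

definition cusp_form_plus :: "nat \<Rightarrow> nat \<Rightarrow> (complex \<Rightarrow> complex) \<Rightarrow> bool" where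
  "cusp_form_plus k M f \<longleftrightarrow> cusp_form k M f \<and>
     (\<forall>z\<in>upper_half. slash k (fricke M) f z = f z)"

end

theory Submission
  imports Defs "HOL-Complex_Analysis.Cauchy_Integral_Formula" "HOL-Probability.Sinc_Integral"
begin

text \<open>
  Following Zagier, let \<open>H\<^sub>M(x)\<close> be the sum of \<open>max(0, - sgn(a) q(x))\<^sup>k\<^sup>-\<^sup>1\<close> over the quadratic forms
  \<open>q = (a, b, c)\<close> of discriminant \<open>D\<close> with \<open>M | a\<close> and \<open>b \<equiv> 1 (mod 2 M)\<close>. A Beta integral shows that the
  integral of \<open>H\<^sub>M(t) (z - t)\<^sup>-\<^sup>2\<^sup>k\<close> over the real line is a constant times \<open>f\<^sub>M(z) = \<Sum> q(z)\<^sup>-\<^sup>k\<close>. Boundedness of \<open>H\<^sub>M\<close>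
  (by Euclid's algorithm) makes \<open>f\<^sub>M\<close> a cusp form, which is invariant under the Fricke involution since
  \<open>k\<close> is even. If \<open>f\<^sub>M = 0\<close>, then the Poisson integral of the periodic function \<open>H\<^sub>M\<close> is constant, so that
  \<open>H\<^sub>M(0)\<close>, a finite divisor sum, equals the mean of \<open>H\<^sub>M\<close> over a period, which unfolds to a Dirichlet
  series \<open>G(M)\<close> counting the primitive ideals contained in the ideal \<open>\<nn>\<^sub>M\<close> generated by \<open>M\<close> and \<open>(1 + \<surd>D)/2\<close>.
  Finally, \<open>I \<mapsto> \<nn>\<^sub>N I\<close> multiplies norms by \<open>N\<close>, and an ideal \<open>t J\<close> with \<open>J\<close> primitive lies in \<open>\<nn>\<^sub>N\<close>
  if and only if \<open>J\<close> lies in the ideal \<open>\<nn>\<^sub>M\<close> with \<open>M = N / gcd(N, t)\<close>. Hence \<open>N\<^sup>-\<^sup>k\<close> times the Dedekind zeta value is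
  the sum of \<open>t\<^sup>-\<^sup>2\<^sup>k G(N / gcd(N, t))\<close> over all \<open>t\<close>, and sorting by \<open>d = gcd(N, t)\<close> gives the formula.
\<close>

subsection \<open>Poisson integrals and Cauchy kernels\<close>

text \<open>The obstacle is that vanishing of \<open>form_series\<close> speaks only about the
  kernels (z - t)^(-2k), whereas recovering \<open>bump_sum\<close> needs the Poisson kernel, the
  imaginary part of -1/(z - t). The exponent is lowered one at a time by integrating in z. Each
  integration constant vanishes as z tends to i infinity, except at the last step: 1/(z - t) need
  not be integrable against a bounded function, only differences survive, and so the Poisson
  integral is constant rather than zero. The factor -sgn(a) confines each nonnegative summand to the
  interval between the real roots of q. One uniform bound on finite partial sums then yields
  absolute convergence, termwise integration and decay at all cusps. Since forms of level M are
  among those of level 1, that bound is proved only for M = 1. The integral of a bump over the line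
  and its kernel integral share the factor B(k, k) D^(k - 1/2), whose reciprocal is (2k - 1)
  binomial(2k - 2, k - 1) D^(1/2 - k).\<close>

lemma integrable_cauchy_kernel: "integrable lborel (\<lambda>x::real. 1 / (1 + x\<^sup>2))"
  using integrable_inverse_1_plus_square
  by (simp add: set_integrable_def einterval_def inverse_eq_divide)

lemma integral_cauchy_kernel: "(LBINT x. 1 / (1 + x\<^sup>2)) = pi"
  using LBINT_inverse_1_plus_square
  by (simp add: interval_lebesgue_integral_def set_lebesgue_integral_def einterval_def inverse_eq_divide)

lemma Im_le_norm_minus_real: "0 < Im z \<Longrightarrow> Im z \<le> norm (z - of_real t)"
  using abs_Im_le_cmod[of "z - of_real t"] by simp

text \<open>Triangle inequality, with |w - z| absorbed through Im z \<le> |z - t|. The factor is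
  independent of t, so it applies to kernels (w = i) as well as to the real roots of a form.\<close>

lemma norm_minus_real_le:
  assumes "0 < Im z"
  shows "norm (w - of_real t) \<le> (1 + norm (w - z) / Im z) * norm (z - of_real t)"
proof -
  have "norm (w - of_real t) \<le> norm (w - z) + norm (z - of_real t)"
    using norm_triangle_ineq[of "w - z" "z - of_real t"] by simp
  also have "norm (w - z) = norm (w - z) / Im z * Im z" using assms by simp
  also have "\<dots> \<le> norm (w - z) / Im z * norm (z - of_real t)"
    using assms Im_le_norm_minus_real[OF assms, of t] by (intro mult_left_mono) auto
  finally show ?thesis by (simp add: algebra_simps)
qed

lemma norm_ii_minus_real: "norm (\<i> - of_real t) ^ 2 = 1 + t\<^sup>2"
  by (simp add: cmod_power2)

text \<open>Two of the n factors are compared with |i - t|^2 = 1 + t^2, the others are at least m.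
  The constant depends only on m and R, so it is uniform along a segment in the upper half
  plane.\<close>

lemma kernel_bound:
  assumes m: "0 < m" "m \<le> Im z" and R: "norm (\<i> - z) \<le> R" and n: "2 \<le> n"
  shows "norm (1 / (z - of_real t) ^ n) \<le> ((1 + R / m)\<^sup>2 / m ^ (n - 2)) * (1 / (1 + t\<^sup>2))"
proof -
  have z: "0 < Im z" and R0: "0 \<le> R" using m R norm_ge_zero order_trans by (linarith, blast)
  have mn: "m \<le> norm (z - of_real t)" using Im_le_norm_minus_real[OF z, of t] m by linarith
  have "norm (\<i> - of_real t) \<le> (1 + norm (\<i> - z) / Im z) * norm (z - of_real t)"
    by (rule norm_minus_real_le[OF z])
  also have "\<dots> \<le> (1 + R / m) * norm (z - of_real t)"
    using m R z R0 by (intro mult_right_mono add_left_mono frac_le) auto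
  finally have "norm (\<i> - of_real t) ^ 2 \<le> ((1 + R / m) * norm (z - of_real t)) ^ 2"
    by (intro power_mono) auto
  then have A: "1 + t\<^sup>2 \<le> (1 + R / m)\<^sup>2 * norm (z - of_real t) ^ 2"
    by (simp only: norm_ii_minus_real power_mult_distrib)
  have B: "m ^ (n - 2) \<le> norm (z - of_real t) ^ (n - 2)" using mn m by (intro power_mono) auto
  have t: "0 < 1 + t\<^sup>2" by (simp add: add_pos_nonneg)
  have "m ^ (n - 2) * (1 + t\<^sup>2) \<le> norm (z - of_real t) ^ (n - 2) * ((1 + R / m)\<^sup>2 * norm (z - of_real t) ^ 2)"
    using A B m t by (intro mult_mono) auto
  also have "\<dots> = (1 + R / m)\<^sup>2 * norm (z - of_real t) ^ n"
    by (simp only: mult_ac power_add[symmetric] le_add_diff_inverse[OF n])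
  finally have "m ^ (n - 2) * (1 + t\<^sup>2) \<le> (1 + R / m)\<^sup>2 * norm (z - of_real t) ^ n" .
  moreover have "0 < norm (z - of_real t) ^ n" using mn m by (intro zero_less_power) auto
  ultimately show ?thesis using m t
    by (simp add: norm_divide norm_power divide_simps mult_ac)
qed

lemma integrable_kernel:
  assumes z: "0 < Im z" and n: "2 \<le> n"
  shows "integrable lborel (\<lambda>t::real. 1 / (z - complex_of_real t) ^ n)"
proof (rule Bochner_Integration.integrable_bound)
  show "integrable lborel (\<lambda>t::real. ((1 + norm (\<i> - z) / Im z)\<^sup>2 / Im z ^ (n - 2)) * (1 / (1 + t\<^sup>2)))"
    by (intro integrable_mult_right integrable_cauchy_kernel)
  show "AE t in lborel. norm (1 / (z - complex_of_real t) ^ n) \<le>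
     norm (((1 + norm (\<i> - z) / Im z)\<^sup>2 / Im z ^ (n - 2)) * (1 / (1 + t\<^sup>2)))"
    using kernel_bound[OF z order_refl order_refl n]
    by (intro AE_I2) (smt (verit) real_norm_def)
qed measurable

lemma integrable_bounded_mult:
  fixes H :: "real \<Rightarrow> real" and g :: "real \<Rightarrow> 'a::{banach, second_countable_topology, real_normed_algebra}"
  assumes [measurable]: "H \<in> borel_measurable borel" and H: "\<And>x. \<bar>H x\<bar> \<le> K" and g: "integrable lborel g"
  shows "integrable lborel (\<lambda>t. H t *\<^sub>R g t)"
proof (rule Bochner_Integration.integrable_bound)
  show "integrable lborel (\<lambda>t. K * norm (g t))" using g by simp
  show "AE t in lborel. norm (H t *\<^sub>R g t) \<le> norm (K * norm (g t))"
    using H by (intro AE_I2) (simp add: abs_mult, smt (verit) mult_right_mono norm_ge_zero)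
qed (use g in measurable)

text \<open>Fubini on the strip [0, 1] x R in the one form used below: s is the parameter of a
  segment, or the base point running over a period.\<close>

lemma integral_swap_cauchy_bound:
  fixes g :: "real \<Rightarrow> real \<Rightarrow> 'a::{banach, second_countable_topology}"
  assumes meas [measurable]: "case_prod g \<in> borel_measurable (lborel \<Otimes>\<^sub>M lborel)"
    and bound: "\<And>s t. norm (g s t) \<le> indicator {0..1} s * (C * (1 / (1 + t\<^sup>2)))"
  shows "(LBINT t. (LBINT s. g s t)) = (LBINT s. (LBINT t. g s t))"
proof (rule lborel_pair.Fubini_integral, rule lborel_pair.Fubini_integrable)
  have [measurable]: "g s \<in> borel_measurable lborel" for s
    using measurable_Pair2[OF meas, of s] by simp
  have int_t: "integrable lborel (g s)" for s
  proof (rule Bochner_Integration.integrable_bound)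
    show "integrable lborel (\<lambda>t. indicator {0..1} s * (C * (1 / (1 + t\<^sup>2))))"
      by (intro integrable_mult_right integrable_cauchy_kernel)
    show "AE t in lborel. norm (g s t) \<le> norm (indicator {0..1} s * (C * (1 / (1 + t\<^sup>2))))"
      using bound[of s] by (intro AE_I2) (smt (verit) real_norm_def)
  qed measurable
  then show "AE s in lborel. integrable lborel (\<lambda>t. case (s, t) of (s, t) \<Rightarrow> g s t)" by simp
  show "integrable lborel (\<lambda>s. LBINT t. norm (case (s, t) of (s, t) \<Rightarrow> g s t))"
  proof (rule Bochner_Integration.integrable_bound)
    show "integrable lborel (\<lambda>s::real. indicator {0..1} s *\<^sub>R (C * pi))"
      by (rule integrable_real_indicator[THEN integrable_scaleR_left]) auto
    show "AE s in lborel. norm (LBINT t. norm (case (s, t) of (s, t) \<Rightarrow> g s t)) \<le> norm (indicator {0..1} s *\<^sub>R (C * pi))"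
    proof (rule AE_I2)
      fix s
      have "(LBINT t. norm (g s t)) \<le> (LBINT t. indicator {0..1} s * (C * (1 / (1 + t\<^sup>2))))"
        using integrable_cauchy_kernel int_t by (intro integral_mono bound integrable_mult_right) auto
      also have "\<dots> = indicator {0..1} s * (C * pi)" by (simp only: integral_mult_right_zero integral_cauchy_kernel)
      finally show "norm (LBINT t. norm (case (s, t) of (s, t) \<Rightarrow> g s t)) \<le> norm (indicator {0..1} s *\<^sub>R (C * pi))"
        by (simp add: integral_nonneg_AE)
    qed
  qed measurable
qed measurable

lemma kernel_difference:
  assumes z1: "0 < Im z1" and z2: "0 < Im z2"
  shows "(LBINT s. indicator {0..1} s *\<^sub>R (- of_nat n * (z2 - z1) / (z1 + of_real s * (z2 - z1) - of_real t) ^ Suc n))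
     = 1 / (z2 - of_real t) ^ n - 1 / (z1 - of_real t) ^ n"
proof -
  have ne: "z1 + of_real s * (z2 - z1) - of_real t \<noteq> 0" if "0 \<le> s" "s \<le> 1" for s :: real
  proof -
    have "0 < (1 - s) * Im z1 + s * Im z2"
      using that z1 z2 by (cases "s = 0") (auto intro: add_nonneg_pos)
    then have "Im (z1 + of_real s * (z2 - z1) - of_real t) \<noteq> 0" by (simp add: algebra_simps)
    then show ?thesis by force
  qed
  have "(LBINT s. indicator {0..1} s *\<^sub>R (- of_nat n * (z2 - z1) / (z1 + of_real s * (z2 - z1) - of_real t) ^ Suc n))
     = 1 / (z1 + of_real 1 * (z2 - z1) - of_real t) ^ n - 1 / (z1 + of_real 0 * (z2 - z1) - of_real t) ^ n"
  proof (rule integral_FTC_atLeastAtMost)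
    fix s :: real assume s: "0 \<le> s" "s \<le> 1"
    have alg: "- (inverse (u ^ n) * (of_nat n * (v * u ^ (n - Suc 0))) * inverse (u ^ n)) = - of_nat n * v / u ^ Suc n"
      if "u \<noteq> 0" for u v :: complex
      using that by (cases n) (auto simp: field_simps)
    have d: "((\<lambda>w. 1 / (z1 + w * (z2 - z1) - of_real t) ^ n) has_field_derivative
      (- of_nat n * (z2 - z1) / (z1 + of_real s * (z2 - z1) - of_real t) ^ Suc n)) (at (of_real s))"
      using ne[OF s]
      unfolding inverse_eq_divide[symmetric] alg[OF ne[OF s], symmetric]
      by (intro DERIV_inverse' DERIV_power) (auto intro!: derivative_eq_intros)
    show "((\<lambda>s. 1 / (z1 + of_real s * (z2 - z1) - of_real t) ^ n) has_vector_derivative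
      (- of_nat n * (z2 - z1) / (z1 + of_real s * (z2 - z1) - of_real t) ^ Suc n)) (at s within {0..1})"
      using field_vector_diff_chain_within[OF has_vector_derivative_of_real[OF DERIV_ident] DERIV_subset[OF d subset_UNIV]]
      by (simp add: o_def)
  qed (use ne in \<open>auto intro!: continuous_intros\<close>)
  then show ?thesis by simp
qed

text \<open>Integrating the vanishing along the segment from z1 to z2 lowers the exponent by one.
  The conclusion is about a difference because for n = 1 the two single integrals need not
  converge.\<close>

lemma kernel_descent:
  fixes H :: "real \<Rightarrow> real"
  assumes [measurable]: "H \<in> borel_measurable borel" and H: "\<And>x. \<bar>H x\<bar> \<le> K" and n: "1 \<le> n"
    and zero: "\<And>z. 0 < Im z \<Longrightarrow> (LBINT t. H t *\<^sub>R (1 / (z - of_real t) ^ Suc n)) = 0"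
    and z1: "0 < Im z1" and z2: "0 < Im z2"
  shows "(LBINT t. H t *\<^sub>R (1 / (z2 - of_real t) ^ n - 1 / (z1 - of_real t) ^ n)) = 0"
proof -
  define w where "w s = z1 + of_real s * (z2 - z1)" for s :: real
  define c where "c = - of_nat n * (z2 - z1)"
  define g where "g s t = indicator {0..1} s *\<^sub>R (H t *\<^sub>R (c / (w s - of_real t) ^ Suc n))" for s t :: real
  define m where "m = min (Im z1) (Im z2)"
  define R where "R = norm (\<i> - z1) + norm (z2 - z1)"
  define C where "C = \<bar>K\<bar> * (norm c * ((1 + R / m)\<^sup>2 / m ^ (Suc n - 2)))"
  have m: "0 < m" using z1 z2 by (simp add: m_def)
  have w_Im: "m \<le> Im (w s)" if "0 \<le> s" "s \<le> 1" for s
  proof -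
    have "(1 - s) * m + s * m \<le> (1 - s) * Im z1 + s * Im z2"
      using that by (intro add_mono mult_left_mono) (auto simp: m_def)
    then show ?thesis by (simp add: w_def algebra_simps)
  qed
  have w_R: "norm (\<i> - w s) \<le> R" if "0 \<le> s" "s \<le> 1" for s
  proof -
    have "norm (\<i> - w s) \<le> norm (\<i> - z1) + norm (of_real s * (z2 - z1))"
      unfolding w_def using norm_triangle_ineq4[of "\<i> - z1" "of_real s * (z2 - z1)"] by (simp add: algebra_simps)
    also have "norm (of_real s * (z2 - z1)) \<le> 1 * norm (z2 - z1)"
      unfolding norm_mult using that by (intro mult_right_mono) auto
    finally show ?thesis by (simp add: R_def)
  qed
  have g_bound: "norm (g s t) \<le> indicator {0..1} s * (C * (1 / (1 + t\<^sup>2)))" for s t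
  proof (cases "0 \<le> s \<and> s \<le> 1")
    case True
    have "norm (c / (w s - of_real t) ^ Suc n) = norm c * norm (1 / (w s - of_real t) ^ Suc n)"
      by (simp add: norm_divide)
    also have "\<dots> \<le> norm c * (((1 + R / m)\<^sup>2 / m ^ (Suc n - 2)) * (1 / (1 + t\<^sup>2)))"
      using True n by (intro mult_left_mono kernel_bound m w_Im w_R) auto
    finally have "\<bar>H t\<bar> * norm (c / (w s - of_real t) ^ Suc n) \<le>
        \<bar>K\<bar> * (norm c * (((1 + R / m)\<^sup>2 / m ^ (Suc n - 2)) * (1 / (1 + t\<^sup>2))))"
      using H[of t] by (intro mult_mono) auto
    then show ?thesis using True by (simp add: g_def C_def mult_ac)
  qed (auto simp: g_def)
  have [measurable]: "(\<lambda>x. case x of (s, t) \<Rightarrow> g s t) \<in> borel_measurable (lborel \<Otimes>\<^sub>M lborel)"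
    unfolding g_def w_def by measurable
  have inner: "(LBINT t. g s t) = 0" for s
  proof (cases "0 \<le> s \<and> s \<le> 1")
    case True
    have "g s = (\<lambda>t. c * (H t *\<^sub>R (1 / (w s - of_real t) ^ Suc n)))"
      using True by (auto simp: g_def fun_eq_iff)
    moreover have "0 < Im (w s)" using w_Im[of s] True m by linarith
    ultimately show ?thesis by (simp only: integral_mult_right_zero zero mult_zero_right)
  qed (auto simp: g_def)
  have "(LBINT t. (LBINT s. g s t)) = (LBINT s. (LBINT t. g s t))"
    by (rule integral_swap_cauchy_bound[OF _ g_bound]) measurable
  then have "(LBINT t. (LBINT s. g s t)) = 0" by (simp add: inner)
  moreover have "(LBINT s. g s t) = H t *\<^sub>R (1 / (z2 - of_real t) ^ n - 1 / (z1 - of_real t) ^ n)" for t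
    unfolding kernel_difference[OF z1 z2, symmetric] g_def w_def c_def
    by (simp only: scaleR_left_commute[of _ "H t"] integral_scaleR_right)
  ultimately show ?thesis by simp
qed

text \<open>For n \<ge> 2 the single integrals converge, so the integral is independent of z; moving
  z up the imaginary axis shows that its value is 0.\<close>

lemma kernel_zero_descent:
  fixes H :: "real \<Rightarrow> real"
  assumes [measurable]: "H \<in> borel_measurable borel" and H: "\<And>x. \<bar>H x\<bar> \<le> K" and n: "2 \<le> n"
    and zero: "\<And>z. 0 < Im z \<Longrightarrow> (LBINT t. H t *\<^sub>R (1 / (z - of_real t) ^ Suc n)) = 0"
    and z: "0 < Im z"
  shows "(LBINT t. H t *\<^sub>R (1 / (z - of_real t) ^ n)) = 0"
proof -
  define J where "J = (\<lambda>z::complex. LBINT t. H t *\<^sub>R (1 / (z - of_real t) ^ n))"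
  \<comment> \<open>Starting at height 1 keeps \<open>Im (v j) ^ (n - 2)\<close> at least 1, so one
    dominating function serves all j.\<close>
  define v where "v j = \<i> * of_real (real (Suc j))" for j
  have v: "0 < Im (v j)" for j by (simp add: v_def)
  have "J z = J (v j)" for j
  proof -
    have "(LBINT t. H t *\<^sub>R (1 / (z - of_real t) ^ n - 1 / (v j - of_real t) ^ n)) = 0"
      using n by (intro kernel_descent[OF assms(1) H _ zero v z]) auto
    then show ?thesis unfolding J_def scaleR_diff_right
      using integrable_bounded_mult[OF assms(1) H integrable_kernel[OF z n]]
        integrable_bounded_mult[OF assms(1) H integrable_kernel[OF v n]]
      by (subst (asm) Bochner_Integration.integral_diff) auto
  qed
  moreover have "(\<lambda>j. J (v j)) \<longlonglongrightarrow> (\<integral>t. 0 \<partial>(lborel :: real measure))"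
    unfolding J_def
  proof (rule integral_dominated_convergence)
    show "integrable lborel (\<lambda>t. \<bar>K\<bar> * (4 * (1 / (1 + t\<^sup>2))))"
      by (intro integrable_mult_right integrable_cauchy_kernel)
    show "AE t in lborel. norm (H t *\<^sub>R (1 / (v j - complex_of_real t) ^ n)) \<le> \<bar>K\<bar> * (4 * (1 / (1 + t\<^sup>2)))" for j
    proof (rule AE_I2)
      fix t
      have "norm (\<i> - v j) \<le> Im (v j)"
      proof -
        have "\<i> - v j = \<i> * of_real (- real j)" by (simp add: v_def algebra_simps)
        then show ?thesis by (simp only: norm_mult norm_of_real) (simp add: v_def)
      qed
      then have "norm (1 / (v j - of_real t) ^ n) \<le> ((1 + Im (v j) / Im (v j))\<^sup>2 / Im (v j) ^ (n - 2)) * (1 / (1 + t\<^sup>2))"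
        by (intro kernel_bound v n order_refl)
      \<comment> \<open>The 4 is (1 + 1)^2: the distance from i to \<open>v j\<close> is at most
        \<open>Im (v j)\<close>.\<close>
      also have "\<dots> \<le> (4 / 1) * (1 / (1 + t\<^sup>2))"
        using v[of j] by (intro mult_right_mono frac_le) (auto simp: v_def intro!: one_le_power)
      finally show "norm (H t *\<^sub>R (1 / (v j - complex_of_real t) ^ n)) \<le> \<bar>K\<bar> * (4 * (1 / (1 + t\<^sup>2)))"
        using H[of t] unfolding norm_scaleR by (intro mult_mono) auto
    qed
    show "AE t in lborel. (\<lambda>j. H t *\<^sub>R (1 / (v j - complex_of_real t) ^ n)) \<longlonglongrightarrow> 0"
    proof (rule AE_I2)
      fix t
      have "filterlim (\<lambda>j. real (Suc j)) at_top sequentially"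
        by (rule filterlim_compose[OF filterlim_real_sequentially filterlim_Suc])
      moreover have "norm (v j - of_real t) \<ge> real (Suc j)" for j
        using Im_le_norm_minus_real[OF v, of j t] by (simp add: v_def)
      ultimately have "filterlim (\<lambda>j. norm (v j - of_real t)) at_top sequentially"
        by (auto intro: filterlim_at_top_mono)
      then have "filterlim (\<lambda>j. v j - of_real t) at_infinity sequentially"
        by (rule filterlim_norm_at_top_imp_at_infinity)
      then have "(\<lambda>j. inverse (v j - of_real t)) \<longlonglongrightarrow> 0"
        by (rule filterlim_compose[OF tendsto_inverse_0])
      then have "(\<lambda>j. H t *\<^sub>R (inverse (v j - of_real t) ^ n)) \<longlonglongrightarrow> H t *\<^sub>R (0 ^ n)"
        by (intro tendsto_intros)
      then show "(\<lambda>j. H t *\<^sub>R (1 / (v j - of_real t) ^ n)) \<longlonglongrightarrow> 0"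
        using n by (simp add: inverse_eq_divide power_one_over power_0_left)
    qed
  qed measurable
  ultimately have "(\<lambda>j. J z) \<longlonglongrightarrow> 0" by simp
  then show ?thesis unfolding J_def by (simp add: LIMSEQ_const_iff)
qed

lemma periodic_integral_shift:
  fixes H :: "real \<Rightarrow> real"
  assumes [measurable]: "H \<in> borel_measurable borel" and H: "\<And>x. \<bar>H x\<bar> \<le> K" and per: "\<And>x. H (x + 1) = H x"
  shows "(LBINT x. indicator {0..<1} x * H (x + c)) = (LBINT x. indicator {0..<1} x * H x)"
proof -
  have per_nat: "H (x + of_nat j) = H x" for x j
    by (induction j) (use per[of "x + of_nat _"] in \<open>auto simp: algebra_simps\<close>)
  have per_int: "H (x + of_int j) = H x" for x j
    using per_nat[of x "nat j"] per_nat[of "x + of_int j" "nat (-j)"] by (cases "0 \<le> j") auto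
  define \<theta> where "\<theta> = frac c"
  have \<theta>: "0 \<le> \<theta>" "\<theta> < 1" by (auto simp: \<theta>_def frac_lt_1)
  have int: "integrable lborel (\<lambda>x. indicator {a..<b} x * H x)" for a b
  proof -
    have "integrable lborel (indicator {a..<b} :: real \<Rightarrow> real)"
      by (cases "a \<le> b") auto
    from integrable_bounded_mult[OF assms(1) H this] show ?thesis
      by (simp add: mult.commute)
  qed
  have shift: "(LBINT x. indicator {a..<b} (x + d) * H (x + d)) = (LBINT x. indicator {a..<b} x * H x)" for a b d
    using lborel_integral_real_affine[of 1 "\<lambda>x. indicator {a..<b} x * H x" d] by (simp add: add.commute)
  have "H (x + c) = H (x + \<theta>)" for x
    using per_int[of "x + \<theta>" "\<lfloor>c\<rfloor>"] by (simp add: \<theta>_def frac_def algebra_simps)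
  then have "(LBINT x. indicator {0..<1} x * H (x + c)) = (LBINT x. indicator {\<theta>..<1+\<theta>} (x + \<theta>) * H (x + \<theta>))"
    by (intro Bochner_Integration.integral_cong) (auto simp: indicator_def)
  also have "\<dots> = (LBINT x. indicator {\<theta>..<1+\<theta>} x * H x)" by (rule shift)
  also have "\<dots> = (LBINT x. indicator {\<theta>..<1} x * H x + indicator {1..<1+\<theta>} x * H x)"
    using \<theta> by (intro Bochner_Integration.integral_cong) (auto simp: indicator_def)
  also have "\<dots> = (LBINT x. indicator {\<theta>..<1} x * H x) + (LBINT x. indicator {1..<1+\<theta>} x * H x)"
    by (intro Bochner_Integration.integral_add int)
  also have "(LBINT x. indicator {1..<1+\<theta>} x * H x) = (LBINT x. indicator {1..<1+\<theta>} (x + 1) * H (x + 1))"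
    by (rule shift[symmetric])
  also have "\<dots> = (LBINT x. indicator {0..<\<theta>} x * H x)"
    using per by (intro Bochner_Integration.integral_cong) (auto simp: indicator_def)
  also have "(LBINT x. indicator {\<theta>..<1} x * H x) + (LBINT x. indicator {0..<\<theta>} x * H x) =
     (LBINT x. indicator {\<theta>..<1} x * H x + indicator {0..<\<theta>} x * H x)"
    by (intro Bochner_Integration.integral_add[symmetric] int)
  also have "\<dots> = (LBINT x. indicator {0..<1} x * H x)"
    using \<theta> by (intro Bochner_Integration.integral_cong) (auto simp: indicator_def)
  finally show ?thesis .
qed

text \<open>The vanishing of all the integrals against \<open>(z - t)\<^sup>-\<^sup>2\<close> makes the Poisson integral of \<open>H\<close>
  constant on the upper half plane; its boundary value at 0 is \<open>H 0\<close>, and its horizontal mean is the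
  mean of \<open>H\<close>.\<close>

lemma value_eq_mean_if_kernel_integrals_vanish:
  fixes H :: "real \<Rightarrow> real"
  assumes meas [measurable]: "H \<in> borel_measurable borel" and H: "\<And>x. \<bar>H x\<bar> \<le> K" and per: "\<And>x. H (x + 1) = H x"
    and cont: "isCont H 0" and n: "2 \<le> n"
    and zero: "\<And>z. 0 < Im z \<Longrightarrow> (LBINT t. H t *\<^sub>R (1 / (z - of_real t) ^ n)) = 0"
  shows "H 0 = (LBINT x. indicator {0..<1} x * H x)"
proof -
  have zero2: "(LBINT t. H t *\<^sub>R (1 / (z - of_real t) ^ 2)) = 0" if "0 < Im z" for z
    using n zero that
  proof (induction n arbitrary: z rule: dec_induct)
    case (step j)
    show ?case
      using step.hyps step.prems by (intro step.IH) (auto intro: kernel_zero_descent[OF meas H])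
  qed auto
  \<comment> \<open>The Poisson integral after substituting t = x + y s. Here the kernel no longer
    depends on the point, so the limit y -> 0 and the mean over x act on \<open>H\<close>
    alone.\<close>
  define A where "A x y = (LBINT s. H (x + y * s) * (1 / (1 + s\<^sup>2)))" for x y
  define P where "P x y t = y / ((x - t)\<^sup>2 + y\<^sup>2)" for x y t :: real
  have A_P: "A x y = (LBINT t. H t * P x y t)" if y: "0 < y" for x y
  proof -
    have "(LBINT t. H t * P x y t) = y *\<^sub>R (LBINT s. H (x + y * s) * P x y (x + y * s))"
      using lborel_integral_real_affine[of y "\<lambda>t. H t * P x y t" x] y by simp
    also have "\<dots> = (LBINT s. y *\<^sub>R (H (x + y * s) * P x y (x + y * s)))" by simp
    also have "\<dots> = A x y" unfolding A_def
    proof (intro Bochner_Integration.integral_cong refl)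
      fix s
      show "y *\<^sub>R (H (x + y * s) * P x y (x + y * s)) = H (x + y * s) * (1 / (1 + s\<^sup>2))"
      proof -
        have "(x - (x + y * s))\<^sup>2 + y\<^sup>2 = y\<^sup>2 * (1 + s\<^sup>2)" by (simp add: algebra_simps power2_eq_square)
        then have "y * P x y (x + y * s) = 1 / (1 + s\<^sup>2)"
          using y by (simp only: P_def) (simp add: power2_eq_square)
        moreover have "y *\<^sub>R (H (x + y * s) * P x y (x + y * s)) = H (x + y * s) * (y * P x y (x + y * s))" by simp
        ultimately show ?thesis by (simp only:)
      qed
    qed
    finally show ?thesis by simp
  qed
  have A_const: "A x y = A 0 y'" if y: "0 < y" and y': "0 < y'" for x y y'
  proof -
    define z1 where "z1 = Complex x y"
    define z2 where "z2 = Complex 0 y'"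
    have z: "0 < Im z1" "0 < Im z2" using y y' by (auto simp: z1_def z2_def)
    have Im_k: "Im (1 / (Complex x y - of_real t)) = - P x y t" for x y t
      by (simp add: P_def Im_divide power2_eq_square)
    have P_bound: "norm (P x y t) \<le> norm (y * (1 + norm (\<i> - Complex x y) / y)\<^sup>2 / y ^ 0 * (1 / (1 + t\<^sup>2)))" if "0 < y" for x y t
    proof -
      have "norm (P x y t) = y * norm (1 / (Complex x y - of_real t) ^ 2)"
        using that by (simp add: P_def norm_divide norm_power cmod_power2)
      also have "\<dots> \<le> y * ((1 + norm (\<i> - Complex x y) / y)\<^sup>2 / y ^ (2 - 2) * (1 / (1 + t\<^sup>2)))"
        using that by (intro mult_left_mono kernel_bound) auto
      also have "\<dots> \<le> norm (y * (1 + norm (\<i> - Complex x y) / y)\<^sup>2 / y ^ 0 * (1 / (1 + t\<^sup>2)))"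
        using that by (simp add: abs_mult)
      finally show ?thesis .
    qed
    have P_int: "integrable lborel (P x y)" if "0 < y" for x y
    proof (rule Bochner_Integration.integrable_bound)
      show "integrable lborel (\<lambda>t. y * (1 + norm (\<i> - Complex x y) / y)\<^sup>2 / y ^ 0 * (1 / (1 + t\<^sup>2)))"
        by (intro integrable_mult_right integrable_cauchy_kernel)
      show "P x y \<in> borel_measurable lborel" unfolding P_def by measurable
      show "AE t in lborel. norm (P x y t) \<le> norm (y * (1 + norm (\<i> - Complex x y) / y)\<^sup>2 / y ^ 0 * (1 / (1 + t\<^sup>2)))"
        by (intro AE_I2 P_bound that)
    qed
    \<comment> \<open>The difference of the two kernels is (z1 - z2) / ((z1 - t)(z2 - t)), and p q
      \<le> p^2 + q^2 reduces it to the integrable exponent 2.\<close>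
    have "integrable lborel (\<lambda>t. H t *\<^sub>R (1 / (z2 - of_real t) - 1 / (z1 - of_real t)))"
    proof (rule integrable_bounded_mult[OF meas H Bochner_Integration.integrable_bound])
      show "integrable lborel (\<lambda>t. norm (z1 - z2) * (norm (1 / (z1 - of_real t) ^ 2) + norm (1 / (z2 - of_real t) ^ 2)))"
        using z by (intro integrable_mult_right Bochner_Integration.integrable_add integrable_norm integrable_kernel) auto
      show "AE t in lborel. norm (1 / (z2 - of_real t) - 1 / (z1 - of_real t)) \<le>
          norm (norm (z1 - z2) * (norm (1 / (z1 - complex_of_real t) ^ 2) + norm (1 / (z2 - complex_of_real t) ^ 2)))"
      proof (rule AE_I2)
        fix t
        define p q where "p = norm (1 / (z1 - of_real t))" and "q = norm (1 / (z2 - of_real t))"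
        have "0 < norm (z1 - of_real t)" "0 < norm (z2 - of_real t)"
          using Im_le_norm_minus_real[OF z(1), of t] Im_le_norm_minus_real[OF z(2), of t] z by linarith+
        then have "1 / (z2 - of_real t) - 1 / (z1 - of_real t) = (z1 - z2) * (1 / (z1 - of_real t) * (1 / (z2 - of_real t)))"
          by (auto simp: field_simps)
        then have "norm (1 / (z2 - of_real t) - 1 / (z1 - of_real t)) = norm (z1 - z2) * (p * q)"
          by (simp only: norm_mult p_def q_def)
        also have "p * q \<le> p\<^sup>2 + q\<^sup>2"
        proof -
          have "0 \<le> p * q" by (simp add: p_def q_def)
          then show ?thesis using sum_squares_bound[of p q] by linarith
        qed
        finally show "norm (1 / (z2 - of_real t) - 1 / (z1 - of_real t)) \<le>
          norm (norm (z1 - z2) * (norm (1 / (z1 - complex_of_real t) ^ 2) + norm (1 / (z2 - complex_of_real t) ^ 2)))"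
          by (simp add: p_def q_def norm_divide norm_power power_divide mult_left_mono abs_mult)
      qed
    qed measurable
    then have "Im (LBINT t. H t *\<^sub>R (1 / (z2 - of_real t) - 1 / (z1 - of_real t))) =
       (LBINT t. Im (H t *\<^sub>R (1 / (z2 - of_real t) - 1 / (z1 - of_real t))))"
      by (rule integral_Im[symmetric])
    also have "\<dots> = (LBINT t. H t * P x y t - H t * P 0 y' t)"
      by (intro Bochner_Integration.integral_cong refl)
        (simp only: scaleR_complex.sel minus_complex.sel z1_def z2_def Im_k, simp add: algebra_simps)
    also have "\<dots> = A x y - A 0 y'"
      unfolding A_P[OF y] A_P[OF y']
      using integrable_bounded_mult[OF meas H P_int[OF y]] integrable_bounded_mult[OF meas H P_int[OF y']]
      by (intro Bochner_Integration.integral_diff) auto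
    finally show ?thesis
      using kernel_descent[OF meas H _ _ z, of 1] zero2 by (simp add: numeral_2_eq_2)
  qed
  define M where "M = (LBINT x. indicator {0..<1} x * H x)"
  have A_mean: "A 0 y' = pi * M" if y: "0 < y'" for y'
  proof -
    \<comment> \<open>Height 1 is chosen for the mean. For fixed s the x-integral is a shifted
      period integral of \<open>H\<close>; for fixed x the s-integral is \<open>A x 1\<close>, which
      constancy replaces by \<open>A 0 y'\<close>.\<close>
    define g where "g x s = indicator {0..<1} x * (H (x + 1 * s) * (1 / (1 + s\<^sup>2)))" for x s :: real
    have [measurable]: "case_prod g \<in> borel_measurable (lborel \<Otimes>\<^sub>M lborel)"
      unfolding g_def by measurable
    have "0 \<le> K" using H[of 0] by simp
    then have g_bound: "norm (g x s) \<le> indicator {0..1} x * (K * (1 / (1 + s\<^sup>2)))" for x s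
      using H[of "x + s"] by (auto simp: g_def indicator_def abs_mult add_pos_nonneg divide_right_mono)
    have "(LBINT s. (LBINT x. g x s)) = (LBINT x. (LBINT s. g x s))"
      by (rule integral_swap_cauchy_bound[OF _ g_bound]) measurable
    moreover have "(LBINT s. g x s) = indicator {0..<1} x * A 0 y'" for x
    proof -
      have "(LBINT s. g x s) = indicator {0..<1} x * A x 1"
        unfolding A_def g_def by (rule integral_mult_right_zero)
      then show ?thesis by (simp add: A_const[OF zero_less_one y])
    qed
    moreover have "(LBINT x. g x s) = 1 / (1 + s\<^sup>2) * M" for s
    proof -
      have "(LBINT x. g x s) = (LBINT x. 1 / (1 + s\<^sup>2) * (indicator {0..<1} x * H (x + s)))"
        by (simp add: g_def mult_ac)
      then show ?thesis by (simp only: integral_mult_right_zero periodic_integral_shift[OF meas H per] M_def)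
    qed
    moreover have "(LBINT x. indicator {0..<1::real} x * A 0 y') = A 0 y'" by simp
    moreover have "(LBINT s. 1 / (1 + s\<^sup>2) * M) = pi * M"
      by (simp only: integral_mult_left_zero integral_cauchy_kernel)
    ultimately show ?thesis by simp
  qed
  have "(\<lambda>j. A 0 (1 / real (Suc j))) \<longlonglongrightarrow> (LBINT s. H 0 * (1 / (1 + s\<^sup>2)))"
    unfolding A_def
  proof (rule integral_dominated_convergence)
    show "integrable lborel (\<lambda>s::real. K * (1 / (1 + s\<^sup>2)))"
      by (intro integrable_mult_right integrable_cauchy_kernel)
    show "AE s in lborel. norm (H (0 + 1 / real (Suc j) * s) * (1 / (1 + s\<^sup>2))) \<le> K * (1 / (1 + s\<^sup>2))" for j
      using H by (intro AE_I2) (auto simp: abs_mult add_pos_nonneg divide_right_mono)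
    show "AE s in lborel. (\<lambda>j. H (0 + 1 / real (Suc j) * s) * (1 / (1 + s\<^sup>2))) \<longlonglongrightarrow> H 0 * (1 / (1 + s\<^sup>2))"
    proof (rule AE_I2)
      fix s :: real
      have "(\<lambda>j. 0 + 1 / real (Suc j) * s) \<longlonglongrightarrow> 0"
        using tendsto_mult_left_zero[OF LIMSEQ_inverse_real_of_nat, of s] by (simp add: inverse_eq_divide)
      then show "(\<lambda>j. H (0 + 1 / real (Suc j) * s) * (1 / (1 + s\<^sup>2))) \<longlonglongrightarrow> H 0 * (1 / (1 + s\<^sup>2))"
        by (intro tendsto_mult tendsto_const isCont_tendsto_compose[OF cont])
    qed
  qed measurable
  then have "(\<lambda>j. pi * M) \<longlonglongrightarrow> H 0 * pi"
    by (simp only: A_mean integral_mult_right_zero integral_cauchy_kernel zero_less_divide_1_iff of_nat_0_less_iff zero_less_Suc)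
  then show ?thesis by (simp add: LIMSEQ_const_iff M_def)
qed

subsection \<open>Binary quadratic forms and bounded sums of truncated powers\<close>

type_synonym form = "int \<times> int \<times> int"

definition qf :: "form \<Rightarrow> 'a::comm_ring_1 \<Rightarrow> 'a" where
  "qf q x = (case q of (a, b, c) \<Rightarrow> of_int a * x\<^sup>2 + of_int b * x + of_int c)"

definition forms :: "int \<Rightarrow> nat \<Rightarrow> form set" where
  "forms D M = {(a, b, c). b\<^sup>2 - 4 * a * c = D \<and> int M dvd a \<and> 2 * int M dvd b - 1}"

definition bump :: "nat \<Rightarrow> form \<Rightarrow> real \<Rightarrow> real" where
  "bump k q x = (max 0 (- of_int (sgn (fst q)) * qf q x)) ^ (k - 1)"

definition shift :: "int \<Rightarrow> form \<Rightarrow> form" where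
  "shift m q = (case q of (a, b, c) \<Rightarrow> (a, b + 2 * a * m, a * m\<^sup>2 + b * m + c))"

definition reverse :: "form \<Rightarrow> form" where
  "reverse q = (case q of (a, b, c) \<Rightarrow> (c, b, a))"

text \<open>The sign of a c separates two regimes: negative for only finitely many forms; positive
  exactly when reversal preserves the sign of a nonzero leading coefficient, so that x -> 1/x can be
  applied to \<open>bump\<close>.\<close>

definition outer_product :: "form \<Rightarrow> int" where
  "outer_product q = (case q of (a, b, c) \<Rightarrow> a * c)"

lemma bump_nonneg: "0 \<le> bump k q x"
  by (simp add: bump_def)

lemma continuous_bump: "continuous_on S (bump k q)"
  unfolding bump_def qf_def by (cases q) (auto intro!: continuous_intros)

lemma measurable_bump [measurable]: "bump k q \<in> borel_measurable borel"
  by (intro borel_measurable_continuous_onI continuous_bump)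

lemma qf_shift: "qf (shift m q) x = qf q (x + of_int m)"
  by (cases q) (simp add: qf_def shift_def algebra_simps power2_eq_square)

lemma fst_shift [simp]: "fst (shift m q) = fst q"
  by (cases q) (simp add: shift_def)

lemma bump_shift: "bump k (shift m q) x = bump k q (x + of_int m)"
  by (simp add: bump_def qf_shift)

lemma shift_shift [simp]: "shift m (shift n q) = shift (m + n) q"
  by (cases q) (simp add: shift_def algebra_simps power2_eq_square)

lemma shift_0 [simp]: "shift 0 q = q"
  by (cases q) (simp add: shift_def)

lemma inj_shift: "inj (shift m)"
  by (rule inj_on_inverseI[of _ "shift (- m)"]) simp

lemma shift_in_forms: "q \<in> forms D M \<Longrightarrow> shift m q \<in> forms D M"
proof (cases q)
  case (fields a b c)
  assume "q \<in> forms D M"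
  then have *: "b\<^sup>2 - 4 * a * c = D" "int M dvd a" "2 * int M dvd b - 1" by (auto simp: forms_def fields)
  have "2 * int M dvd (b - 1) + 2 * (a * m)"
    using * by (intro dvd_add mult_dvd_mono dvd_mult2) auto
  moreover have "(b + 2 * a * m)\<^sup>2 - 4 * a * (a * m\<^sup>2 + b * m + c) = D"
    unfolding *(1)[symmetric] by (simp add: algebra_simps power2_eq_square)
  ultimately show ?thesis using * by (simp add: forms_def shift_def fields algebra_simps)
qed

lemma bij_shift: "bij_betw (shift m) (forms D M) (forms D M)"
  by (rule bij_betw_byWitness[of _ "shift (- m)"]) (auto intro: shift_in_forms)

lemma reverse_reverse [simp]: "reverse (reverse q) = q"
  by (cases q) (simp add: reverse_def)

lemma inj_reverse: "inj reverse"
  by (rule inj_on_inverseI[of _ reverse]) simp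

lemma reverse_in_forms: "q \<in> forms D 1 \<Longrightarrow> reverse q \<in> forms D 1"
  by (cases q) (auto simp: forms_def reverse_def)

lemma forms_subset: "forms D M \<subseteq> forms D 1"
  by (auto simp: forms_def dest: dvd_mult_left)

text \<open>q(x) = x^2 q'(1/x) for the reversed form q', and a c > 0 makes both truncations use the
  same sign.\<close>

lemma bump_reverse:
  assumes "0 < outer_product q" "x \<noteq> 0"
  shows "bump k q x = (x\<^sup>2) ^ (k - 1) * bump k (reverse q) (1 / x)"
proof (cases q)
  case (fields a b c)
  have sgn: "sgn c = sgn a" using assms(1) by (auto simp: fields outer_product_def sgn_if zero_less_mult_iff)
  have "qf q x = x\<^sup>2 * qf (reverse q) (1 / x)"
    using assms(2) by (simp add: qf_def fields reverse_def field_simps power2_eq_square)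
  then have "max 0 (- of_int (sgn a) * qf q x) = x\<^sup>2 * max 0 (- of_int (sgn a) * qf (reverse q) (1 / x))"
    using max_mult_distrib_left[of "x\<^sup>2" 0 "- of_int (sgn a) * qf (reverse q) (1 / x)"] by (simp add: mult_ac)
  then show ?thesis
    by (simp only: bump_def power_mult_distrib) (simp add: fields reverse_def sgn power_mult_distrib)
qed

lemma bump_0: "2 \<le> k \<Longrightarrow> 0 < outer_product q \<Longrightarrow> bump k q 0 = 0"
  by (cases q) (auto simp: bump_def qf_def outer_product_def sgn_if zero_less_mult_iff max_def power_0_left)

text \<open>If a c < 0 then D = b^2 + 4 |a c| is a sum of nonnegative terms, which bounds every
  coefficient by D.\<close>

lemma finite_forms_outer_neg: "finite {q \<in> forms D M. outer_product q < 0}"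
proof (rule finite_subset)
  show "{q \<in> forms D M. outer_product q < 0} \<subseteq> {-D..D} \<times> {-D..D} \<times> {-D..D}"
  proof
    fix q assume q: "q \<in> {q \<in> forms D M. outer_product q < 0}"
    obtain a b c where abc: "q = (a, b, c)" by (cases q)
    have ac: "a * c < 0" and D: "b\<^sup>2 - 4 * (a * c) = D"
      using q by (auto simp: abc forms_def outer_product_def)
    have "a \<noteq> 0" "c \<noteq> 0" using ac by auto
    then have "1 \<le> \<bar>a\<bar>" "1 \<le> \<bar>c\<bar>" by auto
    then have "\<bar>a\<bar> * 1 \<le> \<bar>a\<bar> * \<bar>c\<bar>" by (intro mult_left_mono) auto
    moreover have "1 * \<bar>c\<bar> \<le> \<bar>a\<bar> * \<bar>c\<bar>" using \<open>1 \<le> \<bar>a\<bar>\<close> by (intro mult_right_mono) auto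
    moreover have "\<bar>a\<bar> * \<bar>c\<bar> = - (a * c)" using ac by (simp flip: abs_mult)
    moreover have "\<bar>b\<bar> \<le> b\<^sup>2" using self_le_power[of "\<bar>b\<bar>" 2] by (cases "b = 0") auto
    moreover have "0 \<le> b\<^sup>2" by simp
    ultimately have "\<bar>a\<bar> \<le> D" "\<bar>b\<bar> \<le> D" "\<bar>c\<bar> \<le> D" using D ac by linarith+
    then show "q \<in> {-D..D} \<times> {-D..D} \<times> {-D..D}" by (auto simp: abc)
  qed
qed auto

definition height_bound :: "int \<Rightarrow> nat \<Rightarrow> real" where
  "height_bound D k = (\<Sum>(a, b, c) \<in> {q \<in> forms D 1. outer_product q < 0}. (\<bar>of_int a\<bar> + \<bar>of_int b\<bar> + \<bar>of_int c\<bar>) ^ (k - 1))"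

lemma sum_bump_outer_neg_le:
  assumes "S \<subseteq> {q \<in> forms D 1. outer_product q < 0}" "\<bar>x\<bar> \<le> 1"
  shows "(\<Sum>q\<in>S. bump k q x) \<le> height_bound D k"
proof -
  have "bump k (a, b, c) x \<le> (\<bar>of_int a\<bar> + \<bar>of_int b\<bar> + \<bar>of_int c\<bar>) ^ (k - 1)" for a b c
  proof -
    have "\<bar>qf (a, b, c) x\<bar> \<le> \<bar>of_int a * x\<^sup>2\<bar> + \<bar>of_int b * x\<bar> + \<bar>of_int c\<bar>"
      by (simp add: qf_def)
    also have "\<dots> \<le> \<bar>of_int a\<bar> * 1 + \<bar>of_int b\<bar> * 1 + \<bar>of_int c\<bar>"
      unfolding abs_mult using assms(2) by (intro add_mono mult_left_mono) (auto simp: abs_square_le_1)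
    finally have "max 0 (- of_int (sgn a) * qf (a, b, c) x) \<le> \<bar>of_int a\<bar> + \<bar>of_int b\<bar> + \<bar>of_int c\<bar>"
      by (auto simp: sgn_if max_def abs_if split: if_splits)
    then show ?thesis by (simp add: bump_def power_mono)
  qed
  then have "(\<Sum>q\<in>S. bump k q x) \<le> (\<Sum>(a, b, c) \<in> S. (\<bar>of_int a\<bar> + \<bar>of_int b\<bar> + \<bar>of_int c\<bar>) ^ (k - 1))"
    by (intro sum_mono) auto
  also have "\<dots> \<le> height_bound D k"
    unfolding height_bound_def using assms(1) finite_forms_outer_neg by (intro sum_mono2) auto
  finally show ?thesis .
qed

section \<open>Uniform bound for sums of truncated powers\<close>

locale nonsquare_disc =
  fixes D :: int and k :: nat
  assumes nonsquare: "\<And>b. b\<^sup>2 \<noteq> D" and k_ge: "2 \<le> k"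
begin

lemma outer_product_nonzero: "q \<in> forms D M \<Longrightarrow> outer_product q \<noteq> 0"
proof (cases q)
  case (fields a b c)
  assume "q \<in> forms D M"
  then have "b\<^sup>2 - 4 * (a * c) = D" by (simp add: fields forms_def)
  with nonsquare[of b] show ?thesis by (auto simp: fields outer_product_def)
qed

lemma fst_nonzero: "q \<in> forms D M \<Longrightarrow> fst q \<noteq> 0"
  using outer_product_nonzero[of q M] by (cases q) (auto simp: outer_product_def)

text \<open>Reversal moves x to 1/x at the cost of (x^2)^(k - 1), which is at most x^2 since |x|
  \<le> 1 and k \<ge> 2. The factor x^2 is the contraction in the Euclidean argument, and later
  gives continuity at 0.\<close>

lemma sum_bump_outer_pos_le:
  assumes S: "S \<subseteq> {q \<in> forms D 1. 0 < outer_product q}" "finite S" and x: "\<bar>x\<bar> \<le> 1" and K: "0 \<le> K"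
    and le: "x \<noteq> 0 \<Longrightarrow> (\<Sum>q\<in>reverse ` S. bump k q (1 / x)) \<le> K"
  shows "(\<Sum>q\<in>S. bump k q x) \<le> x\<^sup>2 * K"
proof (cases "x = 0")
  case True
  then show ?thesis using S bump_0[OF k_ge] by (auto intro!: sum_nonpos)
next
  case False
  have "(\<Sum>q\<in>S. bump k q x) = (\<Sum>q\<in>S. (x\<^sup>2) ^ (k - 1) * bump k (reverse q) (1 / x))"
    using S False by (intro sum.cong refl bump_reverse) auto
  also have "\<dots> = (x\<^sup>2) ^ (k - 1) * (\<Sum>q\<in>reverse ` S. bump k q (1 / x))"
    by (simp add: sum_distrib_left sum.reindex inj_on_subset[OF inj_reverse])
  also have "\<dots> \<le> (x\<^sup>2) ^ 1 * K"
    using x False K le k_ge by (intro mult_mono power_decreasing sum_nonneg bump_nonneg) (auto simp: abs_square_le_1)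
  finally show ?thesis by simp
qed

text \<open>Euclid's algorithm with nearest integers: inverting \<open>x\<close> with \<open>\<bar>x\<bar> \<le> 1/2\<close> costs a factor of
  at most \<open>1/4\<close> and a bounded error, so the bounds form a geometric series.\<close>

lemma sum_bump_le_rational:
  fixes p r :: int
  assumes "finite S" "S \<subseteq> forms D 1" "0 < r"
  shows "(\<Sum>q\<in>S. bump k q (of_int p / of_int r)) \<le> 4 / 3 * height_bound D k"
  using assms
\<comment> \<open>\<open>S\<close> is generalized because every round replaces the family by
  translated and then reversed forms; the denominator r drops to |p'|.\<close>
proof (induction "nat r" arbitrary: r p S rule: less_induct)
  case less
  define B where "B = height_bound D k"
  have B0: "0 \<le> B" using sum_bump_outer_neg_le[of "{}" D 0 k] by (simp add: B_def)
  define m where "m = round (of_int p / of_int r :: real)"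
  define p' where "p' = p - m * r"
  define x where "x = (of_int p' / of_int r :: real)"
  have px: "of_int p / of_int r = x + of_int m"
    using less.prems by (simp add: x_def p'_def field_simps)
  have x: "\<bar>x\<bar> \<le> 1 / 2"
  proof -
    have "\<bar>of_int m - of_int p / of_int r :: real\<bar> \<le> 1 / 2" unfolding m_def by (rule of_int_round_abs_le)
    then show ?thesis using px by linarith
  qed
  define T where "T = shift m ` S"
  define Tn where "Tn = {q \<in> T. outer_product q < 0}"
  define Tp where "Tp = {q \<in> T. 0 < outer_product q}"
  have T: "finite T" "T \<subseteq> forms D 1"
    using less.prems shift_in_forms[of _ D 1 m] unfolding T_def by (blast+)
  have "(\<Sum>q\<in>S. bump k q (of_int p / of_int r)) = (\<Sum>q\<in>T. bump k q x)"
    by (simp add: T_def sum.reindex inj_on_subset[OF inj_shift] bump_shift px)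
  also have "T = Tn \<union> Tp"
  proof -
    have "outer_product q < 0 \<or> 0 < outer_product q" if "q \<in> T" for q
      using outer_product_nonzero[of q 1] T that by (metis linorder_neqE subsetD)
    then show ?thesis by (auto simp: Tn_def Tp_def)
  qed
  also have "(\<Sum>q\<in>Tn \<union> Tp. bump k q x) = (\<Sum>q\<in>Tn. bump k q x) + (\<Sum>q\<in>Tp. bump k q x)"
    using T by (intro sum.union_disjoint) (auto simp: Tn_def Tp_def)
  also have "(\<Sum>q\<in>Tn. bump k q x) \<le> B"
    unfolding B_def using T x by (intro sum_bump_outer_neg_le) (auto simp: Tn_def)
  also have "(\<Sum>q\<in>Tp. bump k q x) \<le> x\<^sup>2 * (4 / 3 * B)"
  proof (rule sum_bump_outer_pos_le)
    assume "x \<noteq> 0"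
    then have p': "p' \<noteq> 0" by (auto simp: x_def)
    have "\<bar>of_int p' :: real\<bar> < of_int r"
      using x less.prems unfolding x_def by (simp add: abs_divide pos_divide_le_eq)
    then have small: "\<bar>p'\<bar> < r" by (metis of_int_abs of_int_less_iff)
    \<comment> \<open>1/x is written with the positive denominator |p'|, the sign going to the
      numerator, to fit the induction hypothesis.\<close>
    have "(\<Sum>q\<in>reverse ` Tp. bump k q (of_int (sgn p' * r) / of_int \<bar>p'\<bar>)) \<le> 4 / 3 * height_bound D k"
    proof (rule less.hyps)
      show "nat \<bar>p'\<bar> < nat r" using small less.prems(3) by simp
      show "finite (reverse ` Tp)" using T by (simp add: Tp_def)
      show "reverse ` Tp \<subseteq> forms D 1"
      proof (rule image_subsetI)
        fix q assume "q \<in> Tp"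
        then have "q \<in> forms D 1" using T(2) by (auto simp: Tp_def)
        then show "reverse q \<in> forms D 1" by (rule reverse_in_forms)
      qed
    qed (use p' in simp)
    moreover have "of_int (sgn p' * r) / of_int \<bar>p'\<bar> = 1 / x"
      using p' by (auto simp: x_def sgn_if abs_if)
    ultimately show "(\<Sum>q\<in>reverse ` Tp. bump k q (1 / x)) \<le> 4 / 3 * B"
      by (simp only: B_def)
  qed (use T x B0 in \<open>auto simp: Tp_def\<close>)
  \<comment> \<open>4/3 is the fixed point of the recursion: B + (1/4)(4/3) B = (4/3) B.\<close>
  also have "x\<^sup>2 * (4 / 3 * B) \<le> (1 / 4) * (4 / 3 * B)"
  proof -
    have "\<bar>x\<bar> ^ 2 \<le> (1 / 2) ^ 2" using x by (intro power_mono) auto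
    then show ?thesis using B0 by (intro mult_right_mono) (auto simp: power2_eq_square)
  qed
  finally show ?case by (simp add: B_def)
qed


end

context nonsquare_disc begin
text \<open>A finite sum of bumps is continuous, so the bound passes from the rationals to the
  reals; this is why it is stated for finite families.\<close>

lemma sum_bump_le:
  assumes "finite S" "S \<subseteq> forms D 1"
  shows "(\<Sum>q\<in>S. bump k q x) \<le> 4 / 3 * height_bound D k"
proof (rule ccontr)
  define f where "f x = (\<Sum>q\<in>S. bump k q x)" for x
  define K where "K = 4 / 3 * height_bound D k"
  assume "\<not> ?thesis"
  then have gt: "K < f x" by (simp add: f_def K_def)
  have "continuous_on UNIV f" unfolding f_def by (intro continuous_on_sum continuous_bump)
  then have "0 < f x - K \<longrightarrow> (\<exists>e>0. \<forall>y. dist y x < e \<longrightarrow> dist (f y) (f x) < f x - K)"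
    unfolding continuous_on_iff by blast
  with gt obtain e where e: "0 < e" "\<And>y. dist y x < e \<Longrightarrow> dist (f y) (f x) < f x - K" by auto
  have "x < x + e" using e by simp
  then obtain y where y: "y \<in> \<rat>" "x < y" "y < x + e" using Rats_dense_in_real by blast
  from y(1) obtain p r where "0 < r" "y = of_int p / of_int r" by (rule Rats_cases')
  then have "f y \<le> K" using sum_bump_le_rational[OF assms, of r p] by (simp add: f_def K_def)
  moreover have "dist (f y) (f x) < f x - K" using y by (intro e) (simp add: dist_real_def)
  ultimately show False unfolding dist_real_def by linarith
qed

end

subsection \<open>Beta integrals\<close>

text \<open>The incomplete Beta function: the antiderivative of x^m (1 - x)^m vanishing at 0. Being
  a polynomial, it is available over the reals and along the complex path alike.\<close>

definition beta_poly :: "nat \<Rightarrow> 'a::field_char_0 \<Rightarrow> 'a" where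
  "beta_poly m x = (\<Sum>j\<le>m. of_nat (m choose j) * (- 1) ^ j * x ^ (m + j + 1) / of_nat (m + j + 1))"

lemma beta_poly_0 [simp]: "beta_poly m 0 = 0"
  by (simp add: beta_poly_def)

lemma of_real_beta_poly: "complex_of_real (beta_poly m x) = beta_poly m (complex_of_real x)"
  by (simp add: beta_poly_def)

lemma has_field_derivative_beta_poly:
  fixes x :: "'a::real_normed_field"
  shows "(beta_poly m has_field_derivative (x ^ m * (1 - x) ^ m)) (at x within S)"
proof -
  have "(beta_poly m has_field_derivative (\<Sum>j\<le>m. of_nat (m choose j) * (- 1) ^ j * x ^ (m + j))) (at x within S)"
    unfolding beta_poly_def [abs_def]
  proof (rule DERIV_sum)
    fix j
    define n where "n = m + j + 1"
    have n: "of_nat n \<noteq> (0 :: 'a)" "n - Suc 0 = m + j" by (auto simp only: n_def of_nat_eq_0_iff)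
    define c :: 'a where "c = of_nat (m choose j) * (- 1) ^ j"
    have "((\<lambda>x. c * x ^ n / of_nat n) has_field_derivative c * (of_nat n * (1 * x ^ (n - Suc 0))) / of_nat n) (at x within S)"
      by (intro DERIV_cdivide DERIV_cmult DERIV_power DERIV_ident)
    also have "c * (of_nat n * (1 * x ^ (n - Suc 0))) / of_nat n = c * x ^ (m + j)"
      using n by simp
    finally show "((\<lambda>x. of_nat (m choose j) * (- 1) ^ j * x ^ (m + j + 1) / of_nat (m + j + 1)) has_field_derivative
        of_nat (m choose j) * (- 1) ^ j * x ^ (m + j)) (at x within S)"
      unfolding c_def n_def .
  qed
  also have "(\<Sum>j\<le>m. of_nat (m choose j) * (- 1) ^ j * x ^ (m + j)) = x ^ m * (- x + 1) ^ m"
    unfolding binomial_ring by (simp add: sum_distrib_left power_add power_minus[of x] mult_ac)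
  finally show ?thesis by (simp add: add.commute)
qed

text \<open>The value at 1 is B(m + 1, m + 1) = m!^2 / (2m + 1)!. With m = k - 1 its reciprocal is
  the binomial factor of the theorem.\<close>

lemma beta_poly_1_real:
  assumes "0 < m"
  shows "(beta_poly m 1 :: real) * (real (2 * m + 1) * real ((2 * m) choose m)) = 1"
proof -
  have "((\<lambda>t. t ^ m * (1 - t) ^ m) has_integral (beta_poly m 1 - beta_poly m 0 :: real)) {0..1}"
    by (rule fundamental_theorem_of_calculus)
      (simp_all only: has_real_derivative_iff_has_vector_derivative[symmetric] has_field_derivative_beta_poly zero_le_one)
  moreover have "((\<lambda>t. t powr (real (m + 1) - 1) * (1 - t) powr (real (m + 1) - 1)) has_integral Beta (real (m + 1)) (real (m + 1))) {0..1}"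
    by (rule has_integral_Beta_real) auto
  \<comment> \<open>At the endpoints this relies on m > 0: \<open>0 powr 0\<close> is 0 but
    \<open>0 ^ 0\<close> is 1.\<close>
  moreover have "t powr (real (m + 1) - 1) * (1 - t) powr (real (m + 1) - 1) = t ^ m * (1 - t) ^ m" if "t \<in> {0..1}" for t :: real
    using that assms by (simp add: powr_realpow')
  ultimately have "beta_poly m 1 = Beta (real (m + 1)) (real (m + 1))"
    by (metis (no_types, lifting) has_integral_cong has_integral_unique beta_poly_0 diff_zero)
  also have "\<dots> = fact m * fact m / fact (2 * m + 1)"
    using Gamma_fact[of m, where 'a = real] Gamma_fact[of "2 * m + 1", where 'a = real]
    by (simp add: Beta_def add_ac)
  finally have "beta_poly m 1 = fact m * fact m / (fact (2 * m + 1) :: real)" .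
  moreover have "fact m * fact m * real ((2 * m) choose m) = (fact (2 * m) :: real)"
    using arg_cong[OF binomial_fact_lemma[of m "2 * m"], of real] by simp
  moreover have "(fact (2 * m + 1) :: real) = real (2 * m + 1) * fact (2 * m)"
    by simp
  moreover have "(fact (2 * m) :: real) \<noteq> 0" "real (2 * m + 1) \<noteq> 0" by simp_all
  moreover have "a / (Y * X) * (Y * C) = 1" if "a * C = X" "X \<noteq> 0" "Y \<noteq> 0" for a X Y C :: real
    using that by (auto simp: field_simps)
  ultimately show ?thesis by metis
qed

lemma beta_poly_1_pos: "0 < m \<Longrightarrow> 0 < (beta_poly m 1 :: real)"
  using beta_poly_1_real[of m] mult_nonpos_nonneg[of "beta_poly m 1 :: real" "real (2 * m + 1) * real ((2 * m) choose m)"]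
  by (cases "0 < (beta_poly m 1 :: real)") auto

text \<open>The substitution \<open>x \<mapsto> (x - l) (z - u) / ((z - x) (u - l))\<close> maps the segment from \<open>l\<close> to \<open>u\<close> to a path
  from 0 to 1 and the integrand to that of the Beta integral.\<close>

lemma beta_kernel_integral:
  fixes l u :: real
  assumes lu: "l < u" and z: "0 < Im z"
  shows "has_bochner_integral lborel
    (\<lambda>x. indicator {l..u} x *\<^sub>R (of_real (((x - l) * (u - x)) ^ m) / (z - of_real x) ^ (2 * m + 2)))
    (of_real (beta_poly m 1 * (u - l) ^ (2 * m + 1)) / ((z - of_real l) * (z - of_real u)) ^ (m + 1))"
proof -
  define L U where "L = z - of_real l" and "U = z - of_real u"
  define d where "d = complex_of_real (u - l)"
  define \<tau> where "\<tau> x = (x - of_real l) * U / ((z - x) * d)" for x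
  \<comment> \<open>With w = z - x, the map \<open>\<tau>\<close> has derivative U L / (w^2 d), and
    \<open>\<tau> (1 - \<tau>)\<close> is (L - w)(w - U) L U / (w d)^2. This factor cancels exactly
    the resulting powers of L U and d.\<close>
  define C where "C = d ^ (2 * m + 1) / (L * U) ^ (m + 1)"
  have ne: "z - of_real x \<noteq> 0" for x using z by (auto simp: complex_eq_iff)
  have LU: "L \<noteq> 0" "U \<noteq> 0" "d \<noteq> 0" using ne lu by (auto simp: L_def U_def d_def)
  have lu': "L - U = d" by (simp add: L_def U_def d_def)
  have "has_bochner_integral lborel
    (\<lambda>x. indicator {l..u} x *\<^sub>R (of_real (((x - l) * (u - x)) ^ m) / (z - of_real x) ^ (2 * m + 2)))
    (C * beta_poly m (\<tau> (of_real u)) - C * beta_poly m (\<tau> (of_real l)))"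
  proof (rule has_bochner_integral_FTC_Icc)
    fix x :: real
    define w where "w = z - of_real x"
    have w: "w \<noteq> 0" using ne by (simp add: w_def)
    have xl: "of_real x - of_real l = L - w" and ux: "of_real u - of_real x = w - U"
      by (simp_all add: w_def L_def U_def)
    have "(\<tau> has_field_derivative (U * L / (w\<^sup>2 * d))) (at (of_real x))"
    proof -
      have "(\<tau> has_field_derivative ((U * (w * d) - ((L - w) * U) * (- d)) / ((w * d) * (w * d)))) (at (of_real x))"
        unfolding \<tau>_def [abs_def] w_def[symmetric] using w LU
        by (auto intro!: derivative_eq_intros simp: w_def[symmetric] xl)
      also have "(U * (w * d) - ((L - w) * U) * (- d)) / ((w * d) * (w * d)) = U * L / (w\<^sup>2 * d)"
        using w LU(3) by (simp add: divide_simps power2_eq_square) (simp add: algebra_simps)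
      finally show ?thesis .
    qed
    then have "((\<lambda>x. C * beta_poly m (\<tau> x)) has_field_derivative
        (C * ((\<tau> (of_real x)) ^ m * (1 - \<tau> (of_real x)) ^ m * (U * L / (w\<^sup>2 * d))))) (at (of_real x))"
      by (intro DERIV_cmult DERIV_chain2[OF has_field_derivative_beta_poly])
    also have "C * ((\<tau> (of_real x)) ^ m * (1 - \<tau> (of_real x)) ^ m * (U * L / (w\<^sup>2 * d))) =
      of_real (((x - l) * (u - x)) ^ m) / w ^ (2 * m + 2)"
    proof -
      have t: "\<tau> (of_real x) = (L - w) * U / (w * d)"
        by (simp only: \<tau>_def xl flip: w_def)
      have "1 - \<tau> (of_real x) = (w - U) * L / (w * d)"
      proof -
        have "1 - \<tau> (of_real x) = (w * (L - U) - (L - w) * U) / (w * d)"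
          using w LU by (simp add: t diff_divide_distrib lu')
        then show ?thesis by (simp add: algebra_simps)
      qed
      then have "\<tau> (of_real x) * (1 - \<tau> (of_real x)) = (L - w) * (w - U) * (L * U) / (w\<^sup>2 * d\<^sup>2)"
        by (simp add: t power2_eq_square mult_ac)
      then have "(\<tau> (of_real x)) ^ m * (1 - \<tau> (of_real x)) ^ m = ((L - w) * (w - U)) ^ m * (L * U) ^ m / (w ^ (2 * m) * d ^ (2 * m))"
        by (simp add: power_mult_distrib[symmetric] power_divide power_mult)
      moreover have "of_real (((x - l) * (u - x)) ^ m) = ((L - w) * (w - U)) ^ m"
        unfolding xl[symmetric] ux[symmetric] by simp
      moreover have "e * d / (p * (L * U)) * (X * p / (v * e) * (U * L / (w\<^sup>2 * d))) = X / (v * w\<^sup>2)"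
        if "e \<noteq> 0" "p \<noteq> 0" "v \<noteq> 0" for e p v X
        using that LU w by (simp add: field_simps)
      from this[of "d ^ (2 * m)" "(L * U) ^ m" "w ^ (2 * m)" "((L - w) * (w - U)) ^ m"]
      have "C * (((L - w) * (w - U)) ^ m * (L * U) ^ m / (w ^ (2 * m) * d ^ (2 * m)) * (U * L / (w\<^sup>2 * d))) = ((L - w) * (w - U)) ^ m / w ^ (2 * m + 2)"
        using LU w by (simp add: C_def power_add power2_eq_square mult_ac)
      ultimately show ?thesis by (simp only:)
    qed
    finally show "((\<lambda>x. C * beta_poly m (\<tau> (of_real x))) has_vector_derivative
        (of_real (((x - l) * (u - x)) ^ m) / (z - of_real x) ^ (2 * m + 2))) (at x within {l..u})"
      using field_vector_diff_chain_within[OF has_vector_derivative_of_real[OF DERIV_ident] DERIV_subset[OF _ subset_UNIV]]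
      by (fastforce simp add: o_def w_def)
  qed (use lu ne in \<open>auto intro!: continuous_intros\<close>)
  moreover have "\<tau> (of_real u) = 1"
  proof -
    have "of_real u - of_real l = d" by (simp add: d_def)
    then have "\<tau> (of_real u) = d * U / (U * d)" by (simp only: \<tau>_def U_def)
    then show ?thesis using LU by simp
  qed
  moreover have "\<tau> (of_real l) = 0" by (simp add: \<tau>_def)
  ultimately show ?thesis by (simp add: C_def L_def U_def d_def of_real_beta_poly mult_ac)
qed

text \<open>The affine substitution x -> (x - l) / (u - l) is the limit of the preceding one as z
  tends to infinity.\<close>

lemma beta_integral:
  fixes l u :: real
  assumes lu: "l < u"
  shows "has_bochner_integral lborel (\<lambda>x. indicator {l..u} x *\<^sub>R (((x - l) * (u - x)) ^ m)) (beta_poly m 1 * (u - l) ^ (2 * m + 1))"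
proof -
  define e where "e = u - l"
  have e: "0 < e" using lu by (simp add: e_def)
  define C where "C = e ^ (2 * m + 1)"
  have "has_bochner_integral lborel (\<lambda>x. indicator {l..u} x *\<^sub>R (((x - l) * (u - x)) ^ m))
    (C * beta_poly m ((u - l) / e) - C * beta_poly m ((l - l) / e))"
  proof (rule has_bochner_integral_FTC_Icc)
    fix x :: real
    have "((\<lambda>x. C * beta_poly m ((x - l) / e)) has_field_derivative
       (C * (((x - l) / e) ^ m * (1 - (x - l) / e) ^ m * (1 / e)))) (at x within {l..u})"
      by (intro DERIV_cmult DERIV_chain2[OF has_field_derivative_beta_poly]) (use e in \<open>auto intro!: derivative_eq_intros\<close>)
    also have "1 - (x - l) / e = (u - x) / e" using e by (simp add: field_simps) (simp add: e_def)
    also have "C * (((x - l) / e) ^ m * ((u - x) / e) ^ m * (1 / e)) = ((x - l) * (u - x)) ^ m"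
      using e unfolding C_def power_divide power_mult_distrib by (simp add: mult_2 power_add)
    finally show "((\<lambda>x. C * beta_poly m ((x - l) / e)) has_vector_derivative ((x - l) * (u - x)) ^ m) (at x within {l..u})"
      by (simp add: has_real_derivative_iff_has_vector_derivative)
  qed (use lu in \<open>auto intro!: continuous_intros\<close>)
  then show ?thesis using e unfolding C_def e_def[symmetric] by (simp add: mult_ac)
qed

text \<open>The absolute value in the second denominator orders the two roots independently of the
  sign of a.\<close>

definition lower_root :: "form \<Rightarrow> real" where
  "lower_root q = (case q of (a, b, c) \<Rightarrow> - of_int b / (2 * of_int a) - sqrt (of_int (b\<^sup>2 - 4 * a * c)) / (2 * \<bar>of_int a\<bar>))"

definition upper_root :: "form \<Rightarrow> real" where
  "upper_root q = (case q of (a, b, c) \<Rightarrow> - of_int b / (2 * of_int a) + sqrt (of_int (b\<^sup>2 - 4 * a * c)) / (2 * \<bar>of_int a\<bar>))"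

lemma qf_factor:
  fixes x :: "'a::real_field"
  assumes a: "a \<noteq> 0" and D: "0 \<le> b\<^sup>2 - 4 * a * c"
  shows "qf (a, b, c) x = of_int a * ((x - of_real (lower_root (a, b, c))) * (x - of_real (upper_root (a, b, c))))"
proof -
  define l u where "l = lower_root (a, b, c)" and "u = upper_root (a, b, c)"
  define s where "s = sqrt (of_int (b\<^sup>2 - 4 * a * c))"
  have s2: "s\<^sup>2 = (of_int b)\<^sup>2 - 4 * of_int a * of_int c"
  proof -
    have "0 \<le> real_of_int (b\<^sup>2 - 4 * a * c)" using D by (simp only: of_int_0_le_iff)
    then have "s\<^sup>2 = of_int (b\<^sup>2 - 4 * a * c)" unfolding s_def by (rule real_sqrt_pow2)
    then show ?thesis by simp
  qed
  have sum: "of_int a * (l + u) = - of_int b"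
    using a by (simp add: l_def u_def lower_root_def upper_root_def)
  have "l * u = (- of_int b / (2 * of_int a))\<^sup>2 - (s / (2 * \<bar>of_int a\<bar>))\<^sup>2"
    unfolding l_def u_def lower_root_def upper_root_def s_def by (simp add: algebra_simps power2_eq_square)
  also have "\<dots> = of_int c / of_int a"
    unfolding power_divide s2 using a by (simp add: power_mult_distrib field_simps power2_eq_square)
  finally have prod: "of_int a * (l * u) = of_int c" using a by simp
  have "of_int a * ((x - of_real l) * (x - of_real u)) = of_int a * x\<^sup>2 - of_real (of_int a * (l + u)) * x + of_real (of_int a * (l * u))"
    by (simp add: algebra_simps power2_eq_square)
  then show ?thesis unfolding sum prod l_def[symmetric] u_def[symmetric] by (simp add: qf_def)
qed

lemma root_difference: "upper_root (a, b, c) - lower_root (a, b, c) = sqrt (of_int (b\<^sup>2 - 4 * a * c)) / \<bar>of_int a\<bar>"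
  by (simp add: lower_root_def upper_root_def)

text \<open>Both roots are real, so \<open>norm_minus_real_le\<close> applies to each linear factor.
  The constant does not depend on the form, as locally uniform convergence of the series
  requires.\<close>

lemma qf_norm_le:
  assumes "a \<noteq> 0" "0 \<le> b\<^sup>2 - 4 * a * c" "0 < Im z"
  shows "norm (qf (a, b, c) w) \<le> (1 + norm (w - z) / Im z)\<^sup>2 * norm (qf (a, b, c) z)"
proof -
  define C where "C = 1 + norm (w - z) / Im z"
  have C: "0 \<le> C" using assms(3) by (simp add: C_def)
  have "norm (w - of_real t) \<le> C * norm (z - of_real t)" for t
    unfolding C_def by (rule norm_minus_real_le[OF assms(3)])
  then have "norm (qf (a, b, c) w) \<le> norm (of_int a :: complex) * ((C * norm (z - of_real (lower_root (a, b, c)))) * (C * norm (z - of_real (upper_root (a, b, c)))))"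
    unfolding qf_factor[OF assms(1,2)] norm_mult using C by (intro mult_left_mono mult_mono) auto
  also have "\<dots> = C\<^sup>2 * norm (qf (a, b, c) z)"
    unfolding qf_factor[OF assms(1,2)] norm_mult by (simp add: power2_eq_square mult_ac)
  finally show ?thesis by (simp only: C_def)
qed

lemma qf_nonzero:
  assumes "a \<noteq> 0" "0 \<le> b\<^sup>2 - 4 * a * c" "0 < Im z"
  shows "qf (a, b, c) z \<noteq> 0"
proof -
  have "z - of_real t \<noteq> 0" for t using assms(3) by (auto simp: complex_eq_iff)
  from this[of "lower_root (a, b, c)"] this[of "upper_root (a, b, c)"] show ?thesis
    unfolding qf_factor[OF assms(1,2)] using assms(1) by simp
qed

text \<open>-sgn(a) q(x) = |a| (x - l)(u - x) is nonnegative exactly between the roots; k \<ge> 2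
  makes the power of the truncated value vanish outside.\<close>

lemma bump_eq_indicator:
  assumes a: "a \<noteq> 0" and D: "0 < b\<^sup>2 - 4 * a * c" and k: "2 \<le> k"
  defines "l \<equiv> lower_root (a, b, c)" and "u \<equiv> upper_root (a, b, c)"
  shows "bump k (a, b, c) x = \<bar>of_int a\<bar> ^ (k - 1) * (indicator {l..u} x *\<^sub>R ((x - l) * (u - x)) ^ (k - 1))"
proof -
  have lu: "l < u"
  proof -
    have "0 < sqrt (of_int (b\<^sup>2 - 4 * a * c)) / \<bar>of_int a\<bar>"
      using a D by (intro divide_pos_pos real_sqrt_gt_zero) (simp_all only: of_int_0_less_iff zero_less_abs_iff of_int_eq_0_iff not_False_eq_True)
    then show ?thesis using root_difference[of a b c] by (simp add: l_def u_def)
  qed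
  have "- of_int (sgn a) * qf (a, b, c) x = \<bar>of_int a\<bar> * ((x - l) * (u - x))"
    using qf_factor[OF a, of b c x] D by (simp add: l_def u_def sgn_if algebra_simps)
  then have b: "bump k (a, b, c) x = (max 0 (\<bar>of_int a\<bar> * ((x - l) * (u - x)))) ^ (k - 1)"
    by (simp add: bump_def)
  show ?thesis
  proof (cases "x \<in> {l..u}")
    case True
    then have "0 \<le> \<bar>of_int a\<bar> * ((x - l) * (u - x))" by simp
    then show ?thesis using True by (simp add: b power_mult_distrib)
  next
    case False
    then have "(x - l) * (u - x) \<le> 0" using lu
      by (cases "x < l") (auto intro: mult_nonpos_nonneg mult_nonneg_nonpos)
    then have "\<bar>of_int a\<bar> * ((x - l) * (u - x)) \<le> 0" by (rule mult_nonneg_nonpos[OF abs_ge_zero])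
    then show ?thesis using False k by (simp add: b max_def power_0_left)
  qed
qed

text \<open>The gap between the roots is sqrt(b^2 - 4 a c) / |a|, so |a|^(k - 1) from the bump and
  |a|^(-(2k - 1)) from the gap combine to |a|^(-k). As k is even this is a^(-k), which completes the
  product of linear factors to q(z)^k.\<close>

lemma bump_kernel_integral:
  assumes a: "a \<noteq> 0" and D: "0 < b\<^sup>2 - 4 * a * c" and k: "2 \<le> k" "even k" and z: "0 < Im z"
  shows "has_bochner_integral lborel (\<lambda>x. bump k (a, b, c) x *\<^sub>R (1 / (z - of_real x) ^ (2 * k)))
     (of_real (beta_poly (k - 1) 1 * sqrt (of_int (b\<^sup>2 - 4 * a * c)) ^ (2 * k - 1)) / qf (a, b, c) z ^ k)"
proof -
  define l u where "l = lower_root (a, b, c)" and "u = upper_root (a, b, c)"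
  define s where "s = sqrt (of_int (b\<^sup>2 - 4 * a * c))"
  define A where "A = \<bar>of_int a :: real\<bar>"
  define m where "m = k - 1"
  have km: "k = m + 1" "2 * k = 2 * m + 2" "2 * k - 1 = 2 * m + 1" using k by (auto simp: m_def)
  have A: "0 < A" using a by (simp add: A_def)
  have s: "0 < s" using D by (simp only: s_def real_sqrt_gt_0_iff of_int_0_less_iff)
  have diff: "u - l = s / A" using root_difference[of a b c] by (simp add: l_def u_def s_def A_def)
  have lu: "l < u" using divide_pos_pos[OF s A] unfolding diff[symmetric] by simp
  have "has_bochner_integral lborel (\<lambda>x. of_real (A ^ m) * (indicator {l..u} x *\<^sub>R (of_real (((x - l) * (u - x)) ^ m) / (z - of_real x) ^ (2 * m + 2))))
    (of_real (A ^ m) * (of_real (beta_poly m 1 * (u - l) ^ (2 * m + 1)) / ((z - of_real l) * (z - of_real u)) ^ (m + 1)))"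
    by (intro has_bochner_integral_mult_right beta_kernel_integral lu z)
  moreover have "of_real (A ^ m) * (indicator {l..u} x *\<^sub>R (of_real (((x - l) * (u - x)) ^ m) / (z - of_real x) ^ (2 * m + 2))) =
     bump k (a, b, c) x *\<^sub>R (1 / (z - of_real x) ^ (2 * k))" for x
    unfolding bump_eq_indicator[OF a D k(1)] l_def[symmetric] u_def[symmetric] A_def[symmetric] m_def[symmetric] km(2)
    by (simp add: indicator_def scaleR_conv_of_real)
  moreover have "of_real (A ^ m) * (of_real (beta_poly m 1 * (u - l) ^ (2 * m + 1)) / ((z - of_real l) * (z - of_real u)) ^ (m + 1)) =
     of_real (beta_poly m 1 * s ^ (2 * m + 1)) / qf (a, b, c) z ^ k"
  proof -
    have "(of_int a :: complex) ^ k = of_real (A ^ k)"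
    proof -
      have "A ^ k = of_int a ^ k" using k(2) unfolding A_def by (rule power_even_abs)
      then show ?thesis by simp
    qed
    then have q: "qf (a, b, c) z ^ k = of_real (A ^ k) * ((z - of_real l) * (z - of_real u)) ^ (m + 1)"
      using qf_factor[OF a, of b c z] D by (simp add: power_mult_distrib l_def u_def km(1))
    have "A ^ m * (u - l) ^ (2 * m + 1) * A ^ k = s ^ (2 * m + 1)"
      using A unfolding diff km(1) by (simp add: field_simps power_add mult_2_right)
    moreover have "of_real X * (of_real (B * Y) / Q) = of_real (B * (X * Y * Z)) / (of_real Z * Q)" if "Z \<noteq> 0"
      for B X Y Z and Q :: complex
      using that by (cases "Q = 0") (auto simp: field_simps)
    ultimately show ?thesis unfolding q using A by (metis power_not_zero less_irrefl)
  qed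
  ultimately show ?thesis unfolding s_def[symmetric] km(3) m_def[symmetric] by simp
qed

lemma bump_integral:
  assumes a: "a \<noteq> 0" and D: "0 < b\<^sup>2 - 4 * a * c" and k: "2 \<le> k"
  shows "has_bochner_integral lborel (bump k (a, b, c))
     (beta_poly (k - 1) 1 * sqrt (of_int (b\<^sup>2 - 4 * a * c)) ^ (2 * k - 1) / \<bar>of_int a\<bar> ^ k)"
proof -
  define l u where "l = lower_root (a, b, c)" and "u = upper_root (a, b, c)"
  define s where "s = sqrt (of_int (b\<^sup>2 - 4 * a * c))"
  define A where "A = \<bar>of_int a :: real\<bar>"
  define m where "m = k - 1"
  have km: "k = m + 1" "2 * k - 1 = 2 * m + 1" using k by (auto simp: m_def)
  have A: "0 < A" using a by (simp add: A_def)
  have s: "0 < s" using D by (simp only: s_def real_sqrt_gt_0_iff of_int_0_less_iff)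
  have diff: "u - l = s / A" using root_difference[of a b c] by (simp add: l_def u_def s_def A_def)
  have lu: "l < u" using divide_pos_pos[OF s A] unfolding diff[symmetric] by simp
  have "has_bochner_integral lborel (\<lambda>x. A ^ m * (indicator {l..u} x *\<^sub>R (((x - l) * (u - x)) ^ m))) (A ^ m * (beta_poly m 1 * (u - l) ^ (2 * m + 1)))"
    by (intro has_bochner_integral_mult_right beta_integral lu)
  moreover have "A ^ m * (indicator {l..u} x *\<^sub>R (((x - l) * (u - x)) ^ m)) = bump k (a, b, c) x" for x
    unfolding bump_eq_indicator[OF a D k] l_def[symmetric] u_def[symmetric] A_def[symmetric] m_def[symmetric] ..
  moreover have "A ^ m * (beta_poly m 1 * (u - l) ^ (2 * m + 1)) = beta_poly m 1 * s ^ (2 * m + 1) / A ^ k"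
    using A unfolding diff km(1) by (simp add: field_simps power_add mult_2_right)
  ultimately show ?thesis unfolding s_def[symmetric] km(2) m_def[symmetric] A_def[symmetric] by simp
qed

section \<open>Termwise integration of families with bounded partial sums\<close>

text \<open>Passage from a countable index set to a series over the naturals, where dominated
  convergence for sequences is applicable.\<close>

lemma has_sum_to_nat_iff:
  fixes A :: "'q::countable set"
  shows "((\<lambda>n. if n \<in> to_nat ` A then f (from_nat n) else 0) has_sum s) UNIV \<longleftrightarrow> (f has_sum s) A"
proof -
  have "((\<lambda>n. if n \<in> to_nat ` A then f (from_nat n) else 0) has_sum s) UNIV \<longleftrightarrow> ((\<lambda>n. f (from_nat n)) has_sum s) (to_nat ` A)"
    by (rule has_sum_cong_neutral) auto
  also have "\<dots> \<longleftrightarrow> (f has_sum s) A"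
    by (subst has_sum_reindex) (auto simp: o_def inj_on_def)
  finally show ?thesis .
qed

text \<open>For nonnegative terms with all finite sums below K, the function K |g| dominates every
  partial sum, and it also bounds the sum of the norms of the integrals; hence the sum of the
  integrals converges unconditionally.\<close>

lemma
  fixes \<phi> :: "'q::countable \<Rightarrow> real \<Rightarrow> real" and A :: "'q set"
  assumes nonneg: "\<And>q x. 0 \<le> \<phi> q x" and meas [measurable]: "\<And>q. \<phi> q \<in> borel_measurable borel"
    and bounded: "\<And>S x. finite S \<Longrightarrow> S \<subseteq> A \<Longrightarrow> (\<Sum>q\<in>S. \<phi> q x) \<le> K"
  defines "H \<equiv> \<lambda>x. \<Sum>\<^sub>\<infinity>q\<in>A. \<phi> q x"
  shows bounded_family_has_sum: "((\<lambda>q. \<phi> q x) has_sum H x) A"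
    and bounded_family_bound: "\<bar>H x\<bar> \<le> K"
    and bounded_family_measurable: "H \<in> borel_measurable borel"
    and bounded_family_integral: "integrable lborel (g :: real \<Rightarrow> 'a::{banach, second_countable_topology, real_normed_algebra}) \<Longrightarrow>
      ((\<lambda>q. LBINT t. \<phi> q t *\<^sub>R g t) has_sum (LBINT t. H t *\<^sub>R g t)) A"
proof -
  have sum: "(\<lambda>q. \<phi> q x) summable_on A" for x
    using bounded by (intro nonneg_bdd_above_summable_on nonneg bdd_aboveI2[where M = K]) auto
  then show has_sum: "((\<lambda>q. \<phi> q x) has_sum H x) A" for x by (simp add: H_def)
  have H0: "0 \<le> H x" for x unfolding H_def by (intro infsum_nonneg nonneg)
  have HK: "H x \<le> K" for x unfolding H_def by (rule infsum_le_finite_sums[OF sum bounded])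
  show H: "\<bar>H x\<bar> \<le> K" for x using H0[of x] HK[of x] by simp
  define \<psi> where "\<psi> n x = (if n \<in> to_nat ` A then \<phi> (from_nat n) x else 0)" for n x
  have \<psi>: "0 \<le> \<psi> n x" for n x by (simp add: \<psi>_def nonneg)
  have [measurable]: "\<psi> n \<in> borel_measurable borel" for n
    by (cases "n \<in> to_nat ` A") (auto simp: \<psi>_def [abs_def] meas)
  have sums: "(\<lambda>n. \<psi> n x) sums H x" for x
    unfolding \<psi>_def by (intro has_sum_imp_sums has_sum_to_nat_iff[THEN iffD2] has_sum)
  have partial: "(\<Sum>n<N. \<psi> n x) \<le> K" for N x
    using sum_le_suminf[OF sums_summable[OF sums], of "{..<N}" x] \<psi> HK[of x] sums_unique[OF sums, of x] by simp
  show Hm [measurable]: "H \<in> borel_measurable borel"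
    by (rule borel_measurable_LIMSEQ_real[where u = "\<lambda>N x. \<Sum>n<N. \<psi> n x"]) (use sums in \<open>auto simp: sums_def\<close>)
  assume g: "integrable lborel g"
  have [measurable]: "g \<in> borel_measurable borel" using g by auto
  have \<psi>K: "\<bar>\<psi> n x\<bar> \<le> K" for n x
  proof -
    have "\<psi> n x \<le> (\<Sum>i<Suc n. \<psi> i x)" using \<psi> by (simp add: sum_nonneg)
    also have "\<dots> \<le> K" by (rule partial)
    finally show ?thesis using \<psi>[of n x] by simp
  qed
  have int: "integrable lborel (\<lambda>t. \<psi> n t *\<^sub>R g t)" for n
    by (rule integrable_bounded_mult[OF _ \<psi>K g]) measurable
  define J where "J n = (LBINT t. \<psi> n t *\<^sub>R g t)" for n
  have part_sum: "(\<Sum>n<N. J n) = (LBINT t. (\<Sum>n<N. \<psi> n t) *\<^sub>R g t)" for N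
    unfolding J_def scaleR_sum_left by (rule Bochner_Integration.integral_sum[symmetric]) (rule int)
  have "J sums (LBINT t. H t *\<^sub>R g t)"
    unfolding sums_def part_sum
  proof (rule integral_dominated_convergence)
    show "integrable lborel (\<lambda>t. K * norm (g t))" using g by simp
    show "AE t in lborel. norm ((\<Sum>n<N. \<psi> n t) *\<^sub>R g t) \<le> K * norm (g t)" for N
      using partial \<psi> by (intro AE_I2) (simp add: sum_nonneg mult_right_mono)
    show "AE t in lborel. (\<lambda>N. (\<Sum>n<N. \<psi> n t) *\<^sub>R g t) \<longlonglongrightarrow> H t *\<^sub>R g t"
      using sums by (intro AE_I2 tendsto_intros) (simp add: sums_def)
  qed measurable
  moreover have "summable (\<lambda>n. norm (J n))"
  proof (rule summableI_nonneg_bounded)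
    fix N
    have intn: "integrable lborel (\<lambda>t. \<psi> n t * norm (g t))" for n
      using integrable_norm[OF int[of n]] \<psi> by simp
    have "(\<Sum>n<N. norm (J n)) \<le> (\<Sum>n<N. LBINT t. \<psi> n t * norm (g t))"
      unfolding J_def using \<psi> by (intro sum_mono order_trans[OF integral_norm_bound]) simp
    also have "\<dots> = (LBINT t. (\<Sum>n<N. \<psi> n t) * norm (g t))"
      unfolding sum_distrib_right by (rule Bochner_Integration.integral_sum[symmetric]) (rule intn)
    also have "\<dots> \<le> (LBINT t. K * norm (g t))"
    proof (rule integral_mono)
      show "integrable lborel (\<lambda>t. (\<Sum>n<N. \<psi> n t) * norm (g t))"
        unfolding sum_distrib_right by (intro Bochner_Integration.integrable_sum intn)
    qed (use g partial in \<open>auto intro: mult_right_mono\<close>)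
    finally show "(\<Sum>n<N. norm (J n)) \<le> (LBINT t. K * norm (g t))" .
  qed simp
  ultimately have "(J has_sum (LBINT t. H t *\<^sub>R g t)) UNIV" by (intro norm_summable_imp_has_sum)
  moreover have "J = (\<lambda>n. if n \<in> to_nat ` A then (LBINT t. \<phi> (from_nat n) t *\<^sub>R g t) else 0)"
    by (auto simp: J_def \<psi>_def)
  ultimately show "((\<lambda>q. LBINT t. \<phi> q t *\<^sub>R g t) has_sum (LBINT t. H t *\<^sub>R g t)) A"
    using has_sum_to_nat_iff[of A "\<lambda>q. LBINT t. \<phi> q t *\<^sub>R g t"] by metis
qed

subsection \<open>The cusp form attached to the discriminant\<close>

type_synonym int_matrix = "int \<times> int \<times> int \<times> int"

text \<open>The coefficients of q(\<alpha> X + \<beta> Y, \<gamma> X + \<delta> Y), with q read as a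
  homogeneous form.\<close>

definition act :: "int_matrix \<Rightarrow> form \<Rightarrow> form" where
  "act g q = (case g of (\<alpha>, \<beta>, \<gamma>, \<delta>) \<Rightarrow> case q of (a, b, c) \<Rightarrow>
     (a * \<alpha>\<^sup>2 + b * \<alpha> * \<gamma> + c * \<gamma>\<^sup>2, 2 * a * \<alpha> * \<beta> + b * (\<alpha> * \<delta> + \<beta> * \<gamma>) + 2 * c * \<gamma> * \<delta>, a * \<beta>\<^sup>2 + b * \<beta> * \<delta> + c * \<delta>\<^sup>2))"

definition adjugate :: "int_matrix \<Rightarrow> int_matrix" where
  "adjugate g = (case g of (\<alpha>, \<beta>, \<gamma>, \<delta>) \<Rightarrow> (\<delta>, - \<beta>, - \<gamma>, \<alpha>))"

lemma adjugate_adjugate [simp]: "adjugate (adjugate g) = g"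
  by (cases g) (simp add: adjugate_def)

lemma act_adjugate:
  assumes "g \<in> SL2Z"
  shows "act (adjugate g) (act g q) = q"
proof -
  obtain \<alpha> \<beta> \<gamma> \<delta> where g: "g = (\<alpha>, \<beta>, \<gamma>, \<delta>)" by (cases g)
  obtain a b c where q: "q = (a, b, c)" by (cases q)
  have det: "\<alpha> * \<delta> - \<beta> * \<gamma> = 1" using assms by (simp add: g SL2Z_def)
  have "act (adjugate g) (act g q) = (a * (\<alpha> * \<delta> - \<beta> * \<gamma>)\<^sup>2, b * (\<alpha> * \<delta> - \<beta> * \<gamma>)\<^sup>2, c * (\<alpha> * \<delta> - \<beta> * \<gamma>)\<^sup>2)"
    by (simp add: act_def adjugate_def g q algebra_simps power2_eq_square)
  then show ?thesis unfolding det q by simp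
qed

lemma adjugate_SL2Z: "g \<in> SL2Z \<Longrightarrow> adjugate g \<in> SL2Z"
  by (cases g) (simp add: adjugate_def SL2Z_def algebra_simps)

lemma adjugate_Gamma0: "g \<in> Gamma0 M \<Longrightarrow> adjugate g \<in> Gamma0 M"
  by (cases g) (simp add: adjugate_def Gamma0_def algebra_simps)

lemma Gamma0_subset: "Gamma0 M \<subseteq> SL2Z"
  by (auto simp: Gamma0_def SL2Z_def)

lemma SL2Z_eq: "SL2Z = Gamma0 1"
  by (auto simp: Gamma0_def SL2Z_def)

lemma act_in_forms:
  assumes "g \<in> Gamma0 M" "q \<in> forms D M"
  shows "act g q \<in> forms D M"
proof -
  obtain \<alpha> \<beta> \<gamma> \<delta> where g: "g = (\<alpha>, \<beta>, \<gamma>, \<delta>)" by (cases g)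
  obtain a b c where q: "q = (a, b, c)" by (cases q)
  have det: "\<alpha> * \<delta> - \<beta> * \<gamma> = 1" and M: "int M dvd \<gamma>" using assms by (auto simp: g Gamma0_def)
  have f: "b\<^sup>2 - 4 * a * c = D" "int M dvd a" "2 * int M dvd b - 1" using assms by (auto simp: q forms_def)
  have "(2 * a * \<alpha> * \<beta> + b * (\<alpha> * \<delta> + \<beta> * \<gamma>) + 2 * c * \<gamma> * \<delta>)\<^sup>2 - 4 * (a * \<alpha>\<^sup>2 + b * \<alpha> * \<gamma> + c * \<gamma>\<^sup>2) * (a * \<beta>\<^sup>2 + b * \<beta> * \<delta> + c * \<delta>\<^sup>2)
     = (b\<^sup>2 - 4 * a * c) * (\<alpha> * \<delta> - \<beta> * \<gamma>)\<^sup>2"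
    by (simp add: algebra_simps power2_eq_square)
  also have "\<dots> = D" unfolding det f(1) by simp
  finally have 1: "(2 * a * \<alpha> * \<beta> + b * (\<alpha> * \<delta> + \<beta> * \<gamma>) + 2 * c * \<gamma> * \<delta>)\<^sup>2 - 4 * (a * \<alpha>\<^sup>2 + b * \<alpha> * \<gamma> + c * \<gamma>\<^sup>2) * (a * \<beta>\<^sup>2 + b * \<beta> * \<delta> + c * \<delta>\<^sup>2) = D" .
  have 2: "int M dvd a * \<alpha>\<^sup>2 + b * \<alpha> * \<gamma> + c * \<gamma>\<^sup>2"
    using f M by (auto simp: power2_eq_square intro!: dvd_add)
  \<comment> \<open>Determinant 1 turns \<alpha> \<delta> + \<beta> \<gamma> into 1 + 2 \<beta>
    \<gamma>, so b changes only by twice a combination of a and \<gamma>, both divisible by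
    M.\<close>
  have "b * (\<alpha> * \<delta> + \<beta> * \<gamma>) = b * (\<alpha> * \<delta> - \<beta> * \<gamma>) + 2 * (b * \<beta> * \<gamma>)" by (simp add: algebra_simps)
  then have "2 * a * \<alpha> * \<beta> + b * (\<alpha> * \<delta> + \<beta> * \<gamma>) + 2 * c * \<gamma> * \<delta> - 1 = (b - 1) + 2 * (a * (\<alpha> * \<beta>) + \<gamma> * (b * \<beta> + c * \<delta>))"
    unfolding det by (simp add: algebra_simps)
  moreover have "2 * int M dvd (b - 1) + 2 * (a * (\<alpha> * \<beta>) + \<gamma> * (b * \<beta> + c * \<delta>))"
    using f M by (intro dvd_add mult_dvd_mono dvd_mult2) auto
  ultimately have "2 * int M dvd 2 * a * \<alpha> * \<beta> + b * (\<alpha> * \<delta> + \<beta> * \<gamma>) + 2 * c * \<gamma> * \<delta> - 1"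
    by (simp only:)
  with 1 2 show ?thesis unfolding act_def g q forms_def prod.case mem_Collect_eq by blast
qed

lemma bij_act:
  assumes g: "g \<in> Gamma0 M"
  shows "bij_betw (act g) (forms D M) (forms D M)"
proof (rule bij_betw_byWitness[of _ "act (adjugate g)"])
  have "g \<in> SL2Z" using g Gamma0_subset by blast
  then show "\<forall>q\<in>forms D M. act (adjugate g) (act g q) = q" "\<forall>q\<in>forms D M. act g (act (adjugate g) q) = q"
    using act_adjugate[of g] act_adjugate[of "adjugate g"] adjugate_SL2Z[of g] by simp_all
  show "act g ` forms D M \<subseteq> forms D M" "act (adjugate g) ` forms D M \<subseteq> forms D M"
    using act_in_forms[OF g] act_in_forms[OF adjugate_Gamma0[OF g]] by blast+
qed

lemma qf_act:
  fixes z :: complex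
  assumes "of_int \<gamma> * z + of_int \<delta> \<noteq> 0"
  shows "(of_int \<gamma> * z + of_int \<delta>)\<^sup>2 * qf q ((of_int \<alpha> * z + of_int \<beta>) / (of_int \<gamma> * z + of_int \<delta>)) = qf (act (\<alpha>, \<beta>, \<gamma>, \<delta>) q) z"
proof -
  obtain a b c where q: "q = (a, b, c)" by (cases q)
  define u v where "u = of_int \<alpha> * z + of_int \<beta>" and "v = of_int \<gamma> * z + of_int \<delta>"
  have "v \<noteq> 0" using assms by (simp add: v_def)
  then have "v\<^sup>2 * qf q (u / v) = of_int a * u\<^sup>2 + of_int b * u * v + of_int c * v\<^sup>2"
    by (simp add: qf_def q field_simps power2_eq_square)
  also have "\<dots> = qf (act (\<alpha>, \<beta>, \<gamma>, \<delta>) q) z"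
    by (simp add: qf_def q act_def u_def v_def algebra_simps power2_eq_square)
  finally show ?thesis by (simp only: u_def v_def)
qed

text \<open>Substituting t = Re z + y s with y = Im z leaves y^(1 - 2k) times the integral of (1 +
  s^2)^(-k), which is at most pi.\<close>

lemma norm_kernel_integral_le:
  assumes z: "0 < Im z" and k: "1 \<le> k"
  shows "(LBINT t. norm (1 / (z - of_real t) ^ (2 * k))) \<le> pi / Im z ^ (2 * k - 1)"
proof -
  define y where "y = Im z"
  have y: "0 < y" using z by (simp add: y_def)
  have "(LBINT t. norm (1 / (z - of_real t) ^ (2 * k))) = \<bar>y\<bar> *\<^sub>R (LBINT s. norm (1 / (z - of_real (Re z + y * s)) ^ (2 * k)))"
    by (rule lborel_integral_real_affine) (use y in simp)
  also have "(LBINT s. norm (1 / (z - of_real (Re z + y * s)) ^ (2 * k))) \<le> (LBINT s. 1 / y ^ (2 * k) * (1 / (1 + s\<^sup>2)))"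
  proof (rule integral_mono)
    have n: "norm (1 / (z - of_real (Re z + y * s)) ^ (2 * k)) = 1 / (y ^ (2 * k) * (1 + s\<^sup>2) ^ k)" for s
    proof -
      have "norm (z - of_real (Re z + y * s)) ^ 2 = y\<^sup>2 * (1 + s\<^sup>2)"
        unfolding cmod_power2 by (simp add: y_def[symmetric] power_mult_distrib distrib_left)
      then show ?thesis by (simp add: norm_divide norm_power power_mult power_mult_distrib)
    qed
    have le: "1 / (y ^ (2 * k) * (1 + s\<^sup>2) ^ k) \<le> 1 / y ^ (2 * k) * (1 / (1 + s\<^sup>2))" for s
    proof -
      have "(1 + s\<^sup>2) ^ 1 \<le> (1 + s\<^sup>2) ^ k" using k by (intro power_increasing) auto
      moreover have "0 < 1 + s\<^sup>2" by (simp add: add_pos_nonneg)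
      ultimately show ?thesis using y by (simp add: frac_le)
    qed
    show int: "integrable lborel (\<lambda>s::real. 1 / y ^ (2 * k) * (1 / (1 + s\<^sup>2)))"
      by (intro integrable_mult_right integrable_cauchy_kernel)
    show "integrable lborel (\<lambda>s. norm (1 / (z - of_real (Re z + y * s)) ^ (2 * k)))"
    proof (rule Bochner_Integration.integrable_bound[OF int])
      show "AE s in lborel. norm (norm (1 / (z - of_real (Re z + y * s)) ^ (2 * k))) \<le> norm (1 / y ^ (2 * k) * (1 / (1 + s\<^sup>2)))"
        using le n by (intro AE_I2) (simp add: abs_mult)
    qed measurable
    show "norm (1 / (z - of_real (Re z + y * s)) ^ (2 * k)) \<le> 1 / y ^ (2 * k) * (1 / (1 + s\<^sup>2))" for s
      using le n by simp
  qed
  also have "(LBINT s. 1 / y ^ (2 * k) * (1 / (1 + s\<^sup>2))) = 1 / y ^ (2 * k) * pi"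
    by (simp only: integral_mult_right_zero integral_cauchy_kernel)
  also have "\<bar>y\<bar> *\<^sub>R (1 / y ^ (2 * k) * pi) = pi / y ^ (2 * k - 1)"
    using y k power_eq_if[of y "2 * k"] by (simp add: field_simps)
  finally show ?thesis using y by (simp add: y_def mult_left_mono)
qed

text \<open>Minus the form obtained from q by z -> -1 / (M z), with denominators cleared by M z^2;
  the \<open>div\<close> is exact on \<open>forms D M\<close>. The sign is the one that even k
  absorbs.\<close>

definition fricke_form :: "nat \<Rightarrow> form \<Rightarrow> form" where
  "fricke_form M q = (case q of (a, b, c) \<Rightarrow> (- (c * int M), b, - (a div int M)))"

lemma bij_fricke_form:
  assumes M: "0 < M"
  shows "bij_betw (fricke_form M) (forms D M) (forms D M)"
proof (rule bij_betw_byWitness[of _ "fricke_form M"])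
  have div: "- (b * int M) div int M = - b" for b
    using M nonzero_mult_div_cancel_right[of "int M" "- b"] by simp
  show "\<forall>q\<in>forms D M. fricke_form M (fricke_form M q) = q" "\<forall>q\<in>forms D M. fricke_form M (fricke_form M q) = q"
    using M by (auto simp: fricke_form_def forms_def div)
  show "fricke_form M ` forms D M \<subseteq> forms D M" "fricke_form M ` forms D M \<subseteq> forms D M"
    using M by (auto simp: fricke_form_def forms_def div elim!: dvdE)
qed

lemma qf_fricke_form:
  fixes z :: complex
  assumes M: "0 < M" and q: "q \<in> forms D M" and z: "z \<noteq> 0"
  shows "of_nat M * z\<^sup>2 * qf q (- 1 / (of_nat M * z)) = - qf (fricke_form M q) z"
proof -
  obtain a b c where abc: "q = (a, b, c)" by (cases q)
  obtain a' where a: "a = int M * a'" using q by (auto simp: abc forms_def elim: dvdE)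
  show ?thesis using M z by (simp add: abc a qf_def fricke_form_def field_simps power2_eq_square)
qed

section \<open>The series over forms: convergence, holomorphy, modularity\<close>

locale quadratic_disc = nonsquare_disc +
  assumes D_pos: "0 < D" and k_even: "even k"
begin

text \<open>B(k, k) D^(k - 1/2), the constant common to \<open>kernel_integral\<close> and
  \<open>line_integral\<close>.\<close>

definition const :: real where
  "const = beta_poly (k - 1) 1 * sqrt (of_int D) ^ (2 * k - 1)"

definition bump_bound :: real where
  "bump_bound = 4 / 3 * height_bound D k"

definition bump_sum :: "nat \<Rightarrow> real \<Rightarrow> real" where
  "bump_sum M x = (\<Sum>\<^sub>\<infinity>q\<in>forms D M. bump k q x)"

definition form_series :: "nat \<Rightarrow> complex \<Rightarrow> complex" where
  "form_series M z = (\<Sum>\<^sub>\<infinity>q\<in>forms D M. 1 / qf q z ^ k)"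

lemma const_pos: "0 < const"
  unfolding const_def using D_pos k_ge by (intro mult_pos_pos beta_poly_1_pos) auto

lemma kernel_integral:
  assumes "q \<in> forms D M" "0 < Im z"
  shows "has_bochner_integral lborel (\<lambda>x. bump k q x *\<^sub>R (1 / (z - of_real x) ^ (2 * k))) (of_real const / qf q z ^ k)"
proof -
  obtain a b c where q: "q = (a, b, c)" by (cases q)
  have *: "a \<noteq> 0" "b\<^sup>2 - 4 * a * c = D" using fst_nonzero[OF assms(1)] assms(1) by (simp_all add: q forms_def)
  then show ?thesis
    using bump_kernel_integral[of a b c k z, unfolded *(2), OF *(1) D_pos k_ge k_even assms(2)] by (simp only: q const_def)
qed

lemma line_integral:
  assumes "q \<in> forms D M"
  shows "has_bochner_integral lborel (bump k q) (const / \<bar>of_int (fst q)\<bar> ^ k)"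
proof -
  obtain a b c where q: "q = (a, b, c)" by (cases q)
  have *: "a \<noteq> 0" "b\<^sup>2 - 4 * a * c = D" using fst_nonzero[OF assms(1)] assms(1) by (simp_all add: q forms_def)
  then show ?thesis
    using bump_integral[of a b c k, unfolded *(2), OF *(1) D_pos k_ge] by (simp only: q const_def fst_conv)
qed

lemma qf_nz: "q \<in> forms D M \<Longrightarrow> 0 < Im z \<Longrightarrow> qf q z \<noteq> 0"
proof -
  assume q: "q \<in> forms D M" and z: "0 < Im z"
  obtain a b c where abc: "q = (a, b, c)" by (cases q)
  have "a \<noteq> 0" "0 \<le> b\<^sup>2 - 4 * a * c" using fst_nonzero[OF q] q D_pos by (simp_all add: abc forms_def)
  then show ?thesis unfolding abc using z by (rule qf_nonzero)
qed

lemma bump_sum_facts: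
  shows bump_has_sum: "((\<lambda>q. bump k q x) has_sum bump_sum M x) (forms D M)"
    and bump_sum_bound: "\<bar>bump_sum M x\<bar> \<le> bump_bound"
    and bump_sum_measurable: "bump_sum M \<in> borel_measurable borel"
    and bump_sum_integral: "integrable lborel (g :: real \<Rightarrow> 'a::{banach, second_countable_topology, real_normed_algebra}) \<Longrightarrow>
      ((\<lambda>q. LBINT t. bump k q t *\<^sub>R g t) has_sum (LBINT t. bump_sum M t *\<^sub>R g t)) (forms D M)"
proof -
  have le: "(\<Sum>q\<in>S. bump k q x) \<le> bump_bound" if "finite S" "S \<subseteq> forms D M" for S x
    unfolding bump_bound_def using that forms_subset by (intro sum_bump_le) blast+
  note facts = bump_nonneg measurable_bump le
  show "((\<lambda>q. bump k q x) has_sum bump_sum M x) (forms D M)"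
    unfolding bump_sum_def by (rule bounded_family_has_sum[OF facts])
  show "\<bar>bump_sum M x\<bar> \<le> bump_bound"
    unfolding bump_sum_def by (rule bounded_family_bound[OF facts])
  show "bump_sum M \<in> borel_measurable borel"
    unfolding bump_sum_def [abs_def] by (rule bounded_family_measurable[OF facts])
  show "integrable lborel g \<Longrightarrow> ((\<lambda>q. LBINT t. bump k q t *\<^sub>R g t) has_sum (LBINT t. bump_sum M t *\<^sub>R g t)) (forms D M)"
    unfolding bump_sum_def by (rule bounded_family_integral[OF facts])
qed

text \<open>Each |q(z)|^(-k) is at most 1/\<open>const\<close> times the integral of the bump
  against |z - t|^(-2k), and under the integral the bumps add up to at most
  \<open>bump_bound\<close>. Absolute convergence and decay in Im z thus come from the same
  estimate.\<close>

lemma sum_norm_le: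
  assumes S: "finite S" "S \<subseteq> forms D 1" and z: "0 < Im z"
  shows "(\<Sum>q\<in>S. norm (1 / qf q z ^ k)) \<le> bump_bound * pi / const / Im z ^ (2 * k - 1)"
proof -
  define g where "g t = norm (1 / (z - complex_of_real t) ^ (2 * k))" for t
  have g: "integrable lborel g"
    unfolding g_def using z k_ge by (intro integrable_norm integrable_kernel) auto
  have int: "integrable lborel (\<lambda>t. bump k q t * g t)" if "q \<in> S" for q
  proof -
    have "q \<in> forms D 1" using that S by blast
    from integrable_norm[OF integrable.intros[OF kernel_integral[OF this z]]]
    show ?thesis by (simp add: g_def abs_of_nonneg[OF bump_nonneg])
  qed
  have "const * norm (1 / qf q z ^ k) \<le> (LBINT t. bump k q t * g t)" if "q \<in> S" for q
  proof -
    have "const * norm (1 / qf q z ^ k) = norm (LBINT x. bump k q x *\<^sub>R (1 / (z - of_real x) ^ (2 * k)))"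
    proof -
      have "q \<in> forms D 1" using that S by blast
      from has_bochner_integral_integral_eq[OF kernel_integral[OF this z]]
      show ?thesis using const_pos by (simp add: norm_divide)
    qed
    also have "\<dots> \<le> (LBINT x. norm (bump k q x *\<^sub>R (1 / (z - of_real x) ^ (2 * k))))"
      by (rule integral_norm_bound)
    also have "\<dots> = (LBINT t. bump k q t * g t)"
      by (simp add: g_def abs_of_nonneg[OF bump_nonneg])
    finally show ?thesis .
  qed
  then have "const * (\<Sum>q\<in>S. norm (1 / qf q z ^ k)) \<le> (\<Sum>q\<in>S. LBINT t. bump k q t * g t)"
    unfolding sum_distrib_left by (rule sum_mono)
  also have "\<dots> = (LBINT t. (\<Sum>q\<in>S. bump k q t) * g t)"
    unfolding sum_distrib_right by (rule Bochner_Integration.integral_sum[symmetric]) (rule int)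
  also have "\<dots> \<le> (LBINT t. bump_bound * g t)"
  proof (rule integral_mono)
    show "integrable lborel (\<lambda>t. (\<Sum>q\<in>S. bump k q t) * g t)"
      unfolding sum_distrib_right by (intro Bochner_Integration.integrable_sum int)
    show "(\<Sum>q\<in>S. bump k q t) * g t \<le> bump_bound * g t" for t
      unfolding bump_bound_def using sum_bump_le[OF S] by (intro mult_right_mono) (auto simp: g_def)
  qed (use g in simp)
  also have "\<dots> = bump_bound * (LBINT t. g t)" by simp
  also have "\<dots> \<le> bump_bound * (pi / Im z ^ (2 * k - 1))"
    unfolding g_def using z k_ge bump_sum_bound[of 1 0] by (intro mult_left_mono norm_kernel_integral_le) auto
  finally have "(\<Sum>q\<in>S. norm (1 / qf q z ^ k)) \<le> bump_bound * (pi / Im z ^ (2 * k - 1)) / const"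
    by (simp only: pos_le_divide_eq[OF const_pos] mult.commute[of _ const])
  then show ?thesis by (simp add: ac_simps)
qed

text \<open>Every g in SL2(Z) permutes the forms of level 1, so the bound is the same at every cusp,
  also for forms of level M.\<close>

lemma sum_norm_act_le:
  assumes g: "g \<in> SL2Z" and S: "finite S" "S \<subseteq> forms D M" and z: "0 < Im z"
  shows "(\<Sum>q\<in>S. norm (1 / qf (act g q) z ^ k)) \<le> bump_bound * pi / const / Im z ^ (2 * k - 1)"
proof -
  have bij: "bij_betw (act g) (forms D 1) (forms D 1)" using g by (intro bij_act) (simp add: SL2Z_eq)
  have S1: "S \<subseteq> forms D 1" using S forms_subset by blast
  have "(\<Sum>q\<in>S. norm (1 / qf (act g q) z ^ k)) = (\<Sum>q\<in>act g ` S. norm (1 / qf q z ^ k))"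
    using bij_betw_imp_inj_on[OF bij] S1 by (subst sum.reindex) (auto intro: inj_on_subset)
  also have "\<dots> \<le> bump_bound * pi / const / Im z ^ (2 * k - 1)"
    using S z image_mono[OF S1, of "act g"] bij_betw_imp_surj_on[OF bij]
    by (intro sum_norm_le) (simp_all only: finite_imageI)
  finally show ?thesis .
qed

lemma series_abs_summable:
  assumes "g \<in> SL2Z" "0 < Im z"
  shows "(\<lambda>q. norm (1 / qf (act g q) z ^ k)) summable_on forms D M"
proof (rule nonneg_bdd_above_summable_on)
  show "bdd_above (sum (\<lambda>q. norm (1 / qf (act g q) z ^ k)) ` {S. S \<subseteq> forms D M \<and> finite S})"
    using sum_norm_act_le[OF assms(1) _ _ assms(2)] by (intro bdd_aboveI2[where M = "bump_bound * pi / const / Im z ^ (2 * k - 1)"]) blast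
qed simp

lemma act_id [simp]: "act (1, 0, 0, 1) q = q"
  by (cases q) (simp add: act_def)

lemma form_series_abs_summable:
  assumes "0 < Im z"
  shows "(\<lambda>q. norm (1 / qf q z ^ k)) summable_on forms D M"
proof -
  have "(1, 0, 0, 1) \<in> SL2Z" by (simp add: SL2Z_def)
  from series_abs_summable[OF this assms] show ?thesis by (simp only: act_id)
qed

lemma form_series_has_sum:
  assumes "0 < Im z"
  shows "((\<lambda>q. 1 / qf q z ^ k) has_sum form_series M z) (forms D M)"
  unfolding form_series_def by (rule has_sum_infsum[OF abs_summable_summable[OF form_series_abs_summable[OF assms]]])

lemma slash_form_series:
  assumes g: "g \<in> SL2Z" and z: "0 < Im z"
  shows "slash k (int_mat g) (form_series M) z = (\<Sum>\<^sub>\<infinity>q\<in>forms D M. 1 / qf (act g q) z ^ k)"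
proof -
  obtain \<alpha> \<beta> \<gamma> \<delta> where abcd: "g = (\<alpha>, \<beta>, \<gamma>, \<delta>)" by (cases g)
  have det: "\<alpha> * \<delta> - \<beta> * \<gamma> = 1" using g by (simp add: abcd SL2Z_def)
  define u v where "u = of_int \<alpha> * z + of_int \<beta>" and "v = of_int \<gamma> * z + of_int \<delta>"
  have v: "v \<noteq> 0" using z det by (auto simp: v_def complex_eq_iff)
  have det': "of_int \<alpha> * of_int \<delta> - of_int \<beta> * of_int \<gamma> = (1 :: real)"
    using det by (metis of_int_1 of_int_diff of_int_mult)
  have "slash k (int_mat g) (form_series M) z = 1 / v ^ (2 * k) * (\<Sum>\<^sub>\<infinity>q\<in>forms D M. 1 / qf q (u / v) ^ k)"
    unfolding slash_def int_mat_def abcd prod.case det' form_series_def u_def v_def by simp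
  also have "\<dots> = (\<Sum>\<^sub>\<infinity>q\<in>forms D M. 1 / v ^ (2 * k) * (1 / qf q (u / v) ^ k))"
    by (rule infsum_cmult_right'[symmetric])
  also have "\<dots> = (\<Sum>\<^sub>\<infinity>q\<in>forms D M. 1 / qf (act g q) z ^ k)"
  proof (rule infsum_cong)
    fix q
    show "1 / v ^ (2 * k) * (1 / qf q (u / v) ^ k) = 1 / qf (act g q) z ^ k"
      unfolding abcd qf_act[of \<gamma> z \<delta> q \<alpha> \<beta>, folded u_def v_def, OF v, symmetric]
      by (simp add: power_mult power_mult_distrib)
  qed
  finally show ?thesis .
qed

lemma norm_slash_form_series_le:
  assumes g: "g \<in> SL2Z" and z: "0 < Im z"
  shows "norm (slash k (int_mat g) (form_series M) z) \<le> bump_bound * pi / const / Im z ^ (2 * k - 1)"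
proof -
  have "norm (slash k (int_mat g) (form_series M) z) \<le> (\<Sum>\<^sub>\<infinity>q\<in>forms D M. norm (1 / qf (act g q) z ^ k))"
    unfolding slash_form_series[OF assms] by (rule norm_infsum_bound[OF series_abs_summable[OF assms]])
  also have "\<dots> \<le> bump_bound * pi / const / Im z ^ (2 * k - 1)"
    by (rule infsum_le_finite_sums[OF series_abs_summable[OF assms] sum_norm_act_le[OF g _ _ z]])
  finally show ?thesis .
qed

lemma holomorphic_form_series: "form_series M holomorphic_on upper_half"
proof -
  have "form_series M field_differentiable at z" if z: "0 < Im z" for z
  proof -
    \<comment> \<open>On this disc |z - w| \<le> r \<le> Im w, so the factor in
      \<open>qf_norm_le\<close> is at most (1 + 1)^2 = 4.\<close>
    define r where "r = Im z / 2"
    have r: "0 < r" using z by (simp add: r_def)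
    have Im_r: "r \<le> Im w" if "w \<in> cball z r" for w
      using abs_Im_le_cmod[of "z - w"] that by (simp add: r_def dist_norm)
    have bound: "norm (1 / qf q w ^ k) \<le> 4 ^ k * norm (1 / qf q z ^ k)" if q: "q \<in> forms D M" and w: "w \<in> cball z r" for q w
    proof -
      obtain a b c where abc: "q = (a, b, c)" by (cases q)
      have *: "a \<noteq> 0" "0 \<le> b\<^sup>2 - 4 * a * c" using fst_nonzero[OF q] q D_pos by (simp_all add: abc forms_def)
      have Imw: "0 < Im w" using Im_r[OF w] r by simp
      have "norm (qf q z) \<le> (1 + norm (z - w) / Im w)\<^sup>2 * norm (qf q w)"
        unfolding abc using * Imw by (rule qf_norm_le)
      also have "\<dots> \<le> (1 + 1)\<^sup>2 * norm (qf q w)"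
        using w Im_r[OF w] Imw by (intro mult_right_mono power_mono add_left_mono) (auto simp: dist_norm divide_le_eq_1)
      finally have "norm (qf q z) ^ k \<le> (4 * norm (qf q w)) ^ k" by (intro power_mono) auto
      moreover have "0 < norm (qf q z) ^ k" "0 < norm (qf q w) ^ k" using qf_nz[OF q z] qf_nz[OF q Imw] by simp_all
      ultimately show ?thesis by (simp add: norm_divide norm_power field_simps)
    qed
    have lim: "uniform_limit (cball z r) (\<lambda>S w. \<Sum>q\<in>S. 1 / qf q w ^ k) (form_series M) (finite_subsets_at_top (forms D M))"
      unfolding form_series_def [abs_def] using form_series_abs_summable[OF z]
      by (intro Weierstrass_m_test_general[where M = "\<lambda>q. 4 ^ k * norm (1 / qf q z ^ k)"] bound summable_on_cmult_right)
    have holo: "(\<lambda>w. \<Sum>q\<in>S. 1 / qf q w ^ k) holomorphic_on cball z r" if "S \<subseteq> forms D M" for S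
    proof -
      have "(\<lambda>w. 1 / qf q w ^ k) holomorphic_on cball z r" if "q \<in> S" for q
      proof -
        have "(qf q :: complex \<Rightarrow> complex) holomorphic_on cball z r"
          unfolding qf_def [abs_def] by (cases q) (auto intro!: holomorphic_intros)
        moreover have "qf q w \<noteq> 0" if "w \<in> cball z r" for w
          using Im_r[OF that] r \<open>q \<in> S\<close> \<open>S \<subseteq> forms D M\<close> by (intro qf_nz) auto
        ultimately show ?thesis by (intro holomorphic_intros) auto
      qed
      then show ?thesis by (rule holomorphic_on_sum)
    qed
    have "\<forall>\<^sub>F S in finite_subsets_at_top (forms D M). continuous_on (cball z r) (\<lambda>w. \<Sum>q\<in>S. 1 / qf q w ^ k) \<and>
        (\<lambda>w. \<Sum>q\<in>S. 1 / qf q w ^ k) holomorphic_on ball z r"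
      by (rule eventually_finite_subsets_at_top_weakI)
        (auto intro!: holomorphic_on_imp_continuous_on holo holomorphic_on_subset[OF holo])
    then have "form_series M holomorphic_on ball z r"
      using lim by (rule holomorphic_uniform_limit) simp
    then show ?thesis using r by (intro holomorphic_on_imp_differentiable_at[OF _ open_ball]) auto
  qed
  then show ?thesis
    unfolding holomorphic_on_def upper_half_def by (auto intro: field_differentiable_at_within)
qed

text \<open>Vanishing at the cusps is read off from the bound by a multiple of (Im z)^(-(2k - 1)),
  which is uniform in Re z and in the cusp; no Fourier expansion enters.\<close>

lemma cusp_form_form_series: "cusp_form k M (form_series M)"
  unfolding cusp_form_def
proof (intro conjI ballI allI impI)
  show "form_series M holomorphic_on upper_half" by (rule holomorphic_form_series)
  fix g z assume g: "g \<in> Gamma0 M" and z: "z \<in> upper_half"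
  have "slash k (int_mat g) (form_series M) z = (\<Sum>\<^sub>\<infinity>q\<in>forms D M. 1 / qf (act g q) z ^ k)"
    using g z Gamma0_subset by (intro slash_form_series) (auto simp: upper_half_def)
  also have "\<dots> = form_series M z"
    unfolding form_series_def by (rule infsum_reindex_bij_betw[OF bij_act[OF g]])
  finally show "slash k (int_mat g) (form_series M) z = form_series M z" .
next
  fix g and \<epsilon> :: real assume g: "g \<in> SL2Z" and \<epsilon>: "0 < \<epsilon>"
  define B where "B = bump_bound * pi / const"
  have "norm (slash k (int_mat g) (form_series M) z) < \<epsilon>" if z: "max 1 (B / \<epsilon>) < Im z" for z
  proof -
    have "norm (slash k (int_mat g) (form_series M) z) \<le> B / Im z ^ (2 * k - 1)"
      unfolding B_def using z by (intro norm_slash_form_series_le g) auto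
    also have "\<dots> \<le> B / Im z ^ 1"
      using z k_ge const_pos bump_sum_bound[of 1 0] by (intro divide_left_mono power_increasing) (auto simp: B_def)
    also have "\<dots> < \<epsilon>" using z \<epsilon> by (simp add: field_simps)
    finally show ?thesis .
  qed
  then show "\<exists>Y. \<forall>z. Y < Im z \<longrightarrow> norm (slash k (int_mat g) (form_series M) z) < \<epsilon>" by blast
qed

lemma cusp_form_plus_form_series:
  assumes M: "0 < M"
  shows "cusp_form_plus k M (form_series M)"
  unfolding cusp_form_plus_def
proof (intro conjI ballI cusp_form_form_series)
  fix z assume "z \<in> upper_half"
  then have z: "0 < Im z" by (simp add: upper_half_def)
  define m where "m = complex_of_real (sqrt (real M))"
  have m: "m \<noteq> 0" "m\<^sup>2 = of_nat M" using M by (auto simp: m_def simp flip: of_real_power)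
  have z0: "z \<noteq> 0" using z by auto
  have "slash k (fricke M) (form_series M) z = 1 / (m * z) ^ (2 * k) * (\<Sum>\<^sub>\<infinity>q\<in>forms D M. 1 / qf q (- 1 / (of_nat M * z)) ^ k)"
  proof -
    have det: "0 * 0 - (- 1 / sqrt (real M)) * sqrt (real M) = 1" using M by simp
    have e1: "complex_of_real 0 * z + complex_of_real (- 1 / sqrt (real M)) = - 1 / m" by (simp add: m_def)
    have e2: "complex_of_real (sqrt (real M)) * z + complex_of_real 0 = m * z" by (simp add: m_def)
    have e3: "(- 1 / m) / (m * z) = - 1 / (of_nat M * z)"
      unfolding m(2)[symmetric] by (simp add: power2_eq_square mult.assoc)
    show ?thesis unfolding slash_def fricke_def form_series_def prod.case det e1 e2 e3 by simp
  qed
  also have "\<dots> = (\<Sum>\<^sub>\<infinity>q\<in>forms D M. 1 / (m * z) ^ (2 * k) * (1 / qf q (- 1 / (of_nat M * z)) ^ k))"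
    by (rule infsum_cmult_right'[symmetric])
  also have "\<dots> = (\<Sum>\<^sub>\<infinity>q\<in>forms D M. 1 / qf (fricke_form M q) z ^ k)"
  proof (rule infsum_cong)
    fix q assume q: "q \<in> forms D M"
    have "(m * z) ^ (2 * k) * qf q (- 1 / (of_nat M * z)) ^ k = (of_nat M * z\<^sup>2 * qf q (- 1 / (of_nat M * z))) ^ k"
      unfolding m(2)[symmetric] by (simp add: power_mult power_mult_distrib)
    also have "\<dots> = qf (fricke_form M q) z ^ k"
      unfolding qf_fricke_form[OF M q z0] using k_even by (rule power_minus_even)
    finally show "1 / (m * z) ^ (2 * k) * (1 / qf q (- 1 / (of_nat M * z)) ^ k) = 1 / qf (fricke_form M q) z ^ k"
      by simp
  qed
  also have "\<dots> = form_series M z"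
    unfolding form_series_def by (rule infsum_reindex_bij_betw[OF bij_fricke_form[OF M]])
  finally show "slash k (fricke M) (form_series M) z = form_series M z" .
qed

end

subsection \<open>Averages over a period\<close>

context quadratic_disc begin

lemma bump_sum_periodic: "bump_sum M (x + 1) = bump_sum M x"
  unfolding bump_sum_def using infsum_reindex_bij_betw[OF bij_shift[of 1 D M], of "\<lambda>q. bump k q x"]
  by (simp add: bump_shift)

text \<open>Finitely many forms have a c < 0 and give a continuous sum; the sum over the others is
  at most x^2 times a constant, by reversal, and vanishes at 0.\<close>

lemma isCont_bump_sum_0: "isCont (bump_sum M) 0"
proof -
  define T where "T = {q \<in> forms D M. outer_product q < 0}"
  define U where "U = {q \<in> forms D M. 0 < outer_product q}"
  have T: "finite T" unfolding T_def by (rule finite_forms_outer_neg)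
  define g where "g x = (\<Sum>q\<in>T. bump k q x)" for x
  define h where "h x = (\<Sum>\<^sub>\<infinity>q\<in>U. bump k q x)" for x
  have sumU: "(\<lambda>q. bump k q x) summable_on U" for x
    using has_sum_imp_summable[OF bump_has_sum] by (rule summable_on_subset) (auto simp: U_def)
  have "outer_product q < 0 \<or> 0 < outer_product q" if "q \<in> forms D M" for q
    using outer_product_nonzero[OF that] by linarith
  then have TU: "forms D M = T \<union> U" "T \<inter> U = {}" by (auto simp: T_def U_def)
  have split: "bump_sum M x = g x + h x" for x
    unfolding bump_sum_def TU(1) g_def h_def using infsum_Un_disjoint[OF summable_on_finite[OF T] sumU TU(2)] T
    by simp
  have "h x \<le> x\<^sup>2 * bump_bound" if x: "\<bar>x\<bar> \<le> 1" for x
    unfolding h_def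
  proof (rule infsum_le_finite_sums[OF sumU])
    fix S assume S: "finite S" "S \<subseteq> U"
    have U1: "S \<subseteq> {q \<in> forms D 1. 0 < outer_product q}" using S forms_subset unfolding U_def by blast
    then have "reverse ` S \<subseteq> forms D 1" using reverse_in_forms by blast
    then have "(\<Sum>q\<in>reverse ` S. bump k q (1 / x)) \<le> bump_bound"
      unfolding bump_bound_def using S by (intro sum_bump_le) auto
    then show "(\<Sum>q\<in>S. bump k q x) \<le> x\<^sup>2 * bump_bound"
      using S U1 x bump_sum_bound[of 1 0] by (intro sum_bump_outer_pos_le) auto
  qed
  then have upper: "\<forall>\<^sub>F x in at 0. h x \<le> x\<^sup>2 * bump_bound"
    unfolding eventually_at by (intro exI[of _ 1] conjI ballI impI) (simp_all add: dist_real_def)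
  have lower: "\<forall>\<^sub>F x in at 0. 0 \<le> h x"
    by (intro always_eventually allI) (simp add: h_def infsum_nonneg bump_nonneg)
  have "((\<lambda>x. x\<^sup>2 * bump_bound) \<longlongrightarrow> 0) (at 0)"
    using tendsto_mult_left_zero[OF tendsto_null_power[OF tendsto_ident_at, of 2], of bump_bound] by simp
  then have "(h \<longlongrightarrow> 0) (at 0)" by (rule tendsto_sandwich[OF lower upper tendsto_const])
  moreover have "h 0 = 0"
    unfolding h_def using bump_0[OF k_ge] by (intro infsum_0) (auto simp: U_def)
  ultimately have "isCont h 0" by (simp add: isCont_def)
  moreover have "isCont g 0"
    unfolding g_def using continuous_bump[of UNIV k] by (intro continuous_sum) (simp add: continuous_on_eq_continuous_at)
  ultimately have "isCont (\<lambda>x. g x + h x) 0" by (rule isCont_add[rotated])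
  then show ?thesis unfolding split[symmetric] .
qed

lemma bump_sum_eq_mean:
  assumes M: "0 < M" and zero: "\<And>f z. cusp_form_plus k M f \<Longrightarrow> z \<in> upper_half \<Longrightarrow> f z = 0"
  shows "bump_sum M 0 = (LBINT x. indicator {0..<1} x * bump_sum M x)"
proof (rule value_eq_mean_if_kernel_integrals_vanish)
  show "2 \<le> 2 * k" using k_ge by simp
  fix z assume z: "0 < Im z"
  have "form_series M z = 0"
    using zero[OF cusp_form_plus_form_series[OF M]] z by (simp add: upper_half_def)
  then have "((\<lambda>q. of_real const * (1 / qf q z ^ k)) has_sum of_real const * 0) (forms D M)"
    using form_series_has_sum[OF z] by (metis has_sum_cmult_right)
  moreover have "of_real const * (1 / qf q z ^ k) = (LBINT t. bump k q t *\<^sub>R (1 / (z - of_real t) ^ (2 * k)))"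
    if "q \<in> forms D M" for q
    using has_bochner_integral_integral_eq[OF kernel_integral[OF that z]] by simp
  then have "((\<lambda>q. of_real const * (1 / qf q z ^ k)) has_sum 0) (forms D M) \<longleftrightarrow>
      ((\<lambda>q. LBINT t. bump k q t *\<^sub>R (1 / (z - of_real t) ^ (2 * k))) has_sum 0) (forms D M)"
    by (rule has_sum_cong)
  ultimately have "((\<lambda>q. LBINT t. bump k q t *\<^sub>R (1 / (z - of_real t) ^ (2 * k))) has_sum 0) (forms D M)"
    by (simp only: mult_zero_right)
  moreover have "((\<lambda>q. LBINT t. bump k q t *\<^sub>R (1 / (z - of_real t) ^ (2 * k))) has_sum
      (LBINT t. bump_sum M t *\<^sub>R (1 / (z - of_real t) ^ (2 * k)))) (forms D M)"
    using z k_ge by (intro bump_sum_integral integrable_kernel) auto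
  ultimately show "(LBINT t. bump_sum M t *\<^sub>R (1 / (z - of_real t) ^ (2 * k))) = 0"
    by (rule has_sum_unique[symmetric])
qed (rule bump_sum_measurable bump_sum_bound bump_sum_periodic isCont_bump_sum_0)+

text \<open>Representatives for integer translations: x -> x + m adds 2 a m to b, so b can be
  brought into [0, 2|a|) in exactly one way.\<close>

definition reduced :: "nat \<Rightarrow> form set" where
  "reduced M = {q \<in> forms D M. 0 \<le> fst (snd q) \<and> fst (snd q) < 2 * \<bar>fst q\<bar>}"

lemma bij_reduced: "bij_betw (\<lambda>(q, m). shift m q) (reduced M \<times> UNIV) (forms D M)"
proof -
  \<comment> \<open>Division is by 2|a| but a shift adds multiples of 2a; the sign converts the
    quotient into the shift.\<close>
  define j where "j q = sgn (fst q) * (fst (snd q) div (2 * \<bar>fst q\<bar>))" for q :: form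
  have a_sgn: "2 * \<bar>a\<bar> * (sgn a * x) = 2 * a * x" "2 * a * (sgn a * x) = 2 * \<bar>a\<bar> * x" for a x :: int
    by (auto simp: sgn_if abs_if)
  have j_shift: "j (shift m q) = m" if q: "q \<in> reduced M" for q m
  proof -
    obtain a b c where abc: "q = (a, b, c)" by (cases q)
    have b: "0 \<le> b" "b < 2 * \<bar>a\<bar>" using q by (auto simp: reduced_def abc)
    then have a: "2 * \<bar>a\<bar> \<noteq> 0" by linarith
    have "(b + 2 * \<bar>a\<bar> * (sgn a * m)) div (2 * \<bar>a\<bar>) = sgn a * m + b div (2 * \<bar>a\<bar>)"
      by (rule div_mult_self2[OF a])
    also have "b div (2 * \<bar>a\<bar>) = 0" using b by (rule div_pos_pos_trivial)
    finally have "(b + 2 * a * m) div (2 * \<bar>a\<bar>) = sgn a * m" unfolding a_sgn(1) by simp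
    then have "j (shift m q) = sgn a * (sgn a * m)" by (simp add: j_def abc shift_def)
    then show ?thesis using a by (simp add: sgn_if)
  qed
  have shift_j: "shift (- j q) q \<in> reduced M" if q: "q \<in> forms D M" for q
  proof -
    obtain a b c where abc: "q = (a, b, c)" by (cases q)
    have a: "a \<noteq> 0" using fst_nonzero[OF q] by (simp add: abc)
    have "b + 2 * a * - j q = b - 2 * \<bar>a\<bar> * (b div (2 * \<bar>a\<bar>))"
      using a_sgn(2)[of a "b div (2 * \<bar>a\<bar>)"] by (simp add: j_def abc)
    also have "\<dots> = b mod (2 * \<bar>a\<bar>)" by (rule minus_mult_div_eq_mod)
    finally have "fst (snd (shift (- j q) q)) = b mod (2 * \<bar>a\<bar>)" by (simp add: abc shift_def)
    then show ?thesis using a shift_in_forms[OF q, of "- j q"] by (simp add: reduced_def abc)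
  qed
  show ?thesis
  proof (rule bij_betw_byWitness[where f' = "\<lambda>q. (shift (- j q) q, j q)"])
    show "\<forall>p\<in>reduced M \<times> UNIV. (shift (- j (case p of (q, m) \<Rightarrow> shift m q)) (case p of (q, m) \<Rightarrow> shift m q), j (case p of (q, m) \<Rightarrow> shift m q)) = p"
      by (clarify) (simp add: j_shift)
    show "(\<lambda>(q, m). shift m q) ` (reduced M \<times> UNIV) \<subseteq> forms D M"
      by (auto simp: reduced_def intro: shift_in_forms)
    show "(\<lambda>q. (shift (- j q) q, j q)) ` forms D M \<subseteq> reduced M \<times> UNIV"
      using shift_j by blast
  qed simp
qed

text \<open>The indicators of the intervals [m, m + 1) add up to 1 at every point, so
  \<open>bounded_family_integral\<close> applies to them.\<close>

lemma unit_intervals_has_sum: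
  fixes g :: "real \<Rightarrow> real"
  assumes g: "integrable lborel g"
  shows "((\<lambda>m::int. LBINT x. indicator {0..<1} x * g (x + of_int m)) has_sum (LBINT x. g x)) UNIV"
proof -
  define \<phi> where "\<phi> m = (indicator {of_int m..<of_int m + 1} :: real \<Rightarrow> real)" for m :: int
  have \<phi>: "\<phi> m x = (if m = \<lfloor>x\<rfloor> then 1 else 0)" for m x
    using floor_eq_iff[of x m] unfolding \<phi>_def indicator_def by auto
  have bound: "(\<Sum>m\<in>S. \<phi> m x) \<le> 1" if "finite S" for S x
    unfolding \<phi> using that by (simp add: sum.delta)
  have one: "(\<Sum>\<^sub>\<infinity>m\<in>UNIV. \<phi> m x) = 1" for x
  proof -
    have "(\<Sum>\<^sub>\<infinity>m\<in>UNIV. \<phi> m x) = (\<Sum>\<^sub>\<infinity>m\<in>{\<lfloor>x\<rfloor>}. \<phi> m x)" by (rule infsum_cong_neutral) (auto simp: \<phi>)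
    then show ?thesis by (simp add: \<phi>)
  qed
  have "((\<lambda>m. LBINT t. \<phi> m t *\<^sub>R g t) has_sum (LBINT t. (\<Sum>\<^sub>\<infinity>m\<in>UNIV. \<phi> m t) *\<^sub>R g t)) UNIV"
    by (rule bounded_family_integral[OF _ _ bound g]) (auto simp: \<phi>_def)
  moreover have "(LBINT t. \<phi> m t *\<^sub>R g t) = (LBINT x. indicator {0..<1} x * g (x + of_int m))" for m
    using lborel_integral_real_affine[of 1 "\<lambda>t. \<phi> m t *\<^sub>R g t" "of_int m"]
    by (simp add: \<phi>_def indicator_def algebra_simps)
  ultimately show ?thesis by (simp add: one)
qed

text \<open>Unfolding: the period integrals of all translates of one bump add up to its integral
  over the line, which depends on |a| only.\<close>

lemma reduced_has_sum:
  assumes "bump_sum M 0 = (LBINT x. indicator {0..<1} x * bump_sum M x)"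
  shows "((\<lambda>q. const / \<bar>of_int (fst q)\<bar> ^ k) has_sum bump_sum M 0) (reduced M)"
proof -
  have "((\<lambda>q. LBINT x. bump k q x *\<^sub>R (indicator {0..<1} x :: real)) has_sum (LBINT x. bump_sum M x *\<^sub>R indicator {0..<1} x)) (forms D M)"
    by (rule bump_sum_integral) simp
  then have "((\<lambda>q. LBINT x. indicator {0..<1} x * bump k q x) has_sum bump_sum M 0) (forms D M)"
    using assms by (simp add: mult.commute)
  then have "((\<lambda>p. LBINT x. indicator {0..<1} x * bump k (case p of (q, m) \<Rightarrow> shift m q) x) has_sum bump_sum M 0) (reduced M \<times> UNIV)"
    by (subst has_sum_reindex_bij_betw[OF bij_reduced])
  then show ?thesis
  proof (rule has_sum_SigmaD)
    fix q assume "q \<in> reduced M"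
    then have q: "q \<in> forms D M" by (simp add: reduced_def)
    show "((\<lambda>m. LBINT x. indicator {0..<1} x * bump k (case (q, m) of (q, m) \<Rightarrow> shift m q) x) has_sum const / \<bar>of_int (fst q)\<bar> ^ k) UNIV"
      using unit_intervals_has_sum[OF integrable.intros[OF line_integral[OF q]]]
        has_bochner_integral_integral_eq[OF line_integral[OF q]] by (simp add: bump_shift)
  qed
qed

lemma positive_reduced_has_sum:
  assumes "bump_sum M 0 = (LBINT x. indicator {0..<1} x * bump_sum M x)"
  shows "((\<lambda>q. 1 / of_int (fst q) ^ k) has_sum bump_sum M 0 / (2 * const)) {q \<in> reduced M. 0 < fst q}"
proof -
  define P where "P = {q \<in> reduced M. 0 < fst q}"
  define Q where "Q = {q \<in> reduced M. fst q < 0}"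
  define f where "f q = const / \<bar>of_int (fst q)\<bar> ^ k" for q :: form
  have all: "(f has_sum bump_sum M 0) (reduced M)" unfolding f_def by (rule reduced_has_sum[OF assms])
  have "fst q < 0 \<or> 0 < fst q" if "q \<in> reduced M" for q
    using fst_nonzero[of q M] that by (auto simp: reduced_def)
  then have PQ: "reduced M = P \<union> Q" "P \<inter> Q = {}" by (auto simp: P_def Q_def)
  have "f summable_on P" using has_sum_imp_summable[OF all] by (rule summable_on_subset) (auto simp: P_def)
  then have P: "(f has_sum infsum f P) P" by simp
  \<comment> \<open>Only a and c are negated: b must keep its residue modulo 2M and its
    range.\<close>
  have "bij_betw (\<lambda>(a, b, c). (- a, b, - c)) Q P"
    by (rule bij_betw_byWitness[where f' = "\<lambda>(a, b, c). (- a, b, - c)"]) (auto simp: P_def Q_def reduced_def forms_def)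
  from has_sum_reindex_bij_betw[OF this, of f] P have "((\<lambda>q. f (case q of (a, b, c) \<Rightarrow> (- a, b, - c))) has_sum infsum f P) Q" by blast
  then have "(f has_sum infsum f P) Q" by (rule has_sum_cong[THEN iffD1, rotated]) (auto simp: f_def)
  from has_sum_Un_disjoint[OF P this PQ(2)] have "bump_sum M 0 = 2 * infsum f P"
    using all has_sum_unique unfolding PQ(1)[symmetric] by fastforce
  then have "((\<lambda>q. 1 / const * f q) has_sum 1 / const * (bump_sum M 0 / 2)) P"
    using has_sum_cmult_right[OF P, of "1 / const"] by simp
  moreover have "((\<lambda>q. 1 / const * f q) has_sum S) P \<longleftrightarrow> ((\<lambda>q. 1 / of_int (fst q) ^ k) has_sum S) P" for S
    by (rule has_sum_cong) (use const_pos in \<open>auto simp: f_def P_def\<close>)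
  ultimately show ?thesis unfolding P_def[symmetric] by (simp add: mult.commute)
qed

end

text \<open>Writing \<open>b = 2 B + 1\<close>, the forms \<open>(a, b, c)\<close> of discriminant \<open>D\<close> correspond to \<open>a c = B\<^sup>2 + B - (D - 1) / 4\<close>.\<close>

definition root_pairs :: "int \<Rightarrow> nat \<Rightarrow> (int \<times> int) set" where
  "root_pairs D M = {(a, B). 0 \<le> B \<and> B < a \<and> int M dvd a \<and> int M dvd B \<and> a dvd B\<^sup>2 + B - (D - 1) div 4}"

definition middle_coeffs :: "int \<Rightarrow> nat \<Rightarrow> int set" where
  "middle_coeffs D M = {b. real_of_int \<bar>b\<bar> < sqrt (real_of_int D) \<and> b mod (2 * int M) = 1 mod (2 * int M)}"

lemma middle_coeffs_iff: "b \<in> middle_coeffs D M \<longleftrightarrow> b\<^sup>2 < D \<and> 2 * int M dvd b - 1"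
proof -
  have "real_of_int \<bar>b\<bar> = sqrt (real_of_int (b\<^sup>2))" by simp
  then have "real_of_int \<bar>b\<bar> < sqrt (real_of_int D) \<longleftrightarrow> b\<^sup>2 < D"
    by (simp only: real_sqrt_less_iff of_int_less_iff)
  then show ?thesis unfolding middle_coeffs_def by (simp add: mod_eq_dvd_iff)
qed

lemma finite_middle_coeffs: "finite (middle_coeffs D M)"
proof (rule finite_subset)
  show "middle_coeffs D M \<subseteq> {- D..D}"
  proof
    fix b assume "b \<in> middle_coeffs D M"
    moreover have "\<bar>b\<bar> \<le> b\<^sup>2" using self_le_power[of "\<bar>b\<bar>" 2] by (cases "b = 0") auto
    ultimately show "b \<in> {- D..D}" by (auto simp: middle_coeffs_iff)
  qed
qed simp

text \<open>b = 1 + 2 M t gives b^2 = 1 + 4 M (M t^2 + t).\<close>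

lemma dvd_discriminant_diff:
  assumes "D mod (4 * int M) = 1 mod (4 * int M)" "2 * int M dvd b - 1"
  shows "4 * int M dvd D - b\<^sup>2"
proof -
  obtain t where t: "b - 1 = 2 * int M * t" using assms(2) by (rule dvdE)
  have "4 * int M dvd D - 1" using assms(1) by (simp add: mod_eq_dvd_iff)
  moreover have "4 * int M dvd 4 * int M * (int M * t\<^sup>2 + t)" by simp
  moreover have "D - b\<^sup>2 = (D - 1) - 4 * int M * (int M * t\<^sup>2 + t)"
  proof -
    have "b = 2 * int M * t + 1" using t by simp
    then show ?thesis by (simp add: algebra_simps power2_eq_square)
  qed
  ultimately show ?thesis by (simp only: dvd_diff)
qed

context quadratic_disc begin

lemma root_pairs_has_sum:
  assumes mean: "bump_sum M 0 = (LBINT x. indicator {0..<1} x * bump_sum M x)" and D4: "D mod 4 = 1"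
  shows "((\<lambda>p. 1 / of_int (fst p) ^ k) has_sum bump_sum M 0 / (2 * const)) (root_pairs D M)"
proof -
  define n0 where "n0 = (D - 1) div 4"
  have D: "D = 4 * n0 + 1" using D4 by (simp add: n0_def) presburger
  have char: "(a, 2 * B + 1, c) \<in> forms D M \<longleftrightarrow> a * c = B\<^sup>2 + B - n0 \<and> int M dvd a \<and> int M dvd B" for a B c
  proof -
    have "(2 * B + 1)\<^sup>2 - 4 * a * c = D \<longleftrightarrow> 4 * (a * c) = 4 * (B\<^sup>2 + B - n0)"
      unfolding D by (auto simp: algebra_simps power2_eq_square)
    then show ?thesis by (auto simp: forms_def)
  qed
  have "((\<lambda>p. 1 / of_int (fst p) ^ k) has_sum bump_sum M 0 / (2 * const)) (root_pairs D M) \<longleftrightarrow>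
     ((\<lambda>q. 1 / of_int (fst q) ^ k) has_sum bump_sum M 0 / (2 * const)) {q \<in> reduced M. 0 < fst q}"
  proof (rule has_sum_reindex_bij_witness[where j = "\<lambda>(a, B). (a, 2 * B + 1, (B\<^sup>2 + B - n0) div a)" and i = "\<lambda>(a, b, c). (a, (b - 1) div 2)"])
    fix p assume p: "p \<in> root_pairs D M"
    then show "(case p of (a, B) \<Rightarrow> (a, 2 * B + 1, (B\<^sup>2 + B - n0) div a)) \<in> {q \<in> reduced M. 0 < fst q}"
      by (auto simp: root_pairs_def reduced_def char n0_def[symmetric])
  next
    fix q assume q: "q \<in> {q \<in> reduced M. 0 < fst q}"
    obtain a b c where abc: "q = (a, b, c)" by (cases q)
    have qf: "(a, b, c) \<in> forms D M" and ab: "0 < a" "0 \<le> b" "b < 2 * a" using q by (auto simp: abc reduced_def)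
    have "2 dvd b - 1" using qf by (auto simp: forms_def dest: dvd_mult_left)
    then obtain B where B: "b = 2 * B + 1" by (metis dvdE diff_add_cancel)
    have *: "a * c = B\<^sup>2 + B - n0" "int M dvd a" "int M dvd B" using qf char unfolding B by auto
    have c: "(B\<^sup>2 + B - n0) div a = c" using ab unfolding *(1)[symmetric] by simp
    have a: "a dvd B\<^sup>2 + B - n0" unfolding *(1)[symmetric] by simp
    show "(case (case q of (a, b, c) \<Rightarrow> (a, (b - 1) div 2)) of (a, B) \<Rightarrow> (a, 2 * B + 1, (B\<^sup>2 + B - n0) div a)) = q"
      by (simp add: abc B c)
    show "(case q of (a, b, c) \<Rightarrow> (a, (b - 1) div 2)) \<in> root_pairs D M"
      using ab * a by (simp add: abc B root_pairs_def n0_def)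
  qed auto
  then show ?thesis using positive_reduced_has_sum[OF mean] by blast
qed

lemma bump_0_outer_neg:
  assumes "outer_product q < 0"
  shows "bump k q 0 = \<bar>of_int (snd (snd q))\<bar> ^ (k - 1)"
proof (cases q)
  case (fields a b c)
  have "- of_int (sgn a) * of_int c = \<bar>of_int c :: real\<bar>"
    using assms by (auto simp: fields outer_product_def sgn_if mult_less_0_iff)
  then show ?thesis by (simp add: fields bump_def qf_def)
qed

text \<open>At 0 only forms with a c < 0 contribute, each |c|^(k - 1). For fixed b one has -(a/M) c
  = (D - b^2) / (4M), so |c| runs through the divisors of this number; the free sign of c gives the
  factor 2.\<close>

lemma bump_sum_0:
  assumes M: "0 < M" and DM: "D mod (4 * int M) = 1 mod (4 * int M)"
  shows "bump_sum M 0 = 2 * (\<Sum>b\<in>middle_coeffs D M. sigma_div (k - 1) (nat ((D - b\<^sup>2) div (4 * int M))))"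
proof -
  define T where "T = {q \<in> forms D M. outer_product q < 0}"
  define m where "m b = nat ((D - b\<^sup>2) div (4 * int M))" for b
  define \<eta> :: "form \<Rightarrow> int \<times> int \<times> nat" where "\<eta> = (\<lambda>(a, b, c). (b, sgn c, nat \<bar>c\<bar>))"
  define \<iota> :: "int \<times> int \<times> nat \<Rightarrow> form" where "\<iota> = (\<lambda>(b, s, e). (- s * int M * int (m b div e), b, s * int e))"
  define E where "E b = {e. 0 < e \<and> e dvd m b}" for b
  have m: "D - b\<^sup>2 = 4 * int M * int (m b)" "0 < m b" if "b \<in> middle_coeffs D M" for b
  proof -
    have b: "b\<^sup>2 < D" "2 * int M dvd b - 1" using that by (auto simp: middle_coeffs_iff)
    obtain t where t: "D - b\<^sup>2 = 4 * int M * t" using dvd_discriminant_diff[OF DM b(2)] by (rule dvdE)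
    have "0 < 4 * int M * t" using b(1) t by linarith
    then have "0 < t" using M by (simp add: zero_less_mult_iff)
    moreover have "m b = nat t" using M by (simp add: m_def t)
    ultimately show "D - b\<^sup>2 = 4 * int M * int (m b)" "0 < m b" using t by auto
  qed
  have "bump_sum M 0 = (\<Sum>\<^sub>\<infinity>q\<in>T. bump k q 0)"
    unfolding bump_sum_def
  proof (rule infsum_cong_neutral)
    fix q assume q: "q \<in> forms D M - T"
    then have "0 < outer_product q" using outer_product_nonzero[of q M] by (auto simp: T_def)
    then show "bump k q 0 = 0" by (rule bump_0[OF k_ge])
  qed (auto simp: T_def)
  also have "\<dots> = (\<Sum>q\<in>T. \<bar>of_int (snd (snd q))\<bar> ^ (k - 1))"
    using finite_forms_outer_neg[of D M] by (simp add: T_def bump_0_outer_neg)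
  also have "\<dots> = (\<Sum>(b, s, e)\<in>Sigma (middle_coeffs D M) (\<lambda>b. {1, - 1 :: int} \<times> E b). real e ^ (k - 1))"
  proof (rule sum.reindex_bij_witness[where j = \<eta> and i = \<iota>])
    fix q assume q: "q \<in> T"
    obtain a b c where abc: "q = (a, b, c)" by (cases q)
    have ac: "a * c < 0" and D: "b\<^sup>2 - 4 * a * c = D" and bM: "2 * int M dvd b - 1" and "int M dvd a"
      using q by (auto simp: T_def abc forms_def outer_product_def)
    then obtain a' where a': "a = int M * a'" by (auto elim: dvdE)
    have c0: "c \<noteq> 0" using ac by auto
    have b: "b \<in> middle_coeffs D M" using ac D bM by (simp add: middle_coeffs_iff)
    have "4 * int M * int (m b) = 4 * int M * (- (a' * c))"
    proof -
      have "D - b\<^sup>2 = - (4 * a * c)" using D by linarith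
      then show ?thesis unfolding m(1)[OF b] a' by simp
    qed
    moreover have "4 * int M \<noteq> 0" using M by simp
    ultimately have mb: "int (m b) = - (a' * c)" using mult_left_cancel by blast
    have ac': "a' * c < 0" using ac M by (simp add: a' mult.assoc mult_less_0_iff)
    then have mb': "m b = nat \<bar>a'\<bar> * nat \<bar>c\<bar>" using mb
      by (simp flip: nat_mult_distrib abs_mult)
    have sg: "- sgn c * \<bar>a'\<bar> = a'" using ac' by (auto simp: sgn_if mult_less_0_iff)
    have "m b div nat \<bar>c\<bar> = nat \<bar>a'\<bar>" unfolding mb' using c0 by simp
    then have "- sgn c * int M * int (m b div nat \<bar>c\<bar>) = int M * (- sgn c * \<bar>a'\<bar>)" by simp
    then have 1: "- sgn c * int M * int (m b div nat \<bar>c\<bar>) = a" unfolding sg a' .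
    have 2: "sgn c * int (nat \<bar>c\<bar>) = c" by (simp add: sgn_mult_abs)
    show "\<iota> (\<eta> q) = q"
      by (simp only: abc \<eta>_def \<iota>_def prod.case 1 2)
    show "\<eta> q \<in> Sigma (middle_coeffs D M) (\<lambda>b. {1, - 1 :: int} \<times> E b)"
      using b c0 by (auto simp: abc \<eta>_def E_def mb' sgn_if)
    show "(case \<eta> q of (b, s, e) \<Rightarrow> real e ^ (k - 1)) = \<bar>of_int (snd (snd q))\<bar> ^ (k - 1)"
      by (simp add: abc \<eta>_def)
  next
    fix p assume p: "p \<in> Sigma (middle_coeffs D M) (\<lambda>b. {1, - 1 :: int} \<times> E b)"
    obtain b s e where bse: "p = (b, s, e)" by (cases p)
    have b: "b \<in> middle_coeffs D M" and s: "s = 1 \<or> s = - 1" and e: "0 < e" "e dvd m b" using p by (auto simp: bse E_def)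
    obtain f where f: "m b = e * f" using e(2) by (rule dvdE)
    have f0: "0 < f" using m(2)[OF b] f by (cases f) auto
    have div: "m b div e = f" using e f by simp
    show "\<eta> (\<iota> p) = p"
      using s e by (auto simp: bse \<eta>_def \<iota>_def sgn_if)
    have "D = b\<^sup>2 - 4 * (- s * int M * int f) * (s * int e)"
    proof -
      have "D = b\<^sup>2 + 4 * int M * (int e * int f)" using m(1)[OF b] unfolding f by simp
      then show ?thesis using s by (auto simp: algebra_simps)
    qed
    moreover have "(- s * int M * int f) * (s * int e) < 0" using s M e(1) f0 by auto
    ultimately show "\<iota> p \<in> T"
      using b by (simp add: bse \<iota>_def T_def forms_def outer_product_def div middle_coeffs_iff)
  qed
  also have "\<dots> = (\<Sum>b\<in>middle_coeffs D M. \<Sum>p\<in>{1, - 1 :: int} \<times> E b. real (snd p) ^ (k - 1))"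
    using m(2) by (subst sum.Sigma) (auto simp: finite_middle_coeffs E_def split_def)
  also have "\<dots> = (\<Sum>b\<in>middle_coeffs D M. 2 * sigma_div (k - 1) (m b))"
  proof (rule sum.cong[OF refl])
    fix b
    have "(\<Sum>p\<in>{1, - 1 :: int} \<times> E b. real (snd p) ^ (k - 1)) = (\<Sum>s\<in>{1, - 1 :: int}. \<Sum>e\<in>E b. real e ^ (k - 1))"
      by (subst sum.cartesian_product) (simp add: split_def)
    then show "(\<Sum>p\<in>{1, - 1 :: int} \<times> E b. real (snd p) ^ (k - 1)) = 2 * sigma_div (k - 1) (m b)"
      by (simp add: sigma_div_def E_def)
  qed
  finally show ?thesis by (simp add: m_def sum_distrib_left)
qed

text \<open>The factor 2 from the sign of c in \<open>bump_sum_0\<close> cancels the 2 from the sign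
  of a in \<open>positive_reduced_has_sum\<close>.\<close>

lemma divisor_sum_formula:
  assumes M: "0 < M" and DM: "D mod (4 * int M) = 1 mod (4 * int M)" and D4: "D mod 4 = 1"
    and zero: "\<And>f z. cusp_form_plus k M f \<Longrightarrow> z \<in> upper_half \<Longrightarrow> f z = 0"
  shows "((\<lambda>p. 1 / of_int (fst p) ^ k) has_sum
    (\<Sum>b\<in>middle_coeffs D M. sigma_div (k - 1) (nat ((D - b\<^sup>2) div (4 * int M)))) / const) (root_pairs D M)"
proof -
  have "bump_sum M 0 = (LBINT x. indicator {0..<1} x * bump_sum M x)"
    by (rule bump_sum_eq_mean[OF M]) (rule zero)
  from root_pairs_has_sum[OF this D4] show ?thesis unfolding bump_sum_0[OF M DM] by simp
qed

end

subsection \<open>Ideals of the quadratic order\<close>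

text \<open>In lowest terms x = p/q the hypothesis makes every power of q divide w.\<close>

lemma int_if_bounded_denominators:
  fixes x :: real
  assumes x: "x \<in> \<rat>" and w: "(w :: int) > 0" and pow: "\<And>m. of_int w * x ^ m \<in> \<int>"
  shows "x \<in> \<int>"
proof -
  obtain p q where q: "q > 0" "coprime p q" "x = of_int p / of_int q" using x by (rule Rats_cases')
  have dvd: "q ^ m dvd w" for m
  proof -
    obtain s where "of_int w * x ^ m = of_int s" using pow[of m] by (rule Ints_cases)
    then have "(of_int (w * p ^ m) :: real) = of_int (s * q ^ m)" using q by (simp add: power_divide field_simps)
    then have "w * p ^ m = s * q ^ m" by (simp only: of_int_eq_iff)
    then have "q ^ m dvd w * p ^ m" by simp
    moreover have "coprime (q ^ m) (p ^ m)" using q(2) by (simp add: coprime_commute)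
    ultimately show ?thesis by (simp add: coprime_dvd_mult_left_iff)
  qed
  have "q = 1"
  proof (rule ccontr)
    assume "q \<noteq> 1"
    then have "2 \<le> q" using q by simp
    then have "2 ^ nat w \<le> q ^ nat w" by (intro power_mono) auto
    also have "\<dots> \<le> w" using dvd[of "nat w"] w by (rule zdvd_imp_le)
    finally show False using of_nat_less_two_power[of "nat w", where 'a = int] less_imp_le[OF w] by simp
  qed
  then show ?thesis by (simp add: q)
qed

section \<open>The ring of integers\<close>

locale quadratic_ring =
  fixes D :: int
  assumes D_gt: "1 < D" and D_mod: "D mod 4 = 1" and D_squarefree: "squarefree D"
begin

text \<open>Minus the norm of \<open>omega\<close>, which is a root of X^2 - X - n0.\<close>

definition n0 :: int where "n0 = (D - 1) div 4"

lemma D_eq: "D = 4 * n0 + 1"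
  using D_mod unfolding n0_def by presburger

lemma square_neq_D: "b\<^sup>2 \<noteq> D"
proof
  assume b: "b\<^sup>2 = D"
  then have "b\<^sup>2 dvd D" by simp
  then have "b dvd 1" using D_squarefree by (auto simp: squarefree_def)
  then have "b\<^sup>2 = 1" by (auto simp: zdvd1_eq abs_if split: if_splits)
  then show False using b D_gt by simp
qed

lemma sqrt_D_irrational: "sqrt (of_int D) \<notin> \<rat>"
proof
  assume "sqrt (of_int D) \<in> \<rat>"
  then obtain p q where q: "q > 0" "coprime p q" "sqrt (of_int D) = of_int p / of_int q" by (rule Rats_cases')
  have "of_int D = (of_int p / of_int q :: real)\<^sup>2" using q D_gt by (metis of_int_0_le_iff less_le_trans less_imp_le real_sqrt_pow2 zero_le_one order_trans)
  then have "(of_int (D * q\<^sup>2) :: real) = of_int (p\<^sup>2)" using q by (simp add: field_simps)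
  then have eq: "D * q\<^sup>2 = p\<^sup>2" by (simp only: of_int_eq_iff)
  then have "q\<^sup>2 dvd p\<^sup>2" by (metis dvd_triv_right)
  then have "q dvd p" by simp
  then have "q = 1" using q by (metis coprime_absorb_right zdvd1_eq abs_of_pos coprime_commute is_unit_gcd dvd_refl coprime_common_divisor)
  then show False using eq square_neq_D[of p] by simp
qed

lemma rational_combination_zero:
  assumes "a \<in> \<rat>" "b \<in> \<rat>" "a + b * sqrt (of_int D) = 0"
  shows "a = 0 \<and> b = 0"
proof -
  have "b = 0"
  proof (rule ccontr)
    assume b: "b \<noteq> 0"
    then have "sqrt (of_int D) = - a / b" using assms(3) by (simp add: field_simps)
    then show False using sqrt_D_irrational assms by simp
  qed
  then show ?thesis using assms by simp
qed

definition omega :: real where "omega = (1 + sqrt (of_int D)) / 2"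

lemma omega_square: "omega * omega = omega + of_int n0"
proof -
  have "sqrt (of_int D) * sqrt (of_int D) = of_int D" using D_gt by simp
  also have "\<dots> = 4 * of_int n0 + 1" by (subst D_eq) simp
  finally show ?thesis by (simp add: omega_def field_simps)
qed

definition elt :: "int \<Rightarrow> int \<Rightarrow> real" where "elt x y = of_int x + of_int y * omega"

lemma elt_eq_iff [simp]: "elt x y = elt x' y' \<longleftrightarrow> x = x' \<and> y = y'"
proof
  assume "elt x y = elt x' y'"
  then have "(of_int (x - x') + of_int (y - y') / 2) + (of_int (y - y') / 2) * sqrt (of_int D) = 0"
    by (simp add: elt_def omega_def field_simps)
  then have "of_int (x - x') + of_int (y - y') / 2 = (0 :: real) \<and> of_int (y - y') / 2 = (0 :: real)"
    by (intro rational_combination_zero Rats_add Rats_divide Rats_of_int Rats_number_of)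
  then show "x = x' \<and> y = y'" by auto
qed auto

lemma elt_add: "elt x y + elt x' y' = elt (x + x') (y + y')"
  by (simp add: elt_def algebra_simps)

lemma elt_diff: "elt x y - elt x' y' = elt (x - x') (y - y')"
  by (simp add: elt_def algebra_simps)

lemma elt_mult: "elt x y * elt x' y' = elt (x * x' + n0 * (y * y')) (x * y' + y * x' + y * y')"
proof -
  have "elt x y * elt x' y' = of_int (x * x') + of_int (x * y' + y * x') * omega + of_int (y * y') * (omega * omega)"
    by (simp add: elt_def algebra_simps)
  then show ?thesis by (simp only: omega_square) (simp add: elt_def algebra_simps)
qed

lemma elt_0: "elt 0 0 = 0"
  by (simp add: elt_def)

lemma elt_eq_0_iff [simp]: "elt x y = 0 \<longleftrightarrow> x = 0 \<and> y = 0"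
  using elt_eq_iff[of x y 0 0] by (simp only: elt_0)

text \<open>The coordinates of powers satisfy a two-term recursion, from which multiplicativity of
  the norm and the growth of denominators are read off by induction.\<close>

lemma power_coordinates:
  fixes a b :: real
  assumes a: "a \<in> \<rat>" and b: "b \<in> \<rat>"
  obtains A B :: "nat \<Rightarrow> real" where "\<And>m. A m \<in> \<rat>" "\<And>m. B m \<in> \<rat>"
    "\<And>m. (a + b * sqrt (of_int D)) ^ m = A m + B m * sqrt (of_int D)"
    "\<And>m. (A m)\<^sup>2 - of_int D * (B m)\<^sup>2 = (a\<^sup>2 - of_int D * b\<^sup>2) ^ m"
    "\<And>w m. of_int w * a \<in> \<int> \<Longrightarrow> of_int w * b \<in> \<int> \<Longrightarrow> of_int w ^ m * A m \<in> \<int> \<and> of_int w ^ m * B m \<in> \<int>"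
proof -
  define r where "r = sqrt (of_int D)"
  have r: "r * r = of_int D" using D_gt by (simp add: r_def)
  define AB where "AB = rec_nat (1 :: real, 0 :: real) (\<lambda>_ p. (a * fst p + of_int D * (b * snd p), a * snd p + b * fst p))"
  have AB0: "AB 0 = (1, 0)" and ABS: "AB (Suc m) = (a * fst (AB m) + of_int D * (b * snd (AB m)), a * snd (AB m) + b * fst (AB m))" for m
    by (simp_all add: AB_def)
  show thesis
  proof (rule that[of "\<lambda>m. fst (AB m)" "\<lambda>m. snd (AB m)"])
    have rat: "fst (AB m) \<in> \<rat> \<and> snd (AB m) \<in> \<rat>" for m
      by (induction m) (auto simp: AB0 ABS a b)
    show "fst (AB m) \<in> \<rat>" "snd (AB m) \<in> \<rat>" for m using rat by auto
    show "(a + b * sqrt (of_int D)) ^ m = fst (AB m) + snd (AB m) * sqrt (of_int D)" for m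
      unfolding r_def[symmetric]
    proof (induction m)
      case (Suc m)
      have "(a + b * r) ^ Suc m = (a + b * r) * (fst (AB m) + snd (AB m) * r)" by (simp add: Suc)
      also have "\<dots> = (a * fst (AB m) + (r * r) * (b * snd (AB m))) + (a * snd (AB m) + b * fst (AB m)) * r"
        by (simp add: algebra_simps)
      finally show ?case unfolding r by (simp add: ABS)
    qed (simp add: AB0)
    show "(fst (AB m))\<^sup>2 - of_int D * (snd (AB m))\<^sup>2 = (a\<^sup>2 - of_int D * b\<^sup>2) ^ m" for m
    proof (induction m)
      case (Suc m)
      have "(fst (AB (Suc m)))\<^sup>2 - of_int D * (snd (AB (Suc m)))\<^sup>2 = (a\<^sup>2 - of_int D * b\<^sup>2) * ((fst (AB m))\<^sup>2 - of_int D * (snd (AB m))\<^sup>2)"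
        by (simp add: ABS algebra_simps power2_eq_square)
      then show ?case by (simp add: Suc)
    qed (simp add: AB0)
    show "of_int w ^ m * fst (AB m) \<in> \<int> \<and> of_int w ^ m * snd (AB m) \<in> \<int>"
      if "of_int w * a \<in> \<int>" "of_int w * b \<in> \<int>" for w m
    proof (induction m)
      case (Suc m)
      have "of_int w ^ Suc m * fst (AB (Suc m)) = (of_int w * a) * (of_int w ^ m * fst (AB m)) + of_int D * ((of_int w * b) * (of_int w ^ m * snd (AB m)))"
        "of_int w ^ Suc m * snd (AB (Suc m)) = (of_int w * a) * (of_int w ^ m * snd (AB m)) + (of_int w * b) * (of_int w ^ m * fst (AB m))"
        by (simp_all add: ABS algebra_simps)
      then show ?case using Suc that by (auto intro!: Ints_add Ints_mult)
    qed (simp add: AB0)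
  qed
qed

text \<open>The powers of an algebraic integer have bounded denominators, hence so do the powers of its norm,
  which is therefore an integer.\<close>

lemma norm_alg_integer:
  assumes a: "a \<in> \<rat>" and b: "b \<in> \<rat>" and alg: "alg_integer (a + b * sqrt (of_int D))"
  shows "a\<^sup>2 - of_int D * b\<^sup>2 \<in> \<int>"
proof -
  obtain p :: "int poly" where p: "lead_coeff p = 1" "poly (map_poly of_int p) (a + b * sqrt (of_int D)) = 0"
    using alg by (auto simp: alg_integer_def)
  obtain A B where AB: "\<And>m. A m \<in> \<rat>" "\<And>m. B m \<in> \<rat>"
    "\<And>m. (a + b * sqrt (of_int D)) ^ m = A m + B m * sqrt (of_int D)"
    "\<And>m. (A m)\<^sup>2 - of_int D * (B m)\<^sup>2 = (a\<^sup>2 - of_int D * b\<^sup>2) ^ m"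
    "\<And>w m. of_int w * a \<in> \<int> \<Longrightarrow> of_int w * b \<in> \<int> \<Longrightarrow> of_int w ^ m * A m \<in> \<int> \<and> of_int w ^ m * B m \<in> \<int>"
    using power_coordinates[OF a b] by blast
  define d where "d = degree p"
  define c where "c i = (of_int (coeff p i) :: real)" for i
  have cd: "c d = 1" using p by (simp add: c_def d_def)
  \<comment> \<open>The monic equation times the j-th power, compared coordinatewise, is a linear
    recurrence with integer coefficients.\<close>
  have rec: "A (j + d) = - (\<Sum>i<d. c i * A (j + i)) \<and> B (j + d) = - (\<Sum>i<d. c i * B (j + i))" for j
  proof -
    have "0 = (a + b * sqrt (of_int D)) ^ j * (\<Sum>i\<le>d. c i * (a + b * sqrt (of_int D)) ^ i)"
      using p(2) by (simp add: poly_altdef degree_map_poly coeff_map_poly c_def d_def)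
    also have "\<dots> = (\<Sum>i\<le>d. c i * (A (j + i) + B (j + i) * sqrt (of_int D)))"
      unfolding AB(3)[symmetric] by (simp add: sum_distrib_left power_add mult_ac)
    also have "\<dots> = (\<Sum>i\<le>d. c i * A (j + i)) + (\<Sum>i\<le>d. c i * B (j + i)) * sqrt (of_int D)"
      by (simp add: sum.distrib sum_distrib_right distrib_left mult.assoc)
    finally have "(\<Sum>i\<le>d. c i * A (j + i)) = 0 \<and> (\<Sum>i\<le>d. c i * B (j + i)) = 0"
      using AB(1,2) by (intro rational_combination_zero) (auto intro!: Rats_sum simp: c_def)
    then show ?thesis using cd by (simp add: lessThan_Suc_atMost[symmetric])
  qed
  obtain u1 v1 where a': "v1 > 0" "a = of_int u1 / of_int v1" using a by (rule Rats_cases')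
  obtain u2 v2 where b': "v2 > 0" "b = of_int u2 / of_int v2" using b by (rule Rats_cases')
  define w where "w = v1 * v2"
  have w: "w > 0" using a' b' by (simp add: w_def)
  have wab: "of_int w * a \<in> \<int>" "of_int w * b \<in> \<int>"
    using a' b' by (auto simp: w_def)
  \<comment> \<open>Below index d the factor w^m already clears denominators; from d on the
    recurrence creates no new ones.\<close>
  have int: "of_int (w ^ d) * A m \<in> \<int> \<and> of_int (w ^ d) * B m \<in> \<int>" for m
  proof (induction m rule: less_induct)
    case (less m)
    show ?case
    proof (cases "m < d")
      case True
      then have "w ^ d = w ^ (d - m) * w ^ m" by (simp flip: power_add)
      then have "of_int (w ^ d) * A m = of_int (w ^ (d - m)) * (of_int w ^ m * A m)"
        "of_int (w ^ d) * B m = of_int (w ^ (d - m)) * (of_int w ^ m * B m)" by simp_all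
      then show ?thesis using AB(5)[OF wab, of m] by (simp only: Ints_mult Ints_of_int)
    next
      case False
      define j where "j = m - d"
      have m: "m = j + d" using False by (simp add: j_def)
      have "of_int (w ^ d) * A m = - (\<Sum>i<d. c i * (of_int (w ^ d) * A (j + i)))"
        "of_int (w ^ d) * B m = - (\<Sum>i<d. c i * (of_int (w ^ d) * B (j + i)))"
        unfolding m using rec[of j] by (simp_all add: sum_distrib_left mult_ac)
      moreover have "c i * (of_int (w ^ d) * A (j + i)) \<in> \<int>" "c i * (of_int (w ^ d) * B (j + i)) \<in> \<int>" if "i < d" for i
        using less[of "j + i"] that by (simp_all add: m c_def Ints_mult del: of_int_power)
      ultimately show ?thesis by (simp only:) (intro conjI Ints_minus Ints_sum; blast)
    qed
  qed
  show ?thesis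
  proof (rule int_if_bounded_denominators)
    show "a\<^sup>2 - of_int D * b\<^sup>2 \<in> \<rat>" using a b by simp
    show "0 < w ^ d * w ^ d" using w by simp
    fix m
    have "of_int (w ^ d * w ^ d) * (a\<^sup>2 - of_int D * b\<^sup>2) ^ m = (of_int (w ^ d) * A m)\<^sup>2 - of_int D * (of_int (w ^ d) * B m)\<^sup>2"
      unfolding AB(4)[symmetric] by (simp add: algebra_simps power2_eq_square)
    then show "of_int (w ^ d * w ^ d) * (a\<^sup>2 - of_int D * b\<^sup>2) ^ m \<in> \<int>"
      using int[of m] by (simp only: power2_eq_square Ints_diff Ints_mult Ints_of_int)
  qed
qed

text \<open>With \<open>norm_alg_integer\<close> for x and for x - 1 the trace becomes an integer;
  this translation replaces closure under addition.\<close>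

lemma alg_integer_minus_1:
  assumes "alg_integer x"
  shows "alg_integer (x - 1)"
proof -
  obtain p :: "int poly" where p: "lead_coeff p = 1" "poly (map_poly of_int p) x = 0"
    using assms by (auto simp: alg_integer_def)
  have "lead_coeff (pcompose p [:1, 1:]) = 1" using p by (subst lead_coeff_comp) auto
  moreover have "poly (map_poly of_int (pcompose q [:1, 1:])) y = poly (map_poly of_int q) (y + 1)" for q :: "int poly" and y :: real
  proof (induction q)
    case (pCons a q)
    have add: "map_poly (of_int :: int \<Rightarrow> real) (f + g) = map_poly of_int f + map_poly of_int g" for f g
      by (intro poly_eqI) (simp add: coeff_map_poly)
    have "pcompose (pCons a q) [:1, 1:] = [:a:] + (pcompose q [:1, 1:] + pCons 0 (pcompose q [:1, 1:]))"
      by (simp add: pcompose_pCons)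
    then show ?case by (simp add: add map_poly_pCons pCons.IH algebra_simps)
  qed simp
  from this[of p "x - 1"] have "poly (map_poly of_int (pcompose p [:1, 1:])) (x - 1) = 0" using p(2) by simp
  ultimately show ?thesis unfolding alg_integer_def by blast
qed

lemma alg_integer_elt: "alg_integer (elt x y)"
proof -
  define T N where "T = 2 * x + y" and "N = x * x + x * y - n0 * (y * y)"
  have "elt x y * elt x y - of_int T * elt x y + of_int N = 0"
    unfolding elt_mult by (simp add: elt_def T_def N_def algebra_simps)
  then have "poly (map_poly of_int [:N, - T, 1:]) (elt x y) = 0"
    by (simp add: map_poly_pCons algebra_simps)
  then show ?thesis unfolding alg_integer_def by (intro exI[of _ "[:N, - T, 1:]"]) simp
qed

lemma ring_of_integers_eq: "ring_of_integers D = {elt x y | x y. True}"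
proof (intro equalityI subsetI)
  fix z assume "z \<in> {elt x y | x y. True}"
  then obtain x y where z: "z = elt x y" by blast
  have "elt x y = of_rat (of_int x + of_int y / 2) + of_rat (of_int y / 2) * sqrt (of_int D)"
    by (simp add: elt_def omega_def of_rat_add of_rat_divide) (simp add: field_simps)
  then have "elt x y \<in> quad_field D" unfolding quad_field_def by blast
  then show "z \<in> ring_of_integers D" using alg_integer_elt by (simp add: ring_of_integers_def z)
next
  fix z assume z: "z \<in> ring_of_integers D"
  then obtain a' b' where "z = of_rat a' + of_rat b' * sqrt (of_int D)" by (auto simp: ring_of_integers_def quad_field_def)
  define a b :: real where "a = of_rat a'" and "b = of_rat b'"
  have zab: "z = a + b * sqrt (of_int D)" by (simp add: a_def b_def \<open>z = _\<close>)
  have rat: "a \<in> \<rat>" "b \<in> \<rat>" by (simp_all add: a_def b_def)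
  have alg: "alg_integer (a + b * sqrt (of_int D))" using z by (simp add: ring_of_integers_def zab)
  have N: "a\<^sup>2 - of_int D * b\<^sup>2 \<in> \<int>" by (rule norm_alg_integer[OF rat alg])
  have "alg_integer ((a - 1) + b * sqrt (of_int D))" using alg_integer_minus_1[OF alg] by (simp add: algebra_simps)
  then have N1: "(a - 1)\<^sup>2 - of_int D * b\<^sup>2 \<in> \<int>" using rat by (intro norm_alg_integer) auto
  \<comment> \<open>The trace as N(x) - N(x - 1) + 1.\<close>
  have "2 * a = (a\<^sup>2 - of_int D * b\<^sup>2) - ((a - 1)\<^sup>2 - of_int D * b\<^sup>2) + 1" by (simp add: power2_eq_square algebra_simps)
  then have "2 * a \<in> \<int>" using N N1 by (simp only: Ints_add Ints_diff Ints_1)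
  then obtain s where s: "2 * a = of_int s" by (rule Ints_cases)
  obtain n where n: "a\<^sup>2 - of_int D * b\<^sup>2 = of_int n" using N by (rule Ints_cases)
  have Db: "of_int D * (2 * b)\<^sup>2 = of_int (s\<^sup>2 - 4 * n)"
  proof -
    have "of_int D * (2 * b)\<^sup>2 = (2 * a)\<^sup>2 - 4 * (a\<^sup>2 - of_int D * b\<^sup>2)" by (simp add: power2_eq_square algebra_simps)
    then show ?thesis unfolding s n by simp
  qed
  have "2 * b \<in> \<rat>" using rat by simp
  then obtain u v where v: "v > 0" "coprime u v" "2 * b = of_int u / of_int v" by (rule Rats_cases')
  have "(of_int (D * u\<^sup>2) :: real) = of_int ((s\<^sup>2 - 4 * n) * v\<^sup>2)"
    using Db v(1) unfolding v(3) by (simp add: power_divide field_simps)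
  then have "D * u\<^sup>2 = (s\<^sup>2 - 4 * n) * v\<^sup>2" by (simp only: of_int_eq_iff)
  then have "v\<^sup>2 dvd D * u\<^sup>2" by simp
  moreover have "coprime (v\<^sup>2) (u\<^sup>2)" using v(2) by (simp add: coprime_commute)
  \<comment> \<open>Squarefreeness of D enters here: the denominator v of 2 b must be 1.\<close>
  ultimately have "v\<^sup>2 dvd D" by (simp add: coprime_dvd_mult_left_iff)
  then have "v dvd 1" using D_squarefree by (auto simp: squarefree_def)
  then have "v = 1" using v(1) by simp
  then have u: "2 * b = of_int u" using v by simp
  have "(of_int (D * u\<^sup>2) :: real) = of_int (s\<^sup>2 - 4 * n)" using Db unfolding u by simp
  then have eq: "D * u\<^sup>2 = s\<^sup>2 - 4 * n" by (simp only: of_int_eq_iff)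
  \<comment> \<open>Since D is 1 modulo 4, s and u have equal parity, as coordinates in the basis 1,
    \<open>omega\<close> require.\<close>
  have "4 * (n0 * u\<^sup>2 + n) = s\<^sup>2 - u\<^sup>2" using eq by (subst (asm) D_eq) (simp add: algebra_simps)
  then have "s\<^sup>2 - u\<^sup>2 = 2 * (2 * (n0 * u\<^sup>2 + n))" by simp
  then have "even (s\<^sup>2 - u\<^sup>2)" by (rule dvdI)
  then have "even (s - u)" by simp
  define x where "x = (s - u) div 2"
  have x: "s = u + 2 * x" using \<open>even (s - u)\<close> by (simp add: x_def)
  have "z = elt x u" using s u unfolding zab elt_def omega_def x by (simp add: field_simps)
  then show "z \<in> {elt x y | x y. True}" by blast
qed

end

lemma int_subgroup_generator:
  fixes S :: "int set"
  assumes diff: "\<And>x y. x \<in> S \<Longrightarrow> y \<in> S \<Longrightarrow> x - y \<in> S" and nz: "s \<in> S" "s \<noteq> 0"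
  obtains t where "0 < t" "t \<in> S" "\<And>x. x \<in> S \<Longrightarrow> t dvd x"
proof -
  have zero: "0 \<in> S" using diff[OF nz(1) nz(1)] by simp
  have neg: "- x \<in> S" if "x \<in> S" for x using diff[OF zero that] by simp
  have add: "x + y \<in> S" if "x \<in> S" "y \<in> S" for x y using diff[OF that(1) neg[OF that(2)]] by simp
  have mult_nat: "of_nat n * x \<in> S" if "x \<in> S" for x n
    by (induction n) (auto simp: zero distrib_right add that)
  have mult: "q * x \<in> S" if "x \<in> S" for x q
    using mult_nat[OF that, of "nat q"] neg[OF mult_nat[OF that, of "nat (- q)"]] by (cases "0 \<le> q") auto
  define n where "n = (LEAST n. 0 < n \<and> int n \<in> S)"
  have "\<exists>n. 0 < n \<and> int n \<in> S"
    using nz neg[OF nz(1)] by (intro exI[of _ "nat \<bar>s\<bar>"]) (auto simp: abs_if)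
  then have n: "0 < n \<and> int n \<in> S" unfolding n_def by (rule LeastI_ex)
  have "int n dvd x" if "x \<in> S" for x
  proof (rule ccontr)
    assume nd: "\<not> int n dvd x"
    have "x mod int n = x - (x div int n) * int n" by (simp add: minus_div_mult_eq_mod)
    then have "x mod int n \<in> S" using diff[OF that mult] n by simp
    moreover have "x mod int n \<noteq> 0" using nd unfolding dvd_eq_mod_eq_0 .
    moreover have "0 \<le> x mod int n" "x mod int n < int n" using n by simp_all
    ultimately have "0 < nat (x mod int n) \<and> int (nat (x mod int n)) \<in> S" "nat (x mod int n) < n" by auto
    then show False unfolding n_def using not_less_Least by blast
  qed
  then show thesis using that[of "int n"] n by simp
qed

section \<open>Normal form and norm of ideals\<close>

context quadratic_ring begin

text \<open>The lattice t (a Z + (B + \<open>omega\<close>) Z): t is the integer content, and a is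
  the norm of the primitive part.\<close>

definition lat :: "int \<Rightarrow> int \<Rightarrow> int \<Rightarrow> real set" where
  "lat t a B = {elt (t * (a * i + B * j)) (t * j) | i j. True}"

lemma elt_in_lat: "elt x y \<in> lat t a B \<longleftrightarrow> (\<exists>i j. x = t * (a * i + B * j) \<and> y = t * j)"
  by (auto simp: lat_def)

text \<open>B^2 + B - n0 is the norm of B + \<open>omega\<close>; its divisibility by a makes the
  lattice closed under multiplication by \<open>omega\<close>.\<close>

definition triples :: "(int \<times> int \<times> int) set" where
  "triples = {(t, a, B). 0 < t \<and> 0 \<le> B \<and> B < a \<and> a dvd B\<^sup>2 + B - n0}"

lemma elt_in_ring [simp]: "elt x y \<in> ring_of_integers D"
  by (auto simp: ring_of_integers_eq)

lemma ring_elt_cases: "z \<in> ring_of_integers D \<Longrightarrow> (\<And>x y. z = elt x y \<Longrightarrow> P) \<Longrightarrow> P"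
  by (auto simp: ring_of_integers_eq)

lemma is_ideal_lat:
  assumes "(t, a, B) \<in> triples"
  shows "is_ideal D (lat t a B)" "lat t a B \<noteq> {0}"
proof -
  have t: "0 < t" "0 < a" and a: "a dvd B\<^sup>2 + B - n0" using assms by (auto simp: triples_def)
  obtain c where c: "B\<^sup>2 + B - n0 = a * c" using a by (rule dvdE)
  have n0: "n0 = B\<^sup>2 + B - a * c" using c by simp
  show "is_ideal D (lat t a B)"
    unfolding is_ideal_def
  proof (intro conjI ballI)
    show "lat t a B \<subseteq> ring_of_integers D" by (auto simp: lat_def)
    show "0 \<in> lat t a B" unfolding elt_0[symmetric] elt_in_lat by (intro exI[of _ 0]) simp
    fix x assume "x \<in> lat t a B"
    then obtain i j where x: "x = elt (t * (a * i + B * j)) (t * j)" by (auto simp: lat_def)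
    show "x + y \<in> lat t a B" if y: "y \<in> lat t a B" for y
    proof -
      obtain i' j' where y: "y = elt (t * (a * i' + B * j')) (t * j')" using y by (auto simp: lat_def)
      show ?thesis unfolding x y elt_add elt_in_lat
        by (intro exI[of _ "i + i'"] exI[of _ "j + j'"]) (simp add: algebra_simps)
    qed
    show "r * x \<in> lat t a B" if "r \<in> ring_of_integers D" for r
    proof -
      obtain u v where r: "r = elt u v" using \<open>r \<in> ring_of_integers D\<close> by (rule ring_elt_cases)
      \<comment> \<open>The witnesses come from \<open>omega\<close> a = -B a + a (B +
        \<open>omega\<close>) and \<open>omega\<close> (B + \<open>omega\<close>) = -c a + (B + 1)(B
        + \<open>omega\<close>).\<close>
      show ?thesis unfolding r x elt_mult elt_in_lat
        by (intro exI[of _ "u * i - v * (B * i + c * j)"] exI[of _ "u * j + v * (a * i + B * j) + v * j"])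
          (simp add: n0 algebra_simps power2_eq_square)
    qed
  qed
  have "elt (t * a) 0 \<in> lat t a B" unfolding elt_in_lat by (intro exI[of _ 1] exI[of _ 0]) simp
  moreover have "elt (t * a) 0 \<noteq> 0" using t by simp
  ultimately show "lat t a B \<noteq> {0}" by blast
qed

text \<open>Hermite normal form: A generates the integers in I, and t the
  \<open>omega\<close>-coordinates of I. Multiplication by \<open>omega\<close> shows that t divides
  A and the integer part of any element with \<open>omega\<close>-coordinate t.\<close>

lemma ideal_eq_lat:
  assumes I: "is_ideal D I" and nz: "I \<noteq> {0}"
  obtains t a B where "(t, a, B) \<in> triples" "I = lat t a B"
proof -
  have sub: "I \<subseteq> ring_of_integers D" and zero: "0 \<in> I" and add: "\<And>x y. x \<in> I \<Longrightarrow> y \<in> I \<Longrightarrow> x + y \<in> I"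
    and mult: "\<And>x r. x \<in> I \<Longrightarrow> r \<in> ring_of_integers D \<Longrightarrow> r * x \<in> I" using I by (auto simp: is_ideal_def)
  have smult: "elt (q * x) (q * y) \<in> I" if "elt x y \<in> I" for q x y
    using mult[OF that, of "elt q 0"] by (simp add: elt_mult)
  have diff: "elt (x - x') (y - y') \<in> I" if "elt x y \<in> I" "elt x' y' \<in> I" for x y x' y'
    using add[OF that(1) smult[OF that(2), of "- 1"]] by (simp add: elt_add)
  have om: "elt (n0 * y) (x + y) \<in> I" if "elt x y \<in> I" for x y
    using mult[OF that, of "elt 0 1"] by (simp add: elt_mult)
  obtain z where z: "z \<in> I" "z \<noteq> 0" using zero nz by blast
  obtain x0 y0 where xy: "z = elt x0 y0" using ring_elt_cases[of z] z sub by blast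
  \<comment> \<open>The norm of z, from multiplying by the conjugate x0 + y0 - y0
    \<open>omega\<close>; it supplies a nonzero integer in I.\<close>
  define nz0 where "nz0 = x0 * x0 + x0 * y0 - n0 * (y0 * y0)"
  have "elt nz0 0 \<in> I" using mult[OF z(1), of "elt (x0 + y0) (- y0)"]
    by (simp add: xy elt_mult nz0_def algebra_simps)
  have nz0: "nz0 \<noteq> 0"
  proof
    assume "nz0 = 0"
    moreover have "(2 * x0 + y0)\<^sup>2 - (4 * n0 + 1) * y0\<^sup>2 = 4 * nz0" by (simp add: nz0_def algebra_simps power2_eq_square)
    ultimately have "(2 * x0 + y0)\<^sup>2 = D * y0\<^sup>2" unfolding D_eq[symmetric] by simp
    then have "(of_int ((2 * x0 + y0)\<^sup>2) :: real) = of_int (D * y0\<^sup>2)" by (simp only:)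
    then have "sqrt ((2 * of_int x0 + of_int y0)\<^sup>2) = sqrt (of_int D * (of_int y0)\<^sup>2)" by simp
    then have e: "\<bar>2 * of_int x0 + of_int y0\<bar> + (- \<bar>of_int y0\<bar>) * sqrt (of_int D) = 0" by (simp add: real_sqrt_mult)
    have "\<bar>2 * of_int x0 + of_int y0 :: real\<bar> = 0 \<and> - \<bar>of_int y0 :: real\<bar> = 0"
      by (rule rational_combination_zero[OF _ _ e]) (auto simp: abs_if)
    then show False using z by (simp add: xy)
  qed
  define X where "X = {x. elt x 0 \<in> I}"
  define Y where "Y = {y. \<exists>x. elt x y \<in> I}"
  obtain A where A: "0 < A" "A \<in> X" "\<And>x. x \<in> X \<Longrightarrow> A dvd x"
  proof (rule int_subgroup_generator[of X nz0])
    show "x - y \<in> X" if "x \<in> X" "y \<in> X" for x y using diff[of x 0 y 0] that by (simp add: X_def)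
  qed (use nz0 \<open>elt nz0 0 \<in> I\<close> in \<open>auto simp: X_def\<close>)
  have AI: "elt A 0 \<in> I" using A(2) by (simp add: X_def)
  have "A \<in> Y" using om[OF AI] by (auto simp: Y_def)
  obtain t where t: "0 < t" "t \<in> Y" "\<And>y. y \<in> Y \<Longrightarrow> t dvd y"
  proof (rule int_subgroup_generator[of Y A])
    show "x - y \<in> Y" if "x \<in> Y" "y \<in> Y" for x y using diff that unfolding Y_def by blast
  qed (use A \<open>A \<in> Y\<close> in auto)
  obtain a where a: "A = t * a" using t(3)[OF \<open>A \<in> Y\<close>] by (rule dvdE)
  have a0: "0 < a" using A(1) t(1) by (simp add: a zero_less_mult_iff)
  obtain u where u: "elt u t \<in> I" using t(2) by (auto simp: Y_def)
  have "u + t \<in> Y" using om[OF u] by (auto simp: Y_def)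
  then have "t dvd u + t" by (rule t(3))
  then obtain B0 where B0: "u = t * B0" by (metis dvd_add_left_iff dvd_refl dvdE)
  define B where "B = B0 mod a"
  define q where "q = B0 div a"
  have Bq: "B0 = a * q + B" by (simp add: B_def q_def)
  have BI: "elt (t * B) t \<in> I"
    using diff[OF u smult[OF AI, of q]] by (simp add: B0 Bq a algebra_simps)
  have "elt (n0 * t) (t * B + t) \<in> I" using om[OF BI] .
  \<comment> \<open>(\<open>omega\<close> - B - 1) t (B + \<open>omega\<close>) is the integer -t
    (B^2 + B - n0), hence a multiple of A = t a.\<close>
  from diff[OF this smult[OF BI, of "B + 1"]] have "elt (n0 * t - (B + 1) * (t * B)) 0 \<in> I" by (simp add: algebra_simps)
  then have "A dvd n0 * t - (B + 1) * (t * B)" by (intro A(3)) (simp add: X_def)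
  moreover have "n0 * t - (B + 1) * (t * B) = t * - (B\<^sup>2 + B - n0)" by (simp add: algebra_simps power2_eq_square)
  ultimately have "t * a dvd t * - (B\<^sup>2 + B - n0)" by (simp only: a)
  then have "a dvd B\<^sup>2 + B - n0" using t(1) by (simp only: dvd_mult_cancel_left dvd_minus_iff) auto
  then have "(t, a, B) \<in> triples" using t a0 by (simp add: triples_def B_def)
  moreover have "I = lat t a B"
  proof (intro equalityI subsetI)
    fix w assume w: "w \<in> I"
    then obtain x y where xy: "w = elt x y" using ring_elt_cases[of w] sub by blast
    obtain j where j: "y = t * j" using w t(3)[of y] by (auto simp: xy Y_def elim: dvdE)
    have "elt (x - j * (t * B)) (y - j * t) \<in> I" using diff[OF _ smult[OF BI, of j]] w by (simp add: xy)
    then have "A dvd x - j * (t * B)" by (intro A(3)) (simp add: X_def j mult.commute)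
    then obtain i where "x - j * (t * B) = A * i" by (rule dvdE)
    then have "x = t * (a * i + B * j)" by (simp add: a algebra_simps)
    then show "w \<in> lat t a B" using j by (auto simp: xy elt_in_lat)
  next
    fix w assume "w \<in> lat t a B"
    then obtain i j where w: "w = elt (t * (a * i + B * j)) (t * j)" by (auto simp: lat_def)
    show "w \<in> I" using add[OF smult[OF AI, of i] smult[OF BI, of j]] by (simp add: w elt_add a algebra_simps)
  qed
  ultimately show thesis by (rule that)
qed

lemma ideal_norm_lat:
  assumes "(t, a, B) \<in> triples"
  shows "ideal_norm D (lat t a B) = nat (t\<^sup>2 * a)"
proof -
  have t: "0 < t" "0 < a" using assms by (auto simp: triples_def)
  have ta: "0 < t * a" using t by simp
  define O' where "O' = ring_of_integers D"
  define R where "R = {(x, y). x \<in> O' \<and> y \<in> O' \<and> x - y \<in> lat t a B}"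
  have cls: "R `` {elt x y} = {elt x' y' | x' y'. elt (x - x') (y - y') \<in> lat t a B}" for x y
    by (auto simp: R_def O'_def elt_diff ring_of_integers_eq)
  have ideal: "is_ideal D (lat t a B)" by (rule is_ideal_lat[OF assms])
  have zero: "elt 0 0 \<in> lat t a B" using ideal by (simp add: is_ideal_def elt_0)
  have sub: "elt (x - x') (y - y') \<in> lat t a B" if "elt x y \<in> lat t a B" "elt x' y' \<in> lat t a B" for x y x' y'
  proof -
    have "elt (- 1) 0 * elt x' y' \<in> lat t a B" using that(2) ideal by (simp add: is_ideal_def)
    then have "elt x y + elt (- 1) 0 * elt x' y' \<in> lat t a B" using that(1) ideal by (simp add: is_ideal_def)
    then show ?thesis by (simp add: elt_mult elt_add)
  qed
  have cls_eq: "R `` {elt x y} = R `` {elt x' y'} \<longleftrightarrow> elt (x - x') (y - y') \<in> lat t a B" for x y x' y'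
  proof
    assume "R `` {elt x y} = R `` {elt x' y'}"
    then have "elt x' y' \<in> R `` {elt x y}" using zero by (auto simp: cls)
    then show "elt (x - x') (y - y') \<in> lat t a B" by (auto simp: cls)
  next
    assume d: "elt (x - x') (y - y') \<in> lat t a B"
    have "elt (x - u) (y - v) \<in> lat t a B \<longleftrightarrow> elt (x' - u) (y' - v) \<in> lat t a B" for u v
      using sub[OF _ d, of "x - u" "y - v"] sub[OF sub[OF d zero] sub[OF zero, of "x' - u" "y' - v"]]
      by (auto simp: algebra_simps)
    then show "R `` {elt x y} = R `` {elt x' y'}" by (simp add: cls)
  qed
  \<comment> \<open>Reduce the \<open>omega\<close>-coordinate modulo t by the second basis vector,
    and after that the integer coordinate modulo t a by the first.\<close>
  have "O' // R = (\<lambda>(x, y). R `` {elt x y}) ` ({0..<t * a} \<times> {0..<t})"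
  proof (intro equalityI subsetI)
    fix c assume "c \<in> O' // R"
    then obtain x y where c: "c = R `` {elt x y}" by (auto simp: quotient_def O'_def ring_of_integers_eq)
    define j where "j = y div t"
    define i where "i = (x - t * B * j) div (t * a)"
    have y: "y = t * j + y mod t" by (simp add: j_def)
    have x: "x - t * B * j = t * a * i + (x - t * B * j) mod (t * a)" by (simp add: i_def)
    have "x - (x - t * B * j) mod (t * a) = t * (a * i + B * j)" using x by (simp add: algebra_simps)
    moreover have "y - y mod t = t * j" using y by linarith
    ultimately have "elt (x - (x - t * B * j) mod (t * a)) (y - y mod t) \<in> lat t a B" by (auto simp: elt_in_lat)
    then have "c = R `` {elt ((x - t * B * j) mod (t * a)) (y mod t)}" unfolding c by (simp only: cls_eq)
    then show "c \<in> (\<lambda>(x, y). R `` {elt x y}) ` ({0..<t * a} \<times> {0..<t})"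
      using t ta by (intro image_eqI[of _ _ "((x - t * B * j) mod (t * a), y mod t)"]) simp_all
  qed (auto simp: quotient_def O'_def)
  moreover have "inj_on (\<lambda>(x, y). R `` {elt x y}) ({0..<t * a} \<times> {0..<t})"
  proof (rule inj_onI, clarify)
    fix x y x' y' assume xy: "x \<in> {0..<t * a}" "x' \<in> {0..<t * a}" "y \<in> {0..<t}" "y' \<in> {0..<t}"
      and "R `` {elt x y} = R `` {elt x' y'}"
    then obtain i j where ij: "x - x' = t * (a * i + B * j)" "y - y' = t * j" unfolding cls_eq elt_in_lat by blast
    have "\<bar>y - y'\<bar> < t" using xy by auto
    moreover have "t dvd y - y'" using ij by simp
    ultimately have y: "y - y' = 0" using t dvd_imp_le_int[of "y - y'" t] by fastforce
    then have "j = 0" using ij t by simp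
    then have "t * a dvd x - x'" using ij by simp
    moreover have "\<bar>x - x'\<bar> < t * a" using xy by auto
    ultimately have "x - x' = 0" using ta dvd_imp_le_int[of "x - x'" "t * a"] by fastforce
    then show "x = x' \<and> y = y'" using y by simp
  qed
  ultimately have "card (O' // R) = card ({0..<t * a} \<times> {0..<t})" by (simp only: card_image)
  also have "\<dots> = nat (t\<^sup>2 * a)"
    using t ta by (simp add: nat_mult_distrib[symmetric] power2_eq_square mult_ac)
  finally show ?thesis by (simp add: ideal_norm_def O'_def R_def)
qed

text \<open>The norm of an ideal generates the ideal of all determinants of pairs of its elements.\<close>

lemma lat_wedge_dvd:
  assumes "elt x y \<in> lat t a B" "elt x' y' \<in> lat t a B"
  shows "t\<^sup>2 * a dvd x * y' - x' * y"
proof -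
  obtain i j where "x = t * (a * i + B * j)" "y = t * j" using assms(1) by (auto simp: elt_in_lat)
  moreover obtain i' j' where "x' = t * (a * i' + B * j')" "y' = t * j'" using assms(2) by (auto simp: elt_in_lat)
  ultimately have "x * y' - x' * y = t\<^sup>2 * a * (i * j' - i' * j)" by (simp add: algebra_simps power2_eq_square)
  then show ?thesis by simp
qed

lemma lat_basis: "elt (t * a) 0 \<in> lat t a B" "elt (t * B) t \<in> lat t a B"
  unfolding elt_in_lat by (intro exI[of _ 1] exI[of _ 0]; simp) (intro exI[of _ 0] exI[of _ 1]; simp)

lemma lat_eq_imp:
  assumes T: "(t, a, B) \<in> triples" "(t', a', B') \<in> triples" and eq: "lat t a B = lat t' a' B'"
  shows "t = t' \<and> a = a' \<and> B = B'"
proof -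
  have pos: "0 < t" "0 < t'" "0 < a" "0 < a'" "0 \<le> B" "B < a" "0 \<le> B'" "B' < a'" using T by (auto simp: triples_def)
  have "t' dvd t" using lat_basis(2)[of t B a] unfolding eq elt_in_lat by auto
  moreover have "t dvd t'" using lat_basis(2)[of t' B' a'] unfolding eq[symmetric] elt_in_lat by auto
  ultimately have t: "t = t'" using pos by (simp add: zdvd_antisym_nonneg)
  have "a' dvd a" using lat_basis(1)[of t a B] pos unfolding eq elt_in_lat by (auto simp: t)
  moreover have "a dvd a'" using lat_basis(1)[of t' a' B'] pos unfolding eq[symmetric] elt_in_lat by (auto simp: t)
  ultimately have a: "a = a'" using pos by (simp add: zdvd_antisym_nonneg)
  have "a dvd B - B'" using lat_basis(2)[of t B a] pos unfolding eq elt_in_lat by (auto simp: t a)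
  moreover have "\<bar>B - B'\<bar> < a" using pos a by auto
  ultimately have "B - B' = 0" using dvd_imp_le_int[of "B - B'" a] by fastforce
  then show ?thesis using t a by simp
qed

abbreviation ideals :: "real set set" where
  "ideals \<equiv> {I. is_ideal D I \<and> I \<noteq> {0}}"

lemma bij_lat: "bij_betw (\<lambda>(t, a, B). lat t a B) triples ideals"
proof (rule bij_betw_imageI)
  show "inj_on (\<lambda>(t, a, B). lat t a B) triples"
    by (rule inj_onI) (use lat_eq_imp in force)
  show "(\<lambda>(t, a, B). lat t a B) ` triples = ideals"
  proof (intro equalityI subsetI)
    fix I assume "I \<in> ideals"
    then obtain t a B where "(t, a, B) \<in> triples" "I = lat t a B" using ideal_eq_lat by blast
    then show "I \<in> (\<lambda>(t, a, B). lat t a B) ` triples" by force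
  qed (use is_ideal_lat in auto)
qed

end

section \<open>Multiplication by the ideal generated by N and \<open>omega\<close>\<close>

context quadratic_ring begin

text \<open>The product of J with that ideal: as J is an ideal, one multiple of each generator
  suffices.\<close>

definition times_n :: "int \<Rightarrow> real set \<Rightarrow> real set" where
  "times_n N J = {elt N 0 * p + elt 0 1 * q | p q. p \<in> J \<and> q \<in> J}"

text \<open>The product with the conjugate ideal, divided by N; \<open>elt 1 (- 1)\<close> is the
  conjugate of \<open>omega\<close>.\<close>

definition div_n :: "int \<Rightarrow> real set \<Rightarrow> real set" where
  "div_n N J = {p + elt 1 (- 1) * q / of_int N | p q. p \<in> J \<and> q \<in> J}"

lemma times_nE:
  assumes "z \<in> times_n N J"
  obtains p q where "p \<in> J" "q \<in> J" "z = elt N 0 * p + elt 0 1 * q"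
  using assms by (auto simp: times_n_def)

lemma is_ideal_times_n:
  assumes J: "is_ideal D J" "J \<noteq> {0}" and N: "0 < N"
  shows "is_ideal D (times_n N J)" "times_n N J \<noteq> {0}" "times_n N J \<subseteq> J"
proof -
  have sub: "J \<subseteq> ring_of_integers D" and zero: "0 \<in> J" and add: "\<And>x y. x \<in> J \<Longrightarrow> y \<in> J \<Longrightarrow> x + y \<in> J"
    and mult: "\<And>x r. x \<in> J \<Longrightarrow> r \<in> ring_of_integers D \<Longrightarrow> r * x \<in> J" using J by (auto simp: is_ideal_def)
  show sJ: "times_n N J \<subseteq> J"
    by (auto elim!: times_nE intro!: add mult)
  show "is_ideal D (times_n N J)"
    unfolding is_ideal_def
  proof (intro conjI ballI)
    show "times_n N J \<subseteq> ring_of_integers D" using sJ sub by blast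
    show "0 \<in> times_n N J" unfolding times_n_def using zero by force
    fix x assume "x \<in> times_n N J"
    then obtain p q where x: "p \<in> J" "q \<in> J" "x = elt N 0 * p + elt 0 1 * q" by (rule times_nE)
    show "x + y \<in> times_n N J" if "y \<in> times_n N J" for y
    proof -
      from that obtain p' q' where y: "p' \<in> J" "q' \<in> J" "y = elt N 0 * p' + elt 0 1 * q'" by (rule times_nE)
      have "x + y = elt N 0 * (p + p') + elt 0 1 * (q + q')" by (simp add: x y algebra_simps)
      then show ?thesis using add x y unfolding times_n_def by blast
    qed
    show "r * x \<in> times_n N J" if "r \<in> ring_of_integers D" for r
    proof -
      have "r * x = elt N 0 * (r * p) + elt 0 1 * (r * q)" by (simp add: x algebra_simps)
      then show ?thesis using mult[OF _ that] x unfolding times_n_def by blast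
    qed
  qed
  obtain z where z: "z \<in> J" "z \<noteq> 0" using zero J by blast
  have "elt N 0 * z + elt 0 1 * 0 \<in> times_n N J" using z zero unfolding times_n_def by blast
  moreover have "elt N 0 * z + elt 0 1 * 0 \<noteq> 0" using z N by simp
  ultimately show "times_n N J \<noteq> {0}" by blast
qed

text \<open>Since the conjugate of \<open>omega\<close> is \<open>1 - omega\<close>, the determinant identity
  \<open>x \<and> omega y + omega x \<and> y = x \<and> y\<close> shows that \<open>N\<close> times the norm of \<open>J\<close> is itself a sum of determinants.\<close>

lemma ideal_norm_times_n:
  assumes J: "is_ideal D J" "J \<noteq> {0}" and N: "0 < N" "N dvd n0"
  shows "ideal_norm D (times_n N J) = nat N * ideal_norm D J"
proof -
  obtain t a B where T: "(t, a, B) \<in> triples" and J_eq: "J = lat t a B" using ideal_eq_lat[OF J] by blast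
  obtain t' a' B' where T': "(t', a', B') \<in> triples" and nJ_eq: "times_n N J = lat t' a' B'"
    using ideal_eq_lat[OF is_ideal_times_n(1,2)[OF J N(1)]] by blast
  have pos: "0 < t\<^sup>2 * a" "0 < t'\<^sup>2 * a'" using T T' by (auto simp: triples_def)
  have om: "elt (n0 * y) (x + y) \<in> J" if "elt x y \<in> J" for x y
  proof -
    have "elt 0 1 * elt x y \<in> J" using that J(1) by (simp add: is_ideal_def)
    then show ?thesis by (simp add: elt_mult)
  qed
  have nJ: "elt (N * x1 + n0 * y2) (N * y1 + x2 + y2) \<in> times_n N J" if "elt x1 y1 \<in> J" "elt x2 y2 \<in> J" for x1 y1 x2 y2
  proof -
    have "elt N 0 * elt x1 y1 + elt 0 1 * elt x2 y2 \<in> times_n N J" using that unfolding times_n_def by blast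
    then show ?thesis by (simp add: elt_mult elt_add algebra_simps)
  qed
  have zero: "elt 0 0 \<in> J" using J(1) by (simp add: is_ideal_def elt_0)
  have "t'\<^sup>2 * a' dvd N * (t\<^sup>2 * a)"
  proof -
    define x1 y1 x2 y2 where "x1 = t * a" and "y1 = (0 :: int)" and "x2 = t * B" and "y2 = t"
    have b: "elt x1 y1 \<in> J" "elt x2 y2 \<in> J" unfolding J_eq x1_def y1_def x2_def y2_def by (rule lat_basis)+
    have N1: "elt (N * x1) (N * y1) \<in> times_n N J" "elt (N * x2) (N * y2) \<in> times_n N J"
      using nJ[OF b(1) zero] nJ[OF b(2) zero] by simp_all
    have O1: "elt (n0 * y1) (x1 + y1) \<in> times_n N J" "elt (n0 * y2) (x2 + y2) \<in> times_n N J"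
      using nJ[OF zero b(1)] nJ[OF zero b(2)] by simp_all
    have "t'\<^sup>2 * a' dvd (N * x1) * (x2 + y2) - (n0 * y2) * (N * y1)" "t'\<^sup>2 * a' dvd (n0 * y1) * (N * y2) - (N * x2) * (x1 + y1)"
      using lat_wedge_dvd[OF N1(1)[unfolded nJ_eq] O1(2)[unfolded nJ_eq]] lat_wedge_dvd[OF O1(1)[unfolded nJ_eq] N1(2)[unfolded nJ_eq]] .
    then have "t'\<^sup>2 * a' dvd ((N * x1) * (x2 + y2) - (n0 * y2) * (N * y1)) + ((n0 * y1) * (N * y2) - (N * x2) * (x1 + y1))"
      by (rule dvd_add)
    also have "\<dots> = N * (t\<^sup>2 * a)" by (simp add: x1_def y1_def x2_def y2_def algebra_simps power2_eq_square)
    finally show ?thesis .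
  qed
  moreover have "N * (t\<^sup>2 * a) dvd t'\<^sup>2 * a'"
  proof -
    have wedge: "N * (t\<^sup>2 * a) dvd x * y' - x' * y" if xy: "elt x y \<in> times_n N J" and xy': "elt x' y' \<in> times_n N J" for x y x' y'
    proof -
      have coords: "\<exists>x1 y1 x2 y2. elt x1 y1 \<in> J \<and> elt x2 y2 \<in> J \<and> x = N * x1 + n0 * y2 \<and> y = N * y1 + x2 + y2"
        if xy: "elt x y \<in> times_n N J" for x y
      proof -
        obtain p q where pq: "p \<in> J" "q \<in> J" "elt x y = elt N 0 * p + elt 0 1 * q" using xy by (rule times_nE)
        obtain x1 y1 x2 y2 where "p = elt x1 y1" "q = elt x2 y2" using pq(1,2) J_eq by (auto simp: lat_def)
        then show ?thesis using pq by (intro exI[of _ x1] exI[of _ y1] exI[of _ x2] exI[of _ y2]) (simp add: elt_mult elt_add)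
      qed
      obtain x1 y1 x2 y2 where 1: "elt x1 y1 \<in> J" "elt x2 y2 \<in> J" "x = N * x1 + n0 * y2" "y = N * y1 + x2 + y2" using coords[OF xy] by blast
      obtain x3 y3 x4 y4 where 2: "elt x3 y3 \<in> J" "elt x4 y4 \<in> J" "x' = N * x3 + n0 * y4" "y' = N * y3 + x4 + y4" using coords[OF xy'] by blast
      obtain n1 where n1: "n0 = N * n1" using N(2) by (rule dvdE)
      have w: "t\<^sup>2 * a dvd u * v' - u' * v" if "elt u v \<in> J" "elt u' v' \<in> J" for u v u' v'
        using that unfolding J_eq by (rule lat_wedge_dvd)
      \<comment> \<open>Bilinear expansion into four determinants. Three carry a factor N; the one
        from the two multiples of \<open>omega\<close> carries the norm -n0 = -N n1.\<close>
      have "x * y' - x' * y = N * (N * (x1 * y3 - x3 * y1) + (x1 * (x4 + y4) - (n0 * y4) * y1) + ((n0 * y2) * y3 - x3 * (x2 + y2)) - n1 * (x2 * y4 - x4 * y2))"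
        unfolding 1 2 by (simp add: algebra_simps) (simp add: n1 algebra_simps)
      moreover have "t\<^sup>2 * a dvd N * (x1 * y3 - x3 * y1) + (x1 * (x4 + y4) - (n0 * y4) * y1) + ((n0 * y2) * y3 - x3 * (x2 + y2)) - n1 * (x2 * y4 - x4 * y2)"
        by (rule dvd_diff[OF dvd_add[OF dvd_add[OF dvd_mult[OF w[OF 1(1) 2(1)]] w[OF 1(1) om[OF 2(2)]]]
              w[OF om[OF 1(2)] 2(1)]] dvd_mult[OF w[OF 1(2) 2(2)]]])
      ultimately show ?thesis by (simp only: mult_dvd_mono[OF dvd_refl])
    qed
    have "N * (t\<^sup>2 * a) dvd (t' * a') * t' - (t' * B') * 0"
      using lat_basis(1)[of t' a' B'] lat_basis(2)[of t' B' a'] unfolding nJ_eq[symmetric] by (rule wedge)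
    then show ?thesis by (simp add: power2_eq_square mult_ac)
  qed
  ultimately have "t'\<^sup>2 * a' = N * (t\<^sup>2 * a)" using pos N by (simp add: zdvd_antisym_nonneg)
  then show ?thesis
    unfolding nJ_eq ideal_norm_lat[OF T'] unfolding J_eq ideal_norm_lat[OF T] using N by (simp add: nat_mult_distrib)
qed

text \<open>The lattice N Z + \<open>omega\<close> Z, closed under \<open>omega\<close> exactly when
  N divides \<open>n0\<close>.\<close>

definition n_ideal :: "int \<Rightarrow> real set" where
  "n_ideal N = {elt (N * x) y | x y. True}"

abbreviation ideals_above :: "int \<Rightarrow> real set set" where
  "ideals_above N \<equiv> {I. is_ideal D I \<and> I \<noteq> {0} \<and> I \<subseteq> n_ideal N}"

text \<open>\<open>N \<int> + omega \<int>\<close> times its conjugate is the principal ideal generated by \<open>N\<close>.\<close>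

lemma bij_times_n:
  assumes N: "0 < N" "N dvd n0"
  shows "bij_betw (times_n N) ideals (ideals_above N)"
proof -
  obtain n1 where n1: "n0 = N * n1" using N(2) by (rule dvdE)
  have ww: "elt 1 (- 1) * elt 0 1 = - of_int n0" by (simp add: elt_mult) (simp add: elt_def)
  have wN: "elt 0 1 * (elt 1 (- 1) * q / of_int N) = - of_int n1 * q" for q
  proof -
    have "elt 0 1 * (elt 1 (- 1) * q / of_int N) = (elt 1 (- 1) * elt 0 1) * q / of_int N" by (simp add: mult_ac)
    then show ?thesis unfolding ww using N(1) by (simp add: n1)
  qed
  have N0: "elt N 0 = of_int N" for N by (simp add: elt_def)
  have closed_add: "x + y \<in> J" if "is_ideal D J" "x \<in> J" "y \<in> J" for J x y
    using that by (simp add: is_ideal_def)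
  have closed_mult: "elt u v * x \<in> J" if "is_ideal D J" "x \<in> J" for J x u v
    using that by (simp add: is_ideal_def)
  have closed_int: "of_int u * x \<in> J" if "is_ideal D J" "x \<in> J" for J x u
    using closed_mult[OF that, of u 0] by (simp only: N0)
  have inv1: "div_n N (times_n N J) = J" if J: "is_ideal D J" for J
  proof (intro equalityI subsetI)
    fix z assume "z \<in> div_n N (times_n N J)"
    then obtain p q where "p \<in> times_n N J" "q \<in> times_n N J" and z: "z = p + elt 1 (- 1) * q / of_int N" by (auto simp: div_n_def)
    then obtain p1 q1 p2 q2 where pq: "p1 \<in> J" "q1 \<in> J" "p2 \<in> J" "q2 \<in> J" "p = elt N 0 * p1 + elt 0 1 * q1" "q = elt N 0 * p2 + elt 0 1 * q2"
      by (auto elim!: times_nE)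
    have "elt 1 (- 1) * q / of_int N = elt 1 (- 1) * p2 + elt 0 1 * (elt 1 (- 1) * q2 / of_int N)"
      using N(1) by (simp add: pq(6) N0 field_simps)
    also have "\<dots> = elt 1 (- 1) * p2 + of_int (- n1) * q2" unfolding wN by simp
    finally have "z = elt N 0 * p1 + elt 0 1 * q1 + (elt 1 (- 1) * p2 + of_int (- n1) * q2)" unfolding z pq(5) by (rule arg_cong)
    then show "z \<in> J" by (simp only:) (intro closed_add[OF J] closed_mult[OF J] closed_int[OF J] pq)
  next
    fix z assume z: "z \<in> J"
    have zero: "0 \<in> J" using J by (simp add: is_ideal_def)
    have "elt N 0 * 0 + elt 0 1 * z \<in> times_n N J" "elt N 0 * z + elt 0 1 * 0 \<in> times_n N J"
      unfolding times_n_def using z zero by blast+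
    then have "(elt N 0 * 0 + elt 0 1 * z) + elt 1 (- 1) * (elt N 0 * z + elt 0 1 * 0) / of_int N \<in> div_n N (times_n N J)"
      unfolding div_n_def by blast
    \<comment> \<open>\<open>omega\<close> and its conjugate add up to 1, so this choice of elements
      returns z itself.\<close>
    moreover have "(elt N 0 * 0 + elt 0 1 * z) + elt 1 (- 1) * (elt N 0 * z + elt 0 1 * 0) / of_int N = (elt 0 1 + elt 1 (- 1)) * z"
      using N(1) by (simp add: N0 algebra_simps)
    ultimately show "z \<in> div_n N (times_n N J)" by (simp add: elt_add) (simp add: elt_def)
  qed
  have inv2: "times_n N (div_n N J) = J" if J: "is_ideal D J" for J
  proof (intro equalityI subsetI)
    fix z assume "z \<in> times_n N (div_n N J)"
    then obtain p q where "p \<in> div_n N J" "q \<in> div_n N J" and z: "z = elt N 0 * p + elt 0 1 * q" by (rule times_nE)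
    then obtain p1 q1 p2 q2 where pq: "p1 \<in> J" "q1 \<in> J" "p2 \<in> J" "q2 \<in> J" "p = p1 + elt 1 (- 1) * q1 / of_int N" "q = p2 + elt 1 (- 1) * q2 / of_int N"
      by (auto simp: div_n_def)
    have "elt N 0 * p = of_int N * p1 + elt 1 (- 1) * q1" using N(1) by (simp add: pq(5) N0 distrib_left)
    moreover have "elt 0 1 * q = elt 0 1 * p2 + of_int (- n1) * q2" unfolding pq(6) distrib_left wN by simp
    ultimately have "z = (of_int N * p1 + elt 1 (- 1) * q1) + (elt 0 1 * p2 + of_int (- n1) * q2)" by (simp only: z)
    then show "z \<in> J" by (simp only:) (intro closed_add[OF J] closed_mult[OF J] closed_int[OF J] pq)
  next
    fix z assume z: "z \<in> J"
    have zero: "0 \<in> J" using J by (simp add: is_ideal_def)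
    have "0 + elt 1 (- 1) * z / of_int N \<in> div_n N J" "z + elt 1 (- 1) * 0 / of_int N \<in> div_n N J"
      unfolding div_n_def using z zero by blast+
    then have "elt N 0 * (0 + elt 1 (- 1) * z / of_int N) + elt 0 1 * (z + elt 1 (- 1) * 0 / of_int N) \<in> times_n N (div_n N J)"
      unfolding times_n_def by blast
    moreover have "elt N 0 * (0 + elt 1 (- 1) * z / of_int N) + elt 0 1 * (z + elt 1 (- 1) * 0 / of_int N) = (elt 1 (- 1) + elt 0 1) * z"
      using N(1) by (simp add: N0 algebra_simps)
    ultimately show "z \<in> times_n N (div_n N J)" by (simp add: elt_add) (simp add: elt_def)
  qed
  show ?thesis
  proof (rule bij_betw_byWitness[where f' = "div_n N"])
    show "\<forall>I\<in>ideals. div_n N (times_n N I) = I" using inv1 by blast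
    show "\<forall>I\<in>ideals_above N. times_n N (div_n N I) = I" using inv2 by blast
    show "times_n N ` ideals \<subseteq> ideals_above N"
    proof (intro image_subsetI CollectI conjI)
      fix I assume "I \<in> ideals"
      then have I: "is_ideal D I" "I \<noteq> {0}" by auto
      show "is_ideal D (times_n N I)" "times_n N I \<noteq> {0}" using is_ideal_times_n[OF I N(1)] by blast+
      show "times_n N I \<subseteq> n_ideal N"
      proof
        fix z assume "z \<in> times_n N I"
        then obtain p q where pq: "p \<in> I" "q \<in> I" "z = elt N 0 * p + elt 0 1 * q" by (rule times_nE)
        obtain x1 y1 where p: "p = elt x1 y1" using ring_elt_cases[of p] pq I by (auto simp: is_ideal_def)
        obtain x2 y2 where q: "q = elt x2 y2" using ring_elt_cases[of q] pq I by (auto simp: is_ideal_def)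
        have "z = elt (N * (x1 + n1 * y2)) (N * y1 + x2 + y2)" by (simp add: pq(3) p q elt_mult elt_add n1 algebra_simps)
        then show "z \<in> n_ideal N" unfolding n_ideal_def by blast
      qed
    qed
    show "div_n N ` ideals_above N \<subseteq> ideals"
    proof (intro image_subsetI CollectI conjI)
      fix I assume "I \<in> ideals_above N"
      then have I: "is_ideal D I" "I \<noteq> {0}" and sub: "I \<subseteq> n_ideal N" by auto
      show "is_ideal D (div_n N I)"
        unfolding is_ideal_def
      proof (intro conjI ballI)
        have zero: "0 \<in> I" using I by (simp add: is_ideal_def)
        then show "0 \<in> div_n N I" unfolding div_n_def by force
        show "div_n N I \<subseteq> ring_of_integers D"
        proof
          fix z assume "z \<in> div_n N I"
          then obtain p q where pq: "p \<in> I" "q \<in> I" "z = p + elt 1 (- 1) * q / of_int N" by (auto simp: div_n_def)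
          obtain x1 y1 where p: "p = elt x1 y1" using ring_elt_cases[of p] pq I by (auto simp: is_ideal_def)
          have "q \<in> n_ideal N" using pq(2) sub by blast
          then obtain x2 y2 where q: "q = elt (N * x2) y2" by (auto simp: n_ideal_def)
          \<comment> \<open>Containment in \<open>n_ideal N\<close> is what makes the division by N
            stay inside the ring.\<close>
          have "elt 1 (- 1) * q = elt N 0 * elt (x2 - n1 * y2) (- x2)" by (simp add: q elt_mult n1 algebra_simps)
          then have "z = elt x1 y1 + elt (x2 - n1 * y2) (- x2)" using N(1) by (simp add: pq(3) p N0)
          then show "z \<in> ring_of_integers D" by (simp add: elt_add)
        qed
        fix x assume "x \<in> div_n N I"
        then obtain p q where x: "p \<in> I" "q \<in> I" "x = p + elt 1 (- 1) * q / of_int N" by (auto simp: div_n_def)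
        show "x + y \<in> div_n N I" if "y \<in> div_n N I" for y
        proof -
          from that obtain p' q' where y: "p' \<in> I" "q' \<in> I" "y = p' + elt 1 (- 1) * q' / of_int N" by (auto simp: div_n_def)
          have "x + y = (p + p') + elt 1 (- 1) * (q + q') / of_int N" by (simp add: x y distrib_left add_divide_distrib)
          then show ?thesis using closed_add[OF I(1)] x y unfolding div_n_def by blast
        qed
        show "r * x \<in> div_n N I" if "r \<in> ring_of_integers D" for r
        proof -
          have "r * x = r * p + elt 1 (- 1) * (r * q) / of_int N" by (simp add: x algebra_simps)
          moreover have "r * p \<in> I" "r * q \<in> I" using I(1) that x by (auto simp: is_ideal_def)
          ultimately show ?thesis unfolding div_n_def by blast
        qed
      qed
      show "div_n N I \<noteq> {0}"
      proof
        assume "div_n N I = {0}"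
        then have "times_n N (div_n N I) = {0}" by (auto simp: times_n_def)
        then show False using inv2[OF I(1)] I(2) by simp
      qed
    qed
  qed
qed

definition triples_above :: "int \<Rightarrow> (int \<times> int \<times> int) set" where
  "triples_above N = {(t, a, B) \<in> triples. N dvd t * a \<and> N dvd t * B}"

lemma lat_subset_n_ideal: "lat t a B \<subseteq> n_ideal N \<longleftrightarrow> N dvd t * a \<and> N dvd t * B"
proof
  assume sub: "lat t a B \<subseteq> n_ideal N"
  show "N dvd t * a \<and> N dvd t * B" using subsetD[OF sub lat_basis(1)] subsetD[OF sub lat_basis(2)] by (auto simp: n_ideal_def)
next
  assume d: "N dvd t * a \<and> N dvd t * B"
  show "lat t a B \<subseteq> n_ideal N"
  proof
    fix z assume "z \<in> lat t a B"
    then obtain i j where z: "z = elt (t * (a * i + B * j)) (t * j)" by (auto simp: lat_def)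
    have "N dvd (t * a) * i + (t * B) * j"
      by (rule dvd_add[OF dvd_mult2[OF conjunct1[OF d]] dvd_mult2[OF conjunct2[OF d]]])
    then have "N dvd t * (a * i + B * j)" by (simp add: algebra_simps)
    then show "z \<in> n_ideal N" by (auto simp: z n_ideal_def elim!: dvdE)
  qed
qed

text \<open>Scaling and reindexing \<open>infsum\<close> need no summability here; convergence is
  established afterwards for the sum over triples, in \<open>triples_above_has_sum\<close>.\<close>

lemma dedekind_zeta_eq:
  assumes N: "0 < N" "N dvd n0"
  shows "1 / of_int N ^ k * dedekind_zeta D k = (\<Sum>\<^sub>\<infinity>(t, a, B)\<in>triples_above N. 1 / of_int (t\<^sup>2 * a) ^ k)"
proof -
  have "1 / of_int N ^ k * dedekind_zeta D k = (\<Sum>\<^sub>\<infinity>I\<in>ideals. 1 / of_int N ^ k * (1 / real (ideal_norm D I) ^ k))"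
    unfolding dedekind_zeta_def by (rule infsum_cmult_right'[symmetric])
  also have "\<dots> = (\<Sum>\<^sub>\<infinity>I\<in>ideals. 1 / real (ideal_norm D (times_n N I)) ^ k)"
  proof (rule infsum_cong)
    fix I assume "I \<in> ideals"
    then have "ideal_norm D (times_n N I) = nat N * ideal_norm D I"
      using N by (intro ideal_norm_times_n) auto
    then show "1 / of_int N ^ k * (1 / real (ideal_norm D I) ^ k) = 1 / real (ideal_norm D (times_n N I)) ^ k"
      using N(1) by (simp add: power_mult_distrib)
  qed
  also have "\<dots> = (\<Sum>\<^sub>\<infinity>I\<in>ideals_above N. 1 / real (ideal_norm D I) ^ k)"
    by (rule infsum_reindex_bij_betw[OF bij_times_n[OF N]])
  also have "\<dots> = (\<Sum>\<^sub>\<infinity>p\<in>triples_above N. 1 / real (ideal_norm D (case p of (t, a, B) \<Rightarrow> lat t a B)) ^ k)"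
  proof (rule infsum_reindex_bij_betw[symmetric], rule bij_betw_subset[OF bij_lat])
    show "triples_above N \<subseteq> triples" by (auto simp: triples_above_def)
    show "(\<lambda>(t, a, B). lat t a B) ` triples_above N = ideals_above N"
    proof (intro equalityI subsetI)
      fix I assume I: "I \<in> ideals_above N"
      then obtain t a B where T: "(t, a, B) \<in> triples" "I = lat t a B" using ideal_eq_lat by blast
      have "lat t a B \<subseteq> n_ideal N" using I unfolding T(2) by blast
      then have "(t, a, B) \<in> triples_above N" using T(1) by (simp add: triples_above_def lat_subset_n_ideal)
      then show "I \<in> (\<lambda>(t, a, B). lat t a B) ` triples_above N"
        unfolding T(2) by (intro image_eqI[of _ _ "(t, a, B)"]) simp_all
    next
      fix I assume "I \<in> (\<lambda>(t, a, B). lat t a B) ` triples_above N"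
      then obtain p where p: "p \<in> triples_above N" "I = (case p of (t, a, B) \<Rightarrow> lat t a B)" by blast
      obtain t a B where tab: "p = (t, a, B)" by (cases p)
      have "(t, a, B) \<in> triples_above N" and I: "I = lat t a B" using p by (simp_all add: tab)
      then have T: "(t, a, B) \<in> triples" and sub: "N dvd t * a \<and> N dvd t * B" by (simp_all add: triples_above_def)
      show "I \<in> ideals_above N"
        unfolding I using is_ideal_lat[OF T] lat_subset_n_ideal[THEN iffD2, OF sub] by blast
    qed
  qed
  also have "\<dots> = (\<Sum>\<^sub>\<infinity>(t, a, B)\<in>triples_above N. 1 / of_int (t\<^sup>2 * a) ^ k)"
  proof (rule infsum_cong, clarify)
    fix t a B assume "(t, a, B) \<in> triples_above N"
    then have T: "(t, a, B) \<in> triples" by (simp add: triples_above_def)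
    then have "0 \<le> t\<^sup>2 * a" by (auto simp: triples_def)
    then show "1 / real (ideal_norm D (lat t a B)) ^ k = 1 / of_int (t\<^sup>2 * a) ^ k"
      unfolding ideal_norm_lat[OF T] by (simp only: of_nat_nat)
  qed
  finally show ?thesis .
qed

end

subsection \<open>Dirichlet series\<close>

lemma riemann_zeta_nat_has_sum:
  assumes "2 \<le> j"
  shows "((\<lambda>s. 1 / real s ^ j) has_sum riemann_zeta_nat j) {0<..}"
proof -
  have s: "summable (\<lambda>n. inverse (real (Suc n) ^ j))"
    using inverse_power_summable[OF assms, where 'a = real] by (subst summable_Suc_iff)
  then have "summable (\<lambda>n. norm (1 / real (Suc n) ^ j))" by (simp add: inverse_eq_divide)
  moreover have "(\<lambda>n. 1 / real (Suc n) ^ j) sums riemann_zeta_nat j"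
    unfolding riemann_zeta_nat_def using s by (intro summable_sums) (simp only: inverse_eq_divide)
  ultimately have "((\<lambda>n. 1 / real (Suc n) ^ j) has_sum riemann_zeta_nat j) UNIV" by (rule norm_summable_imp_has_sum)
  moreover have "bij_betw Suc UNIV {0<..}"
    by (rule bij_betw_byWitness[where f' = "\<lambda>n. n - 1"]) auto
  ultimately show ?thesis using has_sum_reindex_bij_betw[of Suc UNIV "{0<..}" "\<lambda>s. 1 / real s ^ j"] by simp
qed

text \<open>One Euler factor per prime: multiplication by a new prime p does not affect divisibility
  by the earlier ones, so the multiples of p in the sieved set S are p S, with sum p^(-j) times that
  of S.\<close>

lemma sieved_zeta_has_sum:
  assumes j: "2 \<le> j" and P: "finite P" "\<And>p. p \<in> P \<Longrightarrow> prime (p :: nat)"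
  shows "((\<lambda>s. 1 / real s ^ j) has_sum riemann_zeta_nat j * (\<Prod>p\<in>P. 1 - 1 / real p ^ j)) {s. 0 < s \<and> (\<forall>p\<in>P. \<not> p dvd s)}"
  using P
proof (induction P rule: finite_induct)
  case empty
  then show ?case using riemann_zeta_nat_has_sum[OF j] by (simp add: greaterThan_def)
next
  case (insert p P)
  define S where "S = {s. 0 < s \<and> (\<forall>p\<in>P. \<not> p dvd s)}"
  define V where "V = riemann_zeta_nat j * (\<Prod>p\<in>P. 1 - 1 / real p ^ j)"
  have S: "((\<lambda>s. 1 / real s ^ j) has_sum V) S" unfolding S_def V_def using insert by simp
  have p: "prime p" using insert by simp
  have p0: "0 < p" using p by (rule prime_gt_0_nat)
  have q_dvd: "q dvd p * s \<longleftrightarrow> q dvd s" if "q \<in> P" for q s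
  proof -
    have "prime q" "q \<noteq> p" using that insert by auto
    then have "\<not> q dvd p" using p primes_dvd_imp_eq by blast
    then show ?thesis using \<open>prime q\<close> by (simp add: prime_dvd_mult_iff)
  qed
  have "bij_betw (\<lambda>s. p * s) S {s \<in> S. p dvd s}"
  proof (rule bij_betw_byWitness[where f' = "\<lambda>s. s div p"])
    show "\<forall>s\<in>S. p * s div p = s" "\<forall>s\<in>{s \<in> S. p dvd s}. p * (s div p) = s" using p0 by simp_all
    show "(\<lambda>s. p * s) ` S \<subseteq> {s \<in> S. p dvd s}" using p0 q_dvd by (auto simp: S_def)
    show "(\<lambda>s. s div p) ` {s \<in> S. p dvd s} \<subseteq> S"
    proof (rule image_subsetI)
      fix s assume s: "s \<in> {s \<in> S. p dvd s}"
      then obtain u where u: "s = p * u" by (auto elim: dvdE)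
      have "0 < u" using s by (cases u) (auto simp: u S_def)
      then show "s div p \<in> S" using s p0 q_dvd[of _ u] by (simp add: u S_def)
    qed
  qed
  from has_sum_reindex_bij_betw[OF this, of "\<lambda>s. 1 / real s ^ j"]
  have "((\<lambda>s. 1 / real s ^ j) has_sum 1 / real p ^ j * V) {s \<in> S. p dvd s}"
    using has_sum_cmult_right[OF S, of "1 / real p ^ j"] by (simp add: power_mult_distrib)
  from has_sum_Diff[OF S this] have "((\<lambda>s. 1 / real s ^ j) has_sum V - 1 / real p ^ j * V) (S - {s \<in> S. p dvd s})" by blast
  moreover have "S - {s \<in> S. p dvd s} = {s. 0 < s \<and> (\<forall>p\<in>insert p P. \<not> p dvd s)}" by (auto simp: S_def)
  moreover have "V - 1 / real p ^ j * V = riemann_zeta_nat j * (\<Prod>p\<in>insert p P. 1 - 1 / real p ^ j)"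
    using insert by (simp add: V_def algebra_simps)
  ultimately show ?case by simp
qed

lemma coprime_zeta_has_sum:
  assumes j: "2 \<le> j" and M: "0 < M"
  shows "((\<lambda>s. 1 / real s ^ j) has_sum riemann_zeta_nat j * (\<Prod>p\<in>{p. prime p \<and> p dvd M}. 1 - 1 / real p ^ j)) {s. 0 < s \<and> coprime s M}"
proof -
  have fin: "finite {p. prime p \<and> p dvd M}"
    using finite_divisors_nat[OF M] by (rule finite_subset[rotated]) auto
  have "coprime s M \<longleftrightarrow> (\<forall>p\<in>{p. prime p \<and> p dvd M}. \<not> p dvd s)" for s
  proof
    assume "coprime s M"
    then show "\<forall>p\<in>{p. prime p \<and> p dvd M}. \<not> p dvd s"
      using coprime_common_divisor not_prime_unit by blast
  next
    assume *: "\<forall>p\<in>{p. prime p \<and> p dvd M}. \<not> p dvd s"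
    show "coprime s M"
    proof (rule ccontr)
      assume "\<not> coprime s M"
      then have "gcd s M \<noteq> 1" by (simp add: coprime_iff_gcd_eq_1)
      then obtain p where "prime p" "p dvd gcd s M" using prime_factor_nat by blast
      then show False using * by auto
    qed
  qed
  then show ?thesis using sieved_zeta_has_sum[OF j fin] by simp
qed

lemma dvd_mult_iff_div_gcd:
  fixes N t :: nat and a :: int
  assumes "0 < N"
  shows "int N dvd int t * a \<longleftrightarrow> int (N div gcd N t) dvd a"
proof -
  define g where "g = gcd N t"
  have g: "0 < g" using assms by (simp add: g_def)
  define N' t' where "N' = N div g" and "t' = t div g"
  have N': "N = g * N'" "t = g * t'" by (simp_all add: N'_def t'_def g_def)
  have cop: "coprime N' t'" unfolding N'_def t'_def g_def using assms by (intro div_gcd_coprime) simp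
  have "int N dvd int t * a \<longleftrightarrow> int N' dvd int t' * a"
    unfolding N' using g by (simp add: mult.assoc)
  also have "\<dots> \<longleftrightarrow> int N' dvd a" using cop by (intro coprime_dvd_mult_right_iff) simp
  finally show ?thesis by (simp only: N'_def g_def)
qed

context quadratic_ring begin

text \<open>The multipliers \<open>t\<close> are sorted by \<open>d = gcd N t\<close>.\<close>

lemma triples_above_has_sum:
  assumes N: "0 < N" and k: "2 \<le> k"
    and G: "\<And>M. M dvd N \<Longrightarrow> ((\<lambda>p. 1 / of_int (fst p) ^ k) has_sum G M) (root_pairs D M)"
  shows "((\<lambda>(t, a, B). 1 / of_int (t\<^sup>2 * a) ^ k) has_sum
    (\<Sum>d\<in>{d. 0 < d \<and> d dvd N}. 1 / real d ^ (2 * k) * (riemann_zeta_nat (2 * k) * (\<Prod>p\<in>{p. prime p \<and> p dvd N div d}. 1 - 1 / real p ^ (2 * k))) * G (N div d)))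
    (triples_above (int N))"
proof -
  define Z where "Z M = riemann_zeta_nat (2 * k) * (\<Prod>p\<in>{p. prime p \<and> p dvd M}. 1 - 1 / real p ^ (2 * k))" for M
  define dv where "dv = {d. 0 < d \<and> d dvd N}"
  define cop where "cop M = {s :: nat. 0 < s \<and> coprime s M}" for M :: nat
  define f where "f = (\<lambda>(d, s, p). 1 / real (d * s) ^ (2 * k) * (1 / real_of_int (fst (p :: int \<times> int)) ^ k))"
  have fin: "finite dv" unfolding dv_def using finite_divisors_nat[OF N] by (rule finite_subset[rotated]) auto
  have Z: "((\<lambda>s. 1 / real s ^ (2 * k)) has_sum Z M) (cop M)" if "0 < M" for M
    unfolding Z_def cop_def using k that by (intro coprime_zeta_has_sum) auto
  have pos: "0 < fst p" if "p \<in> root_pairs D M" for p M using that by (auto simp: root_pairs_def)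
  have f_nonneg: "0 \<le> f (d, s, p)" if "p \<in> root_pairs D M" for d s p M
  proof -
    have "0 < real_of_int (fst p)" using pos[OF that] by simp
    then show ?thesis by (simp add: f_def)
  qed
  have inner: "((\<lambda>(s, p). f (d, s, p)) has_sum 1 / real d ^ (2 * k) * Z (N div d) * G (N div d)) (cop (N div d) \<times> root_pairs D (N div d))"
    if d: "d \<in> dv" for d
  proof -
    have dN: "0 < N div d" "N div d dvd N" using d N by (auto simp: dv_def dvd_imp_le div_greater_zero_iff)
    have 1: "((\<lambda>p. f (d, s, p)) has_sum 1 / real (d * s) ^ (2 * k) * G (N div d)) (root_pairs D (N div d))" for s
      unfolding f_def prod.case by (rule has_sum_cmult_right[OF G[OF dN(2)]])
    have 2: "((\<lambda>s. 1 / real (d * s) ^ (2 * k) * G (N div d)) has_sum 1 / real d ^ (2 * k) * Z (N div d) * G (N div d)) (cop (N div d))"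
      using has_sum_cmult_right[OF Z[OF dN(1)], of "1 / real d ^ (2 * k) * G (N div d)"] by (simp add: power_mult_distrib mult_ac)
    show ?thesis
    proof (rule has_sum_SigmaI[OF _ 2])
      \<comment> \<open>Nonnegativity of the terms turns the iterated sum into summability on the
        product.\<close>
      show "(\<lambda>(s, p). f (d, s, p)) summable_on cop (N div d) \<times> root_pairs D (N div d)"
        by (rule summable_on_SigmaI[OF _ has_sum_imp_summable[OF 2]]) (use 1 f_nonneg in auto)
    qed (use 1 in simp)
  qed
  have outer: "((\<lambda>d. 1 / real d ^ (2 * k) * Z (N div d) * G (N div d)) has_sum (\<Sum>d\<in>dv. 1 / real d ^ (2 * k) * Z (N div d) * G (N div d))) dv"
    using fin by (rule has_sum_finite)
  have "(f has_sum (\<Sum>d\<in>dv. 1 / real d ^ (2 * k) * Z (N div d) * G (N div d))) (SIGMA d:dv. cop (N div d) \<times> root_pairs D (N div d))"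
  proof (rule has_sum_SigmaI[OF _ outer])
    show in': "((\<lambda>y. f (d, y)) has_sum 1 / real d ^ (2 * k) * Z (N div d) * G (N div d)) (cop (N div d) \<times> root_pairs D (N div d))" if "d \<in> dv" for d
      using inner[OF that] by (simp add: case_prod_beta')
    show "f summable_on (SIGMA d:dv. cop (N div d) \<times> root_pairs D (N div d))"
    proof (rule summable_on_SigmaI[OF in' has_sum_imp_summable[OF outer]])
      show "0 \<le> f (d, y)" if "y \<in> cop (N div d) \<times> root_pairs D (N div d)" for d y
        using that f_nonneg by auto
    qed
  qed
  \<comment> \<open>t = d s with d = gcd N t and s coprime to N/d. Divisibility of t a and t B by N
    becomes divisibility of a and B by N/d, the condition in \<open>root_pairs\<close>.\<close>
  also have "?this \<longleftrightarrow> ((\<lambda>(t, a, B). 1 / of_int (t\<^sup>2 * a) ^ k) has_sum (\<Sum>d\<in>dv. 1 / real d ^ (2 * k) * Z (N div d) * G (N div d))) (triples_above (int N))"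
  proof (rule has_sum_reindex_bij_witness[where j = "\<lambda>(d, s, a, B). (int (d * s), a, B)"
        and i = "\<lambda>(t, a, B). (gcd N (nat t), nat t div gcd N (nat t), a, B)"])
    fix x assume x: "x \<in> (SIGMA d:dv. cop (N div d) \<times> root_pairs D (N div d))"
    obtain d s a B where dsab: "x = (d, s, a, B)" by (cases x) auto
    have d: "0 < d" "d dvd N" and s: "0 < s" "coprime s (N div d)" and aB: "(a, B) \<in> root_pairs D (N div d)"
      using x by (auto simp: dsab dv_def cop_def)
    have "gcd N (d * s) = gcd (d * (N div d)) (d * s)" using d by simp
    also have "\<dots> = d * gcd (N div d) s" by (rule gcd_mult_distrib_nat[symmetric])
    also have "gcd (N div d) s = 1" using s(2) by (simp add: coprime_iff_gcd_eq_1 gcd.commute)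
    finally have g: "gcd N (d * s) = d" by simp
    show "(case (case x of (d, s, a, B) \<Rightarrow> (int (d * s), a, B)) of (t, a, B) \<Rightarrow> (gcd N (nat t), nat t div gcd N (nat t), a, B)) = x"
      using g d by (simp add: dsab nat_mult_distrib)
    show "(case x of (d, s, a, B) \<Rightarrow> (int (d * s), a, B)) \<in> triples_above (int N)"
      using aB d s unfolding dsab triples_above_def prod.case mem_Collect_eq dvd_mult_iff_div_gcd[OF N] g
      by (auto simp: triples_def root_pairs_def n0_def)
    have "(real (d * s) ^ 2 * of_int a) ^ k = real (d * s) ^ (2 * k) * of_int a ^ k" by (simp only: power_mult_distrib power_mult)
    then show "(case (case x of (d, s, a, B) \<Rightarrow> (int (d * s), a, B)) of (t, a, B) \<Rightarrow> 1 / real_of_int (t\<^sup>2 * a) ^ k) = f x"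
      by (simp add: dsab f_def)
  next
    fix x assume x: "x \<in> triples_above (int N)"
    obtain t a B where tab: "x = (t, a, B)" by (cases x)
    have T: "(t, a, B) \<in> triples" "int N dvd t * a" "int N dvd t * B" using x by (auto simp: tab triples_above_def)
    have t: "0 < t" using T by (simp add: triples_def)
    define d where "d = gcd N (nat t)"
    have d: "0 < d" "d dvd N" "d dvd nat t" using N by (auto simp: d_def)
    have dv: "int N dvd int (nat t) * a" "int N dvd int (nat t) * B" using T t by simp_all
    have ds: "d * (nat t div d) = nat t" using d by simp
    have ds': "int (d * (nat t div d)) = t" unfolding ds using t by simp
    show "(case (case x of (t, a, B) \<Rightarrow> (gcd N (nat t), nat t div gcd N (nat t), a, B)) of (d, s, a, B) \<Rightarrow> (int (d * s), a, B)) = x"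
      by (simp only: tab prod.case d_def[symmetric] ds')
    have "0 < nat t div d" using ds t by (cases "nat t div d") auto
    moreover have "coprime (nat t div d) (N div d)"
      unfolding d_def using N by (subst coprime_commute) (rule div_gcd_coprime, simp)
    ultimately show "(case x of (t, a, B) \<Rightarrow> (gcd N (nat t), nat t div gcd N (nat t), a, B)) \<in> (SIGMA d:dv. cop (N div d) \<times> root_pairs D (N div d))"
      using T(1) d dv[unfolded dvd_mult_iff_div_gcd[OF N]]
      by (simp add: tab dv_def cop_def d_def[symmetric] root_pairs_def triples_def n0_def)
  qed auto
  finally show ?thesis by (simp only: Z_def dv_def)
qed

end

text \<open>Matches the D^(k - 1/2) inside \<open>const\<close> with the D^(1/2 - k) of the
  theorem.\<close>

lemma sqrt_power_powr:
  assumes "0 < (x :: real)" "1 \<le> k"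
  shows "sqrt x ^ (2 * k - 1) * x powr (1 / 2 - real k) = 1"
proof -
  have "sqrt x ^ (2 * k - 1) = x powr (1 / 2 * real (2 * k - 1))"
    using assms by (simp add: powr_half_sqrt[symmetric] powr_powr powr_realpow[symmetric] del: of_nat_diff)
  also have "1 / 2 * real (2 * k - 1) = real k - 1 / 2" using assms by (simp add: of_nat_diff field_simps)
  finally show ?thesis using assms by (simp flip: powr_add)
qed

theorem theorem2p3:
  fixes k N :: nat and D :: int
  assumes "even k" and "0 < k" and "0 < N"
    and "0 < D" and "fundamental_discriminant D" and "D mod (4 * int N) = 1"
    and "\<forall>d. 0 < d \<and> d dvd N \<longrightarrow>
           (\<forall>f. cusp_form_plus k (N div d) f \<longrightarrow> (\<forall>z\<in>upper_half. f z = 0))"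
  shows "dedekind_zeta D k =
    real (2 * k - 1) * real_of_int D powr (1 / 2 - real k) * riemann_zeta_nat (2 * k)
    * real N ^ k * real ((2 * k - 2) choose (k - 1))
    * (\<Sum>d\<in>{d. 0 < d \<and> d dvd N}.
        1 / real d ^ (2 * k)
        * (\<Prod>p\<in>{p. prime p \<and> p dvd (N div d)}. 1 - 1 / real p ^ (2 * k))
        * (\<Sum>b\<in>{b :: int. real_of_int \<bar>b\<bar> < sqrt (real_of_int D)
                          \<and> b mod (2 * int (N div d)) = 1 mod (2 * int (N div d))}.
             sigma_div (k - 1) (nat ((int d * (D - b ^ 2)) div (4 * int N)))))"
proof -
  have k2: "2 \<le> k" using assms(1,2) by (cases "k = 1") auto
  have D1N: "4 * int N dvd D - 1"
    using assms(3,6) by (metis mod_eq_dvd_iff mod_mod_trivial)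
  then have D1: "4 dvd D - 1" by (rule dvd_mult_left)
  have D4: "D mod 4 = 1" using D1 by presburger
  \<comment> \<open>D is 1 modulo 4, which rules out the branch D = 4 m of a fundamental
    discriminant.\<close>
  have sq: "squarefree D" and D_gt: "1 < D"
    using assms(4,5) D4 by (auto simp: fundamental_discriminant_def)
  interpret R: quadratic_ring D by unfold_locales (fact D_gt D4 sq)+
  interpret Q: quadratic_disc D k by unfold_locales (use R.square_neq_D k2 assms in auto)
  define C where "C M = (\<Sum>b\<in>middle_coeffs D M. sigma_div (k - 1) (nat ((D - b\<^sup>2) div (4 * int M))))" for M
  define Z where "Z M = (\<Prod>p\<in>{p. prime p \<and> p dvd M}. 1 - 1 / real p ^ (2 * k))" for M :: nat
  have G: "((\<lambda>p. 1 / of_int (fst p) ^ k) has_sum C M / Q.const) (root_pairs D M)" if M: "M dvd N" for M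
    unfolding C_def
  proof (rule Q.divisor_sum_formula[OF _ _ D4])
    show M0: "0 < M" using M assms(3) by (cases M) auto
    have "4 * int M dvd D - 1" using D1N M by (meson dvd_trans int_dvd_int_iff mult_dvd_mono dvd_refl)
    then show "D mod (4 * int M) = 1 mod (4 * int M)" by (simp add: mod_eq_dvd_iff)
    fix f z assume f: "cusp_form_plus k M f" and z: "z \<in> upper_half"
    \<comment> \<open>Level M is the instance d = N / M of the hypothesis on cusp forms.\<close>
    have "N div (N div M) = M" using M assms(3) by (auto elim!: dvdE)
    moreover have "0 < N div M" "N div M dvd N" using M assms(3) M0 by (auto elim!: dvdE)
    ultimately show "f z = 0" using assms(7)[rule_format, of "N div M" f z] f z by (simp only: simp_thms)
  qed
  have N: "0 < int N" "int N dvd R.n0"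
    using assms(3) D1N by (auto simp: R.n0_def elim!: dvdE)
  have C_eq: "C (N div d) = (\<Sum>b\<in>{b :: int. real_of_int \<bar>b\<bar> < sqrt (real_of_int D) \<and> b mod (2 * int (N div d)) = 1 mod (2 * int (N div d))}.
             sigma_div (k - 1) (nat ((int d * (D - b ^ 2)) div (4 * int N))))" if "d \<in> {d. 0 < d \<and> d dvd N}" for d
  proof -
    have d: "0 < d" "N = d * (N div d)" using that by auto
    \<comment> \<open>The common factor d cancels for \<open>div\<close> itself, so exactness of the
      division plays no part in matching the arguments of \<open>sigma_div\<close>.\<close>
    have "(int d * X) div (4 * int N) = X div (4 * int (N div d))" for X
    proof -
      have "int N = int d * int (N div d)" by (metis d(2) of_nat_mult)
      then have eq: "4 * int N = int d * (4 * int (N div d))" by simp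
      show ?thesis unfolding eq using d(1) by (intro div_mult_mult1) simp
    qed
    then show ?thesis unfolding C_def middle_coeffs_def by (simp only:)
  qed
  have "1 / real N ^ k * dedekind_zeta D k = (\<Sum>d\<in>{d. 0 < d \<and> d dvd N}. 1 / real d ^ (2 * k) * (riemann_zeta_nat (2 * k) * Z (N div d)) * (C (N div d) / Q.const))"
    using R.dedekind_zeta_eq[OF N, of k] infsumI[OF R.triples_above_has_sum[OF assms(3) k2 G]] by (simp add: Z_def)
  then have "dedekind_zeta D k = real N ^ k * (\<Sum>d\<in>{d. 0 < d \<and> d dvd N}. 1 / real d ^ (2 * k) * (riemann_zeta_nat (2 * k) * Z (N div d)) * (C (N div d) / Q.const))"
    using assms(3) by (simp add: field_simps)
  also have "\<dots> = 1 / Q.const * riemann_zeta_nat (2 * k) * real N ^ k * (\<Sum>d\<in>{d. 0 < d \<and> d dvd N}. 1 / real d ^ (2 * k) * Z (N div d) * C (N div d))"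
    by (simp add: sum_distrib_left mult_ac)
  \<comment> \<open>The reciprocal of B(k, k) gives (2k - 1) times the binomial coefficient, that of
    D^(k - 1/2) the power of D.\<close>
  also have "1 / Q.const = real (2 * k - 1) * real_of_int D powr (1 / 2 - real k) * real ((2 * k - 2) choose (k - 1))"
  proof -
    have k1: "2 * (k - 1) + 1 = 2 * k - 1" "2 * (k - 1) = 2 * k - 2" using k2 by auto
    have "beta_poly (k - 1) 1 * (real (2 * k - 1) * real ((2 * k - 2) choose (k - 1))) = 1"
      using beta_poly_1_real[of "k - 1"] k2 unfolding k1 by simp
    moreover have "sqrt (of_int D) ^ (2 * k - 1) * real_of_int D powr (1 / 2 - real k) = 1"
      using assms(2,4) by (intro sqrt_power_powr) auto
    moreover have "\<beta> * s * (x * y * c) = (\<beta> * (x * c)) * (s * y)" for \<beta> s x y c :: real by simp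
    ultimately have "Q.const * (real (2 * k - 1) * real_of_int D powr (1 / 2 - real k) * real ((2 * k - 2) choose (k - 1))) = 1"
      unfolding Q.const_def by (simp only: mult_1_left)
    moreover have "1 / x = y" if "x * y = 1" for x y :: real
      using that by (cases "x = 0") (auto simp: field_simps)
    ultimately show ?thesis by blast
  qed
  also have "(\<Sum>d\<in>{d. 0 < d \<and> d dvd N}. 1 / real d ^ (2 * k) * Z (N div d) * C (N div d)) =
    (\<Sum>d\<in>{d. 0 < d \<and> d dvd N}. 1 / real d ^ (2 * k) * Z (N div d) *
      (\<Sum>b\<in>{b :: int. real_of_int \<bar>b\<bar> < sqrt (real_of_int D) \<and> b mod (2 * int (N div d)) = 1 mod (2 * int (N div d))}.
             sigma_div (k - 1) (nat ((int d * (D - b ^ 2)) div (4 * int N)))))"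
    by (intro sum.cong refl arg_cong2[of _ _ _ _ "(*)"] C_eq)
  finally show ?thesis unfolding Z_def by (simp only: mult_ac)
qed

end
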